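(* Let $\beta\in(0,1)$, $A<0$, $\gamma\in(0,1)$ with $\beta+\gamma>1$, and $p>\frac1\beta$. Let $h:\mathbb{R}\to\mathbb{R}$ be a non-decreasing and locally Lipschitz function which is concave on $\mathbb{R}_+$ and convex on $\mathbb{R}_-\cup\{0\}$, and suppose there are $\delta_0>0$ and $C>0$ such that $A+C<0$ and $|h(x)|\le C|x|$ for $|x|<\delta_0$. Let $f\in C^1((0,\infty))$ be a positive function with negative derivative such that $r\mapsto r^\gamma|\dot f(r)|$ belongs to $L^1([0,\infty))$ and $r\mapsto r^\gamma f(r)$ belongs to $L^1([0,\infty))\cap L^p([0,\infty))$. Let $B^\gamma$ be a fractional Brownian motion with Hurst parameter $\gamma$ and consider $$X(t)=\xi_t+\frac{1}{\Gamma(\beta)}\int_0^t (t-s)^{\beta-1}[A X(s)+h(X(s))]\,ds+\frac{1}{\Gamma(\beta+1)}\int_0^t(t-s)^{\beta}f(s)\,dB^\gamma_s,\qquad t\ge0.\qquad ( * )$$ Let $\mathcal{E}$ be the class of functions, with $\|\cdot\|_{\mathcal{X}}$, defined in the context, and let $\tilde{\mathcal{E}}$ be the set of processes $\xi=\xi^{(1)}-\xi^{(2)}$ with $\xi^{(1)},\xi^{(2)}$ two non-negative, non-decreasing and continuous processes belonging to $\mathcal{E}$ in the mean. Then the solution of $( * )$ is $(\tilde{\mathcal{E}},p)$-stable in the mean, that is: for a given $\varepsilon>0$ there is $\delta>0$ such that $\sup_{t\ge0}\mathbf{E}|X(t)|<\varepsilon$ for any $\xi\in\tilde{\mathcal{E}}$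 such that $$\big\|\mathbf{E}|\xi|\big\|_{\mathcal{X}}+\|f(\cdot)\cdot^\gamma\|_{L^1([0,\infty))}+\|f(\cdot)\cdot^\gamma\|_{L^p([0,\infty))}+\|\dot f(\cdot)\cdot^\gamma\|_{L^1([0,\infty))}<\delta,$$ where, for $\xi=\xi^{(1)}-\xi^{(2)}\in\tilde{\mathcal{E}}$, the first term is understood as $\|\mathbf{E}|\xi^{(1)}|\|_{\mathcal{X}}+\|\mathbf{E}|\xi^{(2)}|\|_{\mathcal{X}}$.
   Context: All random variables live on a complete probability space, $\mathbf{E}$ is expectation, $\Gamma$ is the Gamma function, and $E_{a,b}(z)=\sum_{k\ge0} z^k/\Gamma(ka+b)$ is the Mittag-Leffler function. Fractional Brownian motion with Hurst parameter $\gamma$ is the centered Gaussian process with covariance $\frac12(s^{2\gamma}+t^{2\gamma}-|t-s|^{2\gamma})$. Equation $( * )$ is interpreted path by path, $\xi$ is a continuous stochastic process, solutions are continuous, and the integral with respect to $B^\gamma$ is a pathwise Young integral (limit of Riemann sums as the mesh of the partition tends to $0$). As a standing assumption, $f$ is a $\tau$-Hölder continuous function in $C^1(\mathbb{R}_+)$ with $\tau+\gamma>1$. The derivative of $f$ is $\dot f$, and $f(\cdot)\cdot^\gamma$ denotes $s\mapsto f(s)s^\gamma$. A continuous process $\xi$ belongs to $\mathcal{E}$ in the mean if the function $\mathbf{E}(|\xi|)$, i.e. $t\mapsto\mathbf{E}|\xi_t|$, belongs to $\mathcal{E}$. The classes of functions are: - $\mathcal{E}^1$: the continuous functions $\xi$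 on $[0,\infty)$ for which there is $\xi_\infty\in\mathbb{R}$ such that, given $\varepsilon>0$, there exists $t_0>0$ with $|\xi_s-\xi_\infty|\le\varepsilon$ for any $s\ge t_0$; here $\|\xi\|_{\mathcal{X}^1}=\sup_{t\ge0}|\xi_t|$. - $\mathcal{E}^2$: the functions $\xi$ with a continuous derivative on $\mathbb{R}_+$ such that $\lim_{t\to\infty}|\xi_t|/t^\beta=0$ and $|\xi_t'|\le \tilde C/t^{1-\upsilon}$ for some $\upsilon\in(0,\beta)$ and some $\tilde C\in\mathbb{R}$; here $\|\xi\|_{\mathcal{X}^2}=\sup_{t\ge0}|\xi_tE_{\beta,1}(At^\beta)|+\sup_{t\ge0}|t^{1-\upsilon}\xi'_t|$. - $\mathcal{E}^3$: the continuous functions of the form $\xi_t=\frac{1}{\Gamma(\eta)}\int_0^t(t-s)^{\eta-1}g(s)\,ds$ with $g\in L^1([0,\infty))\cap L^{r}([0,\infty))$, $\eta\in(0,\beta+1)$ and $r>\max(1/\eta,1)$; here $\|\xi\|_{\mathcal{X}^3}=\|g\|_{L^1([0,\infty))}+\|g\|_{L^{r}([0,\infty))}$. $\mathcal{E}=\{\zeta\in C([0,\infty)):\ \zeta=\sum_{i=1}^3\zeta^{(i)},\ \zeta^{(i)}\in\mathcal{E}^i\}$, with $\|\zeta\|_{\mathcal{X}}=\sum_{i=1}^3\|\zeta^{(i)}\|_{\mathcal{X}^i}$. *)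

theory Defs
  imports "HOL-Probability.Probability"
begin

text \<open>
  Functions of time are functions \<open>real \<Rightarrow> real\<close> of which only the restriction to \<open>{0..}\<close> matters;
  processes are written \<open>\<xi> t \<omega>\<close>, time first. Properties of paths are required almost surely.
\<close>

definition mittag_leffler :: "real \<Rightarrow> real \<Rightarrow> real \<Rightarrow> real" where
  "mittag_leffler a b z = (\<Sum>k. z ^ k / Gamma (real k * a + b))"

definition lp_space :: "real \<Rightarrow> (real \<Rightarrow> real) set" where
  "lp_space q = {g. set_borel_measurable lborel {0..} g \<and>
     set_integrable lborel {0..} (\<lambda>s. \<bar>g s\<bar> powr q)}"

definition lp_norm :: "real \<Rightarrow> (real \<Rightarrow> real) \<Rightarrow> real" where
  "lp_norm q g = (LINT s:{0..}|lborel. \<bar>g s\<bar> powr q) powr (1 / q)"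

definition riemann_liouville :: "real \<Rightarrow> (real \<Rightarrow> real) \<Rightarrow> real \<Rightarrow> real" where
  "riemann_liouville \<eta> g t =
     1 / Gamma \<eta> * (LINT s:{0..t}|lborel. (t - s) powr (\<eta> - 1) * g s)"


section \<open>The classes of functions and their norms\<close>

text \<open>
  The norms are extended nonnegative reals. The parameters \<open>\<upsilon>\<close>, \<open>\<eta>\<close>, \<open>r\<close>, the density \<open>g\<close> and the
  summands \<open>\<zeta>1\<close>, \<open>\<zeta>2\<close>, \<open>\<zeta>3\<close> are not determined by the function. The norm is the infimum over all
  admissible choices, so that it is below \<open>\<delta>\<close> iff the expression in the definition is below \<open>\<delta>\<close>
  for some choice.
\<close>

definition class_E1 :: "(real \<Rightarrow> real) set" where
  "class_E1 = {\<xi>. continuous_on {0..} \<xi> \<and> (\<exists>l. (\<xi> \<longlongrightarrow> l) at_top)}"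

definition norm_X1 :: "(real \<Rightarrow> real) \<Rightarrow> ennreal" where
  "norm_X1 \<xi> = (SUP t\<in>{0..}. ennreal \<bar>\<xi> t\<bar>)"

text \<open>
  The derivative is only required on \<open>(0,\<infinity>)\<close>, as its bound is allowed to blow up at \<open>0\<close>.
\<close>

definition class_E2 :: "real \<Rightarrow> (real \<Rightarrow> real) set" where
  "class_E2 \<beta> = {\<xi>. continuous_on {0..} \<xi> \<and> \<xi> C1_differentiable_on {0<..} \<and>
     ((\<lambda>t. \<bar>\<xi> t\<bar> / t powr \<beta>) \<longlongrightarrow> 0) at_top \<and>
     (\<exists>\<upsilon>\<in>{0<..<\<beta>}. \<exists>c. \<forall>t>0. \<bar>deriv \<xi> t\<bar> \<le> c / t powr (1 - \<upsilon>))}"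

text \<open>
  An exponent \<open>\<upsilon>\<close> for which the bound on the derivative fails gives the value \<open>\<infinity>\<close> and does not
  affect the infimum. Note \<open>0 powr (1 - \<upsilon>) = 0\<close>, so \<open>t = 0\<close> does not contribute to the supremum.
\<close>

definition norm_X2 :: "real \<Rightarrow> real \<Rightarrow> (real \<Rightarrow> real) \<Rightarrow> ennreal" where
  "norm_X2 \<beta> A \<xi> =
     (SUP t\<in>{0..}. ennreal \<bar>\<xi> t * mittag_leffler \<beta> 1 (A * t powr \<beta>)\<bar>) +
     (INF \<upsilon>\<in>{0<..<\<beta>}. SUP t\<in>{0..}. ennreal \<bar>t powr (1 - \<upsilon>) * deriv \<xi> t\<bar>)"

definition E3_representation ::
    "real \<Rightarrow> (real \<Rightarrow> real) \<Rightarrow> (real \<times> real \<times> (real \<Rightarrow> real)) set" where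
  "E3_representation \<beta> \<xi> = {(\<eta>, r, g). 0 < \<eta> \<and> \<eta> < \<beta> + 1 \<and> r > max (1 / \<eta>) 1 \<and>
     g \<in> lp_space 1 \<inter> lp_space r \<and> (\<forall>t\<ge>0. \<xi> t = riemann_liouville \<eta> g t)}"

definition class_E3 :: "real \<Rightarrow> (real \<Rightarrow> real) set" where
  "class_E3 \<beta> = {\<xi>. continuous_on {0..} \<xi> \<and> E3_representation \<beta> \<xi> \<noteq> {}}"

definition norm_X3 :: "real \<Rightarrow> (real \<Rightarrow> real) \<Rightarrow> ennreal" where
  "norm_X3 \<beta> \<xi> =
     (INF (\<eta>, r, g)\<in>E3_representation \<beta> \<xi>. ennreal (lp_norm 1 g) + ennreal (lp_norm r g))"

definition E_decomposition ::
    "real \<Rightarrow> (real \<Rightarrow> real) \<Rightarrow> ((real \<Rightarrow> real) \<times> (real \<Rightarrow> real) \<times> (real \<Rightarrow> real)) set" where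
  "E_decomposition \<beta> \<zeta> = {(\<zeta>1, \<zeta>2, \<zeta>3). \<zeta>1 \<in> class_E1 \<and> \<zeta>2 \<in> class_E2 \<beta> \<and> \<zeta>3 \<in> class_E3 \<beta> \<and>
     (\<forall>t\<ge>0. \<zeta> t = \<zeta>1 t + \<zeta>2 t + \<zeta>3 t)}"

definition class_E :: "real \<Rightarrow> (real \<Rightarrow> real) set" where
  "class_E \<beta> = {\<zeta>. continuous_on {0..} \<zeta> \<and> E_decomposition \<beta> \<zeta> \<noteq> {}}"

definition norm_X :: "real \<Rightarrow> real \<Rightarrow> (real \<Rightarrow> real) \<Rightarrow> ennreal" where
  "norm_X \<beta> A \<zeta> =
     (INF (\<zeta>1, \<zeta>2, \<zeta>3)\<in>E_decomposition \<beta> \<zeta>. norm_X1 \<zeta>1 + norm_X2 \<beta> A \<zeta>2 + norm_X3 \<beta> \<zeta>3)"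


section \<open>Processes\<close>

definition mean_abs :: "'a measure \<Rightarrow> (real \<Rightarrow> 'a \<Rightarrow> real) \<Rightarrow> real \<Rightarrow> real" where
  "mean_abs M \<xi> t = (\<integral>\<omega>. \<bar>\<xi> t \<omega>\<bar> \<partial>M)"

definition continuous_process :: "'a measure \<Rightarrow> (real \<Rightarrow> 'a \<Rightarrow> real) \<Rightarrow> bool" where
  "continuous_process M \<xi> \<longleftrightarrow>
     (\<forall>t\<ge>0. \<xi> t \<in> borel_measurable M) \<and> (AE \<omega> in M. continuous_on {0..} (\<lambda>t. \<xi> t \<omega>))"

definition in_E_in_mean :: "'a measure \<Rightarrow> real \<Rightarrow> (real \<Rightarrow> 'a \<Rightarrow> real) \<Rightarrow> bool" where
  "in_E_in_mean M \<beta> \<xi> \<longleftrightarrow> continuous_process M \<xi> \<and>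
     (\<forall>t\<ge>0. integrable M (\<xi> t)) \<and> mean_abs M \<xi> \<in> class_E \<beta>"

text \<open>
  The processes \<open>\<xi>1\<close>, \<open>\<xi>2\<close> whose differences \<open>\<xi>1 - \<xi>2\<close> form the class \<open>E\<close> with a tilde.
\<close>

definition monotone_E_process :: "'a measure \<Rightarrow> real \<Rightarrow> (real \<Rightarrow> 'a \<Rightarrow> real) \<Rightarrow> bool" where
  "monotone_E_process M \<beta> \<xi> \<longleftrightarrow> in_E_in_mean M \<beta> \<xi> \<and>
     (AE \<omega> in M. (\<forall>t\<ge>0. 0 \<le> \<xi> t \<omega>) \<and> mono_on {0..} (\<lambda>t. \<xi> t \<omega>))"

definition gaussian_variable :: "'a measure \<Rightarrow> ('a \<Rightarrow> real) \<Rightarrow> bool" where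
  "gaussian_variable M Y \<longleftrightarrow> Y \<in> borel_measurable M \<and>
     (\<exists>\<mu>. (AE \<omega> in M. Y \<omega> = \<mu>) \<or> (\<exists>\<sigma>>0. distributed M lborel Y (normal_density \<mu> \<sigma>)))"

definition gaussian_process :: "'a measure \<Rightarrow> (real \<Rightarrow> 'a \<Rightarrow> real) \<Rightarrow> bool" where
  "gaussian_process M B \<longleftrightarrow>
     (\<forall>T c. finite T \<and> T \<subseteq> {0..} \<longrightarrow> gaussian_variable M (\<lambda>\<omega>. \<Sum>t\<in>T. c t * B t \<omega>))"

text \<open>
  As usual, and as needed for pathwise integration, the continuous version is meant.
\<close>

definition fractional_brownian_motion ::
    "'a measure \<Rightarrow> real \<Rightarrow> (real \<Rightarrow> 'a \<Rightarrow> real) \<Rightarrow> bool" where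
  "fractional_brownian_motion M \<gamma> B \<longleftrightarrow>
     continuous_process M B \<and> gaussian_process M B \<and>
     (\<forall>t\<ge>0. (\<integral>\<omega>. B t \<omega> \<partial>M) = 0) \<and>
     (\<forall>s\<ge>0. \<forall>t\<ge>0. (\<integral>\<omega>. B s \<omega> * B t \<omega> \<partial>M) =
        1 / 2 * (s powr (2 * \<gamma>) + t powr (2 * \<gamma>) - \<bar>t - s\<bar> powr (2 * \<gamma>)))"

definition has_young_integral ::
    "(real \<Rightarrow> real) \<Rightarrow> (real \<Rightarrow> real) \<Rightarrow> real \<Rightarrow> real \<Rightarrow> real \<Rightarrow> bool" where
  "has_young_integral g b u v I \<longleftrightarrow>
     (\<forall>e>0. \<exists>d>0. \<forall>D. D tagged_division_of {u..v} \<and> (\<forall>(x, K)\<in>D. Sup K - Inf K < d) \<longrightarrow>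
        \<bar>(\<Sum>(x, K)\<in>D. g x * (b (Sup K) - b (Inf K))) - I\<bar> < e)"

definition volterra_solution ::
    "'a measure \<Rightarrow> real \<Rightarrow> real \<Rightarrow> (real \<Rightarrow> real) \<Rightarrow> (real \<Rightarrow> real) \<Rightarrow>
     (real \<Rightarrow> 'a \<Rightarrow> real) \<Rightarrow> (real \<Rightarrow> 'a \<Rightarrow> real) \<Rightarrow> (real \<Rightarrow> 'a \<Rightarrow> real) \<Rightarrow> bool" where
  "volterra_solution M \<beta> A h f B \<xi> X \<longleftrightarrow> continuous_process M X \<and>
     (AE \<omega> in M. \<forall>t\<ge>0. \<exists>I.
        has_young_integral (\<lambda>s. (t - s) powr \<beta> * f s) (\<lambda>s. B s \<omega>) 0 t I \<and>
        X t \<omega> = \<xi> t \<omega>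
          + 1 / Gamma \<beta> * (LINT s:{0..t}|lborel. (t - s) powr (\<beta> - 1) * (A * X s \<omega> + h (X s \<omega>)))
          + 1 / Gamma (\<beta> + 1) * I)"


section \<open>Coefficients\<close>

definition locally_lipschitz :: "(real \<Rightarrow> real) \<Rightarrow> bool" where
  "locally_lipschitz h \<longleftrightarrow> (\<forall>x. \<exists>u>0. \<exists>L. L-lipschitz_on (cball x u) h)"

definition hoelder_on :: "real \<Rightarrow> real set \<Rightarrow> (real \<Rightarrow> real) \<Rightarrow> bool" where
  "hoelder_on \<tau> S f \<longleftrightarrow> (\<exists>K. \<forall>s\<in>S. \<forall>t\<in>S. \<bar>f s - f t\<bar> \<le> K * \<bar>s - t\<bar> powr \<tau>)"

definition admissible_noise_coeff :: "real \<Rightarrow> real \<Rightarrow> (real \<Rightarrow> real) \<Rightarrow> bool" where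
  "admissible_noise_coeff \<gamma> p f \<longleftrightarrow>
     f C1_differentiable_on {0<..} \<and> (\<exists>\<tau>. \<tau> + \<gamma> > 1 \<and> hoelder_on \<tau> {0..} f) \<and>
     (\<forall>s>0. f s > 0 \<and> deriv f s < 0) \<and>
     (\<lambda>s. \<bar>deriv f s\<bar> * s powr \<gamma>) \<in> lp_space 1 \<and>
     (\<lambda>s. f s * s powr \<gamma>) \<in> lp_space 1 \<inter> lp_space p"

end

theory Submission
  imports Defs
begin

text \<open>
  Write \<open>l = -A\<close>, let \<open>k\<close> be the fractional kernel \<open>t\<^bsup>\<beta>-1\<^esup> / \<Gamma>(\<beta>)\<close> and \<open>R\<close> its resolvent, \<open>R / l + k * R = k\<close>.
  As \<open>k\<close> is log-convex and decreasing, \<open>R\<close> is non-negative with mass at most \<open>1\<close>. Integration by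
  parts turns the Young integral into fractional integrals of \<open>f B\<close> and \<open>|f'| B\<close>, and variation of
  constants with \<open>|h(x)| \<le> C |x|\<close> gives, path by path,
  \<open>|X| \<le> D \<xi>1 + D \<xi>2 + R * (C |X| + f |B| + \<integral> |f'| |B|) / l\<close>, where \<open>D m = m - R * m\<close> is non-negative
  on non-negative non-decreasing functions. Taking expectations, the term with \<open>|X|\<close> is absorbed
  because \<open>C / l < 1\<close>, and it remains to bound \<open>D m\<close> for the means \<open>m\<close> of \<open>\<xi>1\<close> and \<open>\<xi>2\<close> linearly in
  their norm, uniformly in the parameters of the classes. To this end \<open>m\<close> is compared with a
  function \<open>P\<close> whose increments are bounded by those of \<open>t\<^bsup>\<beta>\<^esup>\<close> (or a superposition of shifts of such
  functions). Then \<open>D P\<close> is bounded because \<open>D (t\<^bsup>\<beta>\<^esup>)\<close> is, and \<open>m - P\<close> is bounded because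
  \<open>m\<close> is monotone and the averages of \<open>m - P\<close> over unit windows are bounded.
\<close>


section \<open>The Mittag-Leffler function and fractional kernels\<close>

text \<open>The sign structure explains the monotone class: D subtracts an average, so |D \<xi>| is
  not controlled by D |\<xi>| for a general process, whereas D \<xi>1 and D \<xi>2 are non-negative
  and expectation commutes with D. Only deterministic monotone means remain. The obstacle is
  uniformity: \<delta> is fixed before \<upsilon>, \<eta>, r and the decomposition are known. A
  pointwise bound on a fractional integral of order \<eta> through the L^r norm degenerates as r
  approaches 1 / \<eta>, so for \<eta> \<le> 1 it is measured only in mean over unit windows, where
  the L^1 norm of g is enough. What grows, namely the part of order \<eta> > 1 and \<zeta>2 after a
  time t0 depending on \<beta> and A alone, goes into P. Of the resolvent, two bounds enter the
  noise estimate: its mass is at most 1, which serves the term in f', and R / l \<le> k, which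
  together with p > 1 / \<beta> serves the term in f.\<close>

lemma Gamma_shift_lower_bound:
  fixes x a :: real
  assumes "x > 1" "a > 0"
  shows "Gamma x * (x - 1) powr a \<le> Gamma (x + a)"
proof -
  \<comment> \<open>Log-convexity is applied at the convex combination x of x - 1 and x + a.
    Multiplying by 1 + a clears the weights, and Gamma x = (x - 1) Gamma (x - 1) then removes Gamma
    (x - 1).\<close>
  define u where "u = 1 / (1 + a)"
  have u: "0 \<le> u" "u \<le> 1" "u * (1 + a) = 1" "(1 - u) * (1 + a) = a"
    using assms by (auto simp: u_def field_simps)
  have x: "(1 - u) * (x - 1) + u * (x + a) = x"
    using u(3) by (simp add: algebra_simps)
  have "ln (Gamma x) \<le> (1 - u) * ln (Gamma (x - 1)) + u * ln (Gamma (x + a))"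
    using convex_onD[OF log_convex_Gamma_real, of u "x - 1" "x + a"] u assms x by simp
  then have "(1 + a) * ln (Gamma x) \<le> (1 + a) * ((1 - u) * ln (Gamma (x - 1)) + u * ln (Gamma (x + a)))"
    using assms by (intro mult_left_mono) auto
  also have "\<dots> = ((1 - u) * (1 + a)) * ln (Gamma (x - 1)) + (u * (1 + a)) * ln (Gamma (x + a))"
    by (simp add: algebra_simps)
  also have "\<dots> = a * ln (Gamma (x - 1)) + ln (Gamma (x + a))"
    using u by simp
  finally have le: "(1 + a) * ln (Gamma x) \<le> a * ln (Gamma (x - 1)) + ln (Gamma (x + a))" .
  have "x - 1 \<notin> \<int>\<^sub>\<le>\<^sub>0"
    using assms by (auto elim!: nonpos_Ints_cases)
  then have "Gamma x = (x - 1) * Gamma (x - 1)"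
    using Gamma_plus1[of "x - 1"] by simp
  then have "ln (Gamma x) = ln (x - 1) + ln (Gamma (x - 1))"
    using assms Gamma_real_pos[of "x - 1"] by (simp add: ln_mult del: Gamma_real_pos)
  with le have "ln (Gamma x) + a * ln (x - 1) \<le> ln (Gamma (x + a))"
    by (simp add: algebra_simps)
  then have "exp (ln (Gamma x) + a * ln (x - 1)) \<le> exp (ln (Gamma (x + a)))"
    by simp
  then show ?thesis
    using assms by (simp add: exp_add powr_def)
qed

lemma mittag_leffler_summable:
  fixes a b z :: real
  assumes "a > 0" "b > 0"
  shows "summable (\<lambda>k. z ^ k / Gamma (real k * a + b))"
proof -
  \<comment> \<open>From N0 on, the argument x of Gamma satisfies (x - 1)^a \<ge> 2 |z| + 1, so
    \<open>Gamma_shift_lower_bound\<close> keeps the ratio of consecutive terms at most 1 /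
    2.\<close>
  obtain N0 :: nat where N0: "real N0 > (((2 * \<bar>z\<bar> + 1) powr (1 / a)) + 1) / a"
    using reals_Archimedean2 by blast
  show ?thesis
  proof (rule summable_ratio_test[of "1/2" N0])
    fix n :: nat
    assume n: "n \<ge> N0"
    define x where "x = real n * a + b"
    have "real N0 * a \<le> real n * a"
      using n assms by (intro mult_right_mono) auto
    moreover have "real N0 * a > (2 * \<bar>z\<bar> + 1) powr (1 / a) + 1"
      using N0 assms by (simp add: field_simps)
    ultimately have x: "x - 1 > (2 * \<bar>z\<bar> + 1) powr (1 / a)"
      using assms(2) unfolding x_def by linarith
    moreover have "(2 * \<bar>z\<bar> + 1) powr (1 / a) > 0"
      by (intro powr_gt_zero[THEN iffD2]) auto
    ultimately have x1: "x > 1"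
      by linarith
    have pos: "(2 * \<bar>z\<bar> + 1) powr (1 / a) > 0"
      by (intro powr_gt_zero[THEN iffD2]) auto
    have "((2 * \<bar>z\<bar> + 1) powr (1 / a)) powr a \<le> (x - 1) powr a"
      using x pos assms by (intro powr_mono2) auto
    then have "2 * \<bar>z\<bar> + 1 \<le> (x - 1) powr a"
      using assms by (simp add: powr_powr)
    then have "Gamma x * (2 * \<bar>z\<bar>) \<le> Gamma x * (x - 1) powr a"
      using x1 by (intro mult_left_mono) (auto intro!: less_imp_le Gamma_real_pos)
    also have "\<dots> \<le> Gamma (x + a)"
      using x1 assms by (intro Gamma_shift_lower_bound) auto
    finally have G: "Gamma x * (2 * \<bar>z\<bar>) \<le> Gamma (x + a)" .
    have xa: "real (Suc n) * a + b = x + a"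
      by (simp add: x_def algebra_simps)
    have Gp: "Gamma x > 0" "Gamma (x + a) > 0"
      using x1 assms by (auto intro!: Gamma_real_pos)
    have "\<bar>z\<bar> ^ n * (Gamma x * (2 * \<bar>z\<bar>)) \<le> \<bar>z\<bar> ^ n * Gamma (x + a)"
      using G by (intro mult_left_mono) auto
    then have "\<bar>z\<bar> ^ Suc n / Gamma (x + a) \<le> 1 / 2 * (\<bar>z\<bar> ^ n / Gamma x)"
      using Gp by (simp add: field_simps)
    then show "norm (z ^ Suc n / Gamma (real (Suc n) * a + b)) \<le> 1 / 2 * norm (z ^ n / Gamma (real n * a + b))"
      unfolding xa using Gp by (simp add: x_def[symmetric] power_abs abs_mult)
  qed simp
qed

lemma isCont_mittag_leffler:
  assumes "a > 0" "b > 0"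
  shows "isCont (mittag_leffler a b) z"
proof -
  have "isCont (\<lambda>z. \<Sum>k. (1 / Gamma (real k * a + b)) * z ^ k) z"
    using mittag_leffler_summable[OF assms] by (intro isCont_powser_converges_everywhere) simp
  then show ?thesis
    unfolding mittag_leffler_def by simp
qed

lemma mittag_leffler_0: "mittag_leffler a b 0 = 1 / Gamma b"
proof -
  have "(\<lambda>k. 0 ^ k / Gamma (real k * a + b)) sums (0 ^ 0 / Gamma (real 0 * a + b))"
    by (intro sums_finite[of "{0}", simplified]) auto
  then show ?thesis
    unfolding mittag_leffler_def by (simp add: sums_iff)
qed

text \<open>One positive c must serve all orders \<eta> of the third class at once: 1 / Gamma \<eta>
  for \<eta> > 1 and 1 / Gamma (\<eta> + 1) for \<eta> \<le> 1 are then at most 1 / c. The minimum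
  on [1, 2] works, since the factor x - 1 in Gamma x = (x - 1) Gamma (x - 1) is at least 1 beyond
  2.\<close>

lemma Gamma_lower_bound: "\<exists>c>0. \<forall>x\<ge>1. c \<le> Gamma (x::real)"
proof -
  have "continuous_on {1..2} (Gamma :: real \<Rightarrow> real)"
    by (intro continuous_on_Gamma) (auto elim!: nonpos_Ints_cases)
  then obtain y where y: "y \<in> {1..2}" "\<And>x. x \<in> {1..2} \<Longrightarrow> Gamma y \<le> Gamma (x::real)"
    using continuous_attains_inf[of "{1..2::real}" Gamma] by auto
  have "Gamma y \<le> Gamma x" if "1 \<le> x" "x \<le> real n + 2" for x n
    using that
  proof (induction n arbitrary: x)
    case 0
    then show ?case using y by auto
  next
    case (Suc n)
    show ?case
    proof (cases "x \<le> 2")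
      case False
      then have "x - 1 \<notin> \<int>\<^sub>\<le>\<^sub>0"
        by (auto elim!: nonpos_Ints_cases)
      then have eq: "Gamma x = (x - 1) * Gamma (x - 1)"
        using Gamma_plus1[of "x - 1"] by simp
      have "Gamma y \<le> Gamma (x - 1)"
        using Suc False by auto
      also have "\<dots> \<le> (x - 1) * Gamma (x - 1)"
        using False Gamma_real_pos[of "x - 1"] mult_right_mono[of 1 "x - 1" "Gamma (x - 1)"] by simp
      finally show ?thesis
        using eq by simp
    qed (use Suc y in auto)
  qed
  then have "\<forall>x\<ge>1. Gamma y \<le> Gamma x"
    by (meson real_arch_simple add_increasing2 order_trans zero_le_numeral)
  then show ?thesis
    using y Gamma_real_pos[of y] by (intro exI[of _ "Gamma y"]) auto
qed

text \<open>Extended by 0 to t \<le> 0, so that the convolution of two kernels is a plain integral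
  over the line. The kernel of order 1 is the indicator of the positive half-line and later
  expresses integrals over intervals.\<close>

definition frac_kernel :: "real \<Rightarrow> real \<Rightarrow> real" where
  "frac_kernel a t = (if t > 0 then t powr (a - 1) / Gamma a else 0)"

lemma frac_kernel_nonneg: "a > 0 \<Longrightarrow> frac_kernel a t \<ge> 0"
  by (auto simp: frac_kernel_def intro!: divide_nonneg_pos)

lemma frac_kernel_measurable [measurable]: "frac_kernel a \<in> borel_measurable borel"
  unfolding frac_kernel_def by measurable

text \<open>Semigroup law of fractional integration: substituting s = t x turns the integral into a
  Beta function, whose Gamma quotient matches the normalisation of the kernels.\<close>

lemma frac_kernel_conv:
  assumes "a > 0" "b > 0" "t > 0"
  shows "has_bochner_integral lborel (\<lambda>s. frac_kernel a (t - s) * frac_kernel b s) (frac_kernel (a + b) t)"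
proof -
  let ?g = "\<lambda>x. indicator {0..1} x * (x powr (b - 1) * (1 - x) powr (a - 1))"
  have int: "set_integrable lborel {0..1} (\<lambda>x. x powr (b - 1) * (1 - x) powr (a - 1))"
    using integrable_Beta[of b a] assms by simp
  have val: "(LINT x:{0..1}|lborel. x powr (b - 1) * (1 - x) powr (a - 1)) = Beta b a"
    using has_integral_Beta_real[of b a] set_borel_integral_eq_integral(2)[OF int] assms
    by (metis integral_unique)
  have g: "has_bochner_integral lborel ?g (Beta b a)"
    using int val by (simp add: has_bochner_integral_iff set_integrable_def set_lebesgue_integral_def)
  define c where "c = t powr (a + b - 1) / (Gamma a * Gamma b)"
  have "has_bochner_integral lborel (\<lambda>x. c * ?g x) (c * Beta b a)"
    using g by (intro has_bochner_integral_mult_right) auto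
  moreover have "c * ?g x = t * (frac_kernel a (t - (0 + t * x)) * frac_kernel b (0 + t * x))" for x
  proof (cases "0 < x \<and> x < 1")
    case True
    then have *: "t - t * x = t * (1 - x)" "t * (1 - x) > 0" "t * x > 0"
      using assms by (auto simp: algebra_simps)
    have "t powr (a + b - 1) = t * (t powr (a - 1) * t powr (b - 1))"
      using assms by (simp add: powr_diff powr_add field_simps)
    then show ?thesis
      using True * assms unfolding frac_kernel_def c_def
      by (simp add: * powr_mult)
  next
    case False
    then have "x \<le> 0 \<or> x \<ge> 1" by auto
    then have "\<not> (0 < t * x \<and> 0 < t - t * x)"
      using assms by (auto simp: zero_less_mult_iff)
    with False show ?thesis
      by (auto simp: frac_kernel_def indicator_def)
  qed
  ultimately have "has_bochner_integral lborel
      (\<lambda>x. t * (frac_kernel a (t - (0 + t * x)) * frac_kernel b (0 + t * x))) (c * Beta b a)"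
    by simp
  from has_bochner_integral_mult_right[of "1 / t", OF this]
  have "has_bochner_integral lborel
      (\<lambda>x. frac_kernel a (t - (0 + t * x)) * frac_kernel b (0 + t * x)) (c * Beta b a / t)"
    using assms by simp
  moreover have "c * Beta b a / t = frac_kernel (a + b) t /\<^sub>R \<bar>t\<bar>"
    using assms Gamma_real_pos[of a, THEN less_imp_neq] Gamma_real_pos[of b, THEN less_imp_neq]
    by (simp add: c_def frac_kernel_def Beta_def add.commute field_simps)
  ultimately show ?thesis
    using assms lborel_has_bochner_integral_real_affine_iff[of t "\<lambda>s. frac_kernel a (t - s) * frac_kernel b s" "frac_kernel (a+b) t" 0]
    by simp
qed

lemma frac_kernel_plus1:
  assumes "a > 0" "t > 0"
  shows "frac_kernel (a + 1) t = t powr a / (a * Gamma a)"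
proof -
  have "a \<notin> \<int>\<^sub>\<le>\<^sub>0"
    using assms by (auto elim!: nonpos_Ints_cases)
  then show ?thesis
    using assms Gamma_plus1[of a] by (simp add: frac_kernel_def)
qed

section \<open>The resolvent of the fractional kernel\<close>

text \<open>The Neumann series of l k: the kernel of order (n + 1) b is the (n + 1)-fold convolution
  power of k, so the sum formally solves R + l (k * R) = l k.\<close>

definition resolvent :: "real \<Rightarrow> real \<Rightarrow> real \<Rightarrow> real" where
  "resolvent b l t = (\<Sum>n. (-1) ^ n * l ^ (n + 1) * frac_kernel (real (n + 1) * b) t)"

lemma resolvent_summable:
  assumes "b > 0"
  shows "summable (\<lambda>n. \<bar>l\<bar> ^ (n + 1) * frac_kernel (real (n + 1) * b) t)"
proof (cases "t > 0")
  case True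
  have "summable (\<lambda>n. (\<bar>l\<bar> * t powr (b - 1)) * ((\<bar>l\<bar> * t powr b) ^ n / Gamma (real n * b + b)))"
    by (intro summable_mult mittag_leffler_summable assms)
  moreover have "(\<bar>l\<bar> * t powr (b - 1)) * ((\<bar>l\<bar> * t powr b) ^ n / Gamma (real n * b + b)) =
      \<bar>l\<bar> ^ (n + 1) * frac_kernel (real (n + 1) * b) t" for n
  proof -
    have "t powr (real (n + 1) * b - 1) = t powr (b - 1) * (t powr b) ^ n"
      using True by (simp add: powr_realpow[symmetric] powr_powr powr_add[symmetric] algebra_simps)
    moreover have "real (n + 1) * b = real n * b + b"
      by (simp add: algebra_simps)
    ultimately show ?thesis
      using True by (simp add: frac_kernel_def power_mult_distrib)
  qed
  ultimately show ?thesis by simp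
qed (simp add: frac_kernel_def)

lemma resolvent_nonpos: "t \<le> 0 \<Longrightarrow> resolvent b l t = 0"
  by (simp add: resolvent_def frac_kernel_def)

text \<open>The closed form reduces continuity of R at positive times and its sign near 0 to
  continuity of the Mittag-Leffler function.\<close>

lemma resolvent_eq_mittag_leffler:
  assumes "b > 0" "t > 0"
  shows "resolvent b l t = l * t powr (b - 1) * mittag_leffler b b (- l * t powr b)"
proof -
  have "(l * t powr (b - 1)) * ((- l * t powr b) ^ n / Gamma (real n * b + b)) =
      (-1) ^ n * l ^ (n + 1) * frac_kernel (real (n + 1) * b) t" for n
  proof -
    have "t powr (real (n + 1) * b - 1) = t powr (b - 1) * (t powr b) ^ n"
      using assms by (simp add: powr_realpow[symmetric] powr_powr powr_add[symmetric] algebra_simps)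
    moreover have "real (n + 1) * b = real n * b + b"
      by (simp add: algebra_simps)
    moreover have "(- l * t powr b) ^ n = (-1) ^ n * l ^ n * (t powr b) ^ n"
      by (metis mult_minus1 power_mult_distrib)
    ultimately show ?thesis
      using assms by (simp add: frac_kernel_def)
  qed
  then have "resolvent b l t = (\<Sum>n. (l * t powr (b - 1)) * ((- l * t powr b) ^ n / Gamma (real n * b + b)))"
    by (simp add: resolvent_def)
  then show ?thesis
    using suminf_mult[OF mittag_leffler_summable[of b b "- l * t powr b"], of "l * t powr (b - 1)"] assms
    by (simp add: mittag_leffler_def)
qed

lemma resolvent_measurable [measurable]: "resolvent b l \<in> borel_measurable borel"
  unfolding resolvent_def by measurable

lemma isCont_resolvent:
  assumes "b > 0" "t > 0"
  shows "isCont (resolvent b l) t"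
proof -
  have p: "isCont (\<lambda>t. t powr c) t" for c
    using assms by (intro continuous_at_within_powr continuous_ident continuous_const) auto
  have "isCont (\<lambda>t. - l * t powr b) t"
    by (intro continuous_mult continuous_const p)
  then have "isCont (\<lambda>t. mittag_leffler b b (- l * t powr b)) t"
    by (rule isCont_o2[OF _ isCont_mittag_leffler[OF assms(1) assms(1)]])
  then have "isCont (\<lambda>t. l * t powr (b - 1) * mittag_leffler b b (- l * t powr b)) t"
    by (intro continuous_mult continuous_const p)
  moreover have "eventually (\<lambda>u. u > 0) (nhds t)"
    using assms eventually_nhds_in_open[of "{0<..}" t] by simp
  then have "eventually (\<lambda>u. resolvent b l u = l * u powr (b - 1) * mittag_leffler b b (- l * u powr b)) (nhds t)"
    by eventually_elim (use assms resolvent_eq_mittag_leffler in auto)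
  ultimately show ?thesis
    using isCont_cong by fastforce
qed

text \<open>Convolving the Neumann series with k raises each order by b and so shifts the series by
  one term. Sum and integral may be exchanged because the integrals of the absolute values again
  form a convergent series of this shape.\<close>

lemma resolvent_equation:
  assumes "b > 0" "l > 0" "t > 0"
  shows "has_bochner_integral lborel (\<lambda>s. frac_kernel b (t - s) * resolvent b l s)
           (frac_kernel b t - resolvent b l t / l)"
proof -
  define f where "f n s = (-1) ^ n * l ^ (n + 1) * (frac_kernel b (t - s) * frac_kernel (real (n + 1) * b) s)" for n s
  have base: "has_bochner_integral lborel (\<lambda>s. frac_kernel b (t - s) * frac_kernel (real (n + 1) * b) s)
      (frac_kernel (real (n + 2) * b) t)" for n
  proof -
    have "b + real (n + 1) * b = real (n + 2) * b"
      by (simp add: algebra_simps)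
    then show ?thesis
      using frac_kernel_conv[of b "real (n + 1) * b" t] assms by simp
  qed
  have f: "has_bochner_integral lborel (f n) ((-1) ^ n * l ^ (n + 1) * frac_kernel (real (n + 2) * b) t)" for n
    unfolding f_def by (intro has_bochner_integral_mult_right base)
  have nf: "has_bochner_integral lborel (\<lambda>s. norm (f n s)) (l ^ (n + 1) * frac_kernel (real (n + 2) * b) t)" for n
  proof -
    have "norm (f n s) = l ^ (n + 1) * (frac_kernel b (t - s) * frac_kernel (real (n + 1) * b) s)" for s
      using assms by (simp add: f_def abs_mult power_abs frac_kernel_nonneg)
    then show ?thesis
      by (simp only:) (intro has_bochner_integral_mult_right base)
  qed
  have sm: "summable (\<lambda>n. l ^ (n + 1) * frac_kernel (real (n + 2) * b) t)"
  proof -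
    have "summable (\<lambda>n. (1 / l) * (\<bar>l\<bar> ^ (Suc n + 1) * frac_kernel (real (Suc n + 1) * b) t))"
      using resolvent_summable[OF assms(1), of l t] by (intro summable_mult) (rule summable_Suc_iff[THEN iffD2])
    moreover have "(1 / l) * (\<bar>l\<bar> ^ (Suc n + 1) * frac_kernel (real (Suc n + 1) * b) t) =
        l ^ (n + 1) * frac_kernel (real (n + 2) * b) t" for n
      using assms by (simp add: add_ac)
    ultimately show ?thesis
      by (simp only:)
  qed
  have sf: "summable (\<lambda>n. norm (f n s))" for s
  proof -
    have "summable (\<lambda>n. frac_kernel b (t - s) * (\<bar>l\<bar> ^ (n + 1) * frac_kernel (real (n + 1) * b) s))"
      using resolvent_summable[OF assms(1)] by (intro summable_mult)
    then show ?thesis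
      using assms by (simp add: f_def abs_mult power_abs frac_kernel_nonneg mult_ac)
  qed
  have eq: "(\<Sum>n. f n s) = frac_kernel b (t - s) * resolvent b l s" for s
  proof -
    have "summable (\<lambda>n. norm ((-1) ^ n * l ^ (n + 1) * frac_kernel (real (n + 1) * b) s))"
      using resolvent_summable[OF assms(1), of l s] assms
      by (simp add: abs_mult power_abs frac_kernel_nonneg)
    then have "summable (\<lambda>n. (-1) ^ n * l ^ (n + 1) * frac_kernel (real (n + 1) * b) s)"
      by (rule summable_norm_cancel)
    from suminf_mult[OF this, of "frac_kernel b (t - s)"] show ?thesis
      by (simp add: f_def resolvent_def mult_ac)
  qed
  have int: "integrable lborel (f n)" for n
    using f has_bochner_integral_integrable by (auto simp: has_bochner_integral_iff)
  have AE: "AE s in lborel. summable (\<lambda>n. norm (f n s))"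
    using sf by simp
  have sn: "summable (\<lambda>n. LINT s|lborel. norm (f n s))"
  proof -
    have "(\<lambda>n. LINT s|lborel. norm (f n s)) = (\<lambda>n. l ^ (n + 1) * frac_kernel (real (n + 2) * b) t)"
      by (intro ext has_bochner_integral_integral_eq[OF nf])
    then show ?thesis
      by (rule ssubst) (rule sm)
  qed
  have i: "integrable lborel (\<lambda>s. \<Sum>n. f n s)"
    by (rule integrable_suminf[OF int AE sn])
  have "(\<lambda>n. LINT s|lborel. f n s) sums (LINT s|lborel. (\<Sum>n. f n s))"
    by (rule sums_integral[OF int AE sn])
  then have s1: "(\<lambda>n. (-1) ^ n * l ^ (n + 1) * frac_kernel (real (n + 2) * b) t) sums
      (LINT s|lborel. frac_kernel b (t - s) * resolvent b l s)"
  proof -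
    have 1: "(\<lambda>n. LINT s|lborel. f n s) = (\<lambda>n. (-1) ^ n * l ^ (n + 1) * frac_kernel (real (n + 2) * b) t)"
      by (intro ext has_bochner_integral_integral_eq[OF f])
    have 2: "(\<lambda>s. \<Sum>n. f n s) = (\<lambda>s. frac_kernel b (t - s) * resolvent b l s)"
      by (intro ext eq)
    assume "(\<lambda>n. LINT s|lborel. f n s) sums (LINT s|lborel. (\<Sum>n. f n s))"
    then show ?thesis
      unfolding 1 2 .
  qed
  \<comment> \<open>\<open>g\<close> is the series of R / l. Dropping its term k t and changing the
    sign leaves the shifted series.\<close>
  define g where "g n = (-1) ^ n * l ^ n * frac_kernel (real (n + 1) * b) t" for n
  have "summable (\<lambda>n. norm ((-1) ^ n * l ^ (n + 1) * frac_kernel (real (n + 1) * b) t))"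
    using resolvent_summable[OF assms(1), of l t] assms
    by (simp add: abs_mult power_abs frac_kernel_nonneg)
  then have "(\<lambda>n. (-1) ^ n * l ^ (n + 1) * frac_kernel (real (n + 1) * b) t) sums resolvent b l t"
    unfolding resolvent_def by (rule summable_sums[OF summable_norm_cancel])
  from sums_divide[OF this, of l]
  have "(\<lambda>n. (-1) ^ n * l ^ (n + 1) * frac_kernel (real (n + 1) * b) t / l) sums (resolvent b l t / l)" .
  then have "g sums (resolvent b l t / l)"
  proof -
    have "g = (\<lambda>n. (-1) ^ n * l ^ (n + 1) * frac_kernel (real (n + 1) * b) t / l)"
      using assms by (intro ext) (simp add: g_def)
    then show ?thesis
      using \<open>(\<lambda>n. (-1) ^ n * l ^ (n + 1) * frac_kernel (real (n + 1) * b) t / l) sums (resolvent b l t / l)\<close>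
      by simp
  qed
  then have "(\<lambda>n. g (Suc n)) sums (resolvent b l t / l - g 0)"
    by (simp add: sums_Suc_iff)
  from sums_minus[OF this] have "(\<lambda>n. - g (Suc n)) sums (frac_kernel b t - resolvent b l t / l)"
    by (simp add: g_def)
  moreover have "- g (Suc n) = (-1) ^ n * l ^ (n + 1) * frac_kernel (real (n + 2) * b) t" for n
    by (simp add: g_def)
  ultimately have "(\<lambda>n. (-1) ^ n * l ^ (n + 1) * frac_kernel (real (n + 2) * b) t) sums
      (frac_kernel b t - resolvent b l t / l)"
    by (simp only:)
  from sums_unique2[OF s1 this]
  have "(LINT s|lborel. frac_kernel b (t - s) * resolvent b l s) = frac_kernel b t - resolvent b l t / l" .
  with i show ?thesis
    by (simp add: eq has_bochner_integral_iff)
qed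


section \<open>Positivity and mass of the resolvent\<close>

lemma frac_kernel_conv_shift:
  assumes "a > 0" "b > 0" "u < t"
  shows "has_bochner_integral lborel (\<lambda>s. frac_kernel a (t - s) * frac_kernel b (s - u)) (frac_kernel (a + b) (t - u))"
proof -
  have "has_bochner_integral lborel (\<lambda>s. frac_kernel a (t - (u + 1 * s)) * frac_kernel b ((u + 1 * s) - u)) (frac_kernel (a + b) (t - u) /\<^sub>R \<bar>1\<bar>)"
    using frac_kernel_conv[of a b "t - u"] assms by (simp add: algebra_simps)
  then show ?thesis
    by (subst lborel_has_bochner_integral_real_affine_iff[of 1 _ _ u]) auto
qed

lemma frac_kernel_antimono:
  assumes "0 < b" "b \<le> 1" "0 < s" "s \<le> t"
  shows "frac_kernel b t \<le> frac_kernel b s"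
  using assms by (auto simp: frac_kernel_def intro!: divide_right_mono powr_mono2' less_imp_le[OF Gamma_real_pos])

lemma frac_kernel_pos: "a > 0 \<Longrightarrow> t > 0 \<Longrightarrow> frac_kernel a t > 0"
  by (auto simp: frac_kernel_def)

text \<open>Log-convexity in cross-multiplied form: (t' - s) t exceeds t' (t - s) by s (t' - t)
  \<ge> 0, and the exponent b - 1 \<le> 0 reverses the order.\<close>

lemma frac_kernel_ratio:
  assumes "0 < b" "b \<le> 1" "0 < s" "s < t" "t \<le> t'"
  shows "frac_kernel b (t' - s) * frac_kernel b t \<le> frac_kernel b t' * frac_kernel b (t - s)"
proof -
  have "((t' - s) * t) powr (b - 1) \<le> (t' * (t - s)) powr (b - 1)"
    using assms by (intro powr_mono2') (auto simp: algebra_simps intro!: mult_pos_pos)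
  then have "(t' - s) powr (b - 1) * t powr (b - 1) \<le> t' powr (b - 1) * (t - s) powr (b - 1)"
    using assms by (simp add: powr_mult)
  then have "(t' - s) powr (b - 1) * t powr (b - 1) / (Gamma b * Gamma b) \<le> t' powr (b - 1) * (t - s) powr (b - 1) / (Gamma b * Gamma b)"
    using assms by (intro divide_right_mono) auto
  then show ?thesis
    using assms by (simp add: frac_kernel_def)
qed

text \<open>Near 0 the resolvent behaves like l t^(b - 1) / Gamma b, so a first zero, if there is
  one, lies away from 0.\<close>

lemma resolvent_pos_near_0:
  assumes "b > 0" "l > 0"
  shows "\<exists>u>0. \<forall>t. 0 < t \<and> t \<le> u \<longrightarrow> resolvent b l t > 0"
proof -
  have "((\<lambda>t. t powr b) \<longlongrightarrow> 0) (at_right (0::real))"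
    using assms tendsto_powr'[of "\<lambda>t::real. t" 0 "at_right 0" "\<lambda>_. b" b] 
    by (auto simp: eventually_at_filter)
  then have "((\<lambda>t. - l * t powr b) \<longlongrightarrow> - l * 0) (at_right (0::real))"
    by (intro tendsto_mult tendsto_const)
  then have "((\<lambda>t. - l * t powr b) \<longlongrightarrow> 0) (at_right (0::real))"
    by simp
  then have "((\<lambda>t. mittag_leffler b b (- l * t powr b)) \<longlongrightarrow> mittag_leffler b b 0) (at_right 0)"
    using isCont_tendsto_compose[OF isCont_mittag_leffler] assms by blast
  then have "eventually (\<lambda>t. mittag_leffler b b (- l * t powr b) > 0) (at_right 0)"
    by (rule order_tendstoD) (use assms in \<open>simp add: mittag_leffler_0\<close>)
  then obtain u where u: "u > 0" "\<And>t. 0 < t \<Longrightarrow> t < u \<Longrightarrow> mittag_leffler b b (- l * t powr b) > 0"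
    by (auto simp: eventually_at_right_field)
  then have "resolvent b l t > 0" if "0 < t" "t \<le> u / 2" for t
    using that assms by (simp add: resolvent_eq_mittag_leffler)
  then show ?thesis
    using u by (intro exI[of _ "u / 2"]) auto
qed

text \<open>
  At a first zero \<open>t0\<close>, the ratio \<open>k (t0 - s) / k (t - s)\<close> of the kernel decreases in \<open>s\<close>, so the
  resolvent equation at \<open>t < t0\<close> bounds most of the one at \<open>t0\<close>. Taking \<open>t\<close> as the maximiser on
  a short interval before \<open>t0\<close> makes the remaining piece too small to produce a zero.
\<close>

lemma resolvent_pos:
  assumes "0 < b" "b \<le> 1" "l > 0" "t > 0"
  shows "resolvent b l t > 0"
proof (rule ccontr)
  assume "\<not> ?thesis"
  then have neg: "resolvent b l t \<le> 0" by simp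
  obtain u where u: "u > 0" "\<And>t. 0 < t \<Longrightarrow> t \<le> u \<Longrightarrow> resolvent b l t > 0"
    using resolvent_pos_near_0[of b l] assms by blast
  have cont: "continuous_on S (resolvent b l)" if "S \<subseteq> {0<..}" for S
    using that assms by (intro continuous_at_imp_continuous_on) (auto intro!: isCont_resolvent)
  define Z where "Z = {s \<in> {u..t}. resolvent b l s \<le> 0}"
  have "closed Z"
    unfolding Z_def using u by (intro continuous_on_closed_Collect_le cont) auto
  moreover have "bounded Z"
    by (rule bounded_subset[of "{u..t}"]) (auto simp: Z_def)
  ultimately have "compact Z"
    by (simp add: compact_eq_bounded_closed)
  moreover have "t \<in> Z"
    using neg u(2)[of t] assms by (cases "t \<le> u") (auto simp: Z_def)
  ultimately obtain t0 where t0: "t0 \<in> Z" "\<And>s. s \<in> Z \<Longrightarrow> t0 \<le> s"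
    using compact_attains_inf[of Z] by blast
  have t0_pos: "t0 > 0" and R0: "resolvent b l t0 \<le> 0"
    using t0 u by (auto simp: Z_def)
  have pos: "resolvent b l s > 0" if "0 < s" "s < t0" for s
  proof (cases "s \<le> u")
    case False
    have "s \<notin> Z"
      using t0(2)[of s] that by auto
    moreover have "s \<le> t"
      using that t0 by (auto simp: Z_def)
    ultimately show ?thesis
      using False by (auto simp: Z_def)
  qed (use that u in auto)
  let ?k = "frac_kernel b"
  have kp: "?k s > 0" if "s > 0" for s
    using that assms by (intro frac_kernel_pos)
  \<comment> \<open>Chosen so that e^b < c makes the mass e^b / (b Gamma b) of k on an interval of
    length e smaller than k t0 / (l k (t0 / 2)). This yields the contradiction at the end of the
    chain.\<close>
  define c where "c = ?k t0 * (b * Gamma b) / (l * ?k (t0 / 2))"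
  have c: "c > 0"
    unfolding c_def using assms t0_pos kp by (intro divide_pos_pos mult_pos_pos) auto
  define e where "e = min (t0 / 2) ((c / 2) powr (1 / b))"
  have e: "e > 0" "e \<le> t0 / 2"
    using c t0_pos by (auto simp: e_def)
  have "e powr b \<le> ((c / 2) powr (1 / b)) powr b"
    using e assms by (intro powr_mono2) (auto simp: e_def)
  also have "\<dots> = c / 2"
    using assms c by (simp add: powr_powr)
  finally have eb: "e powr b < c"
    using c by simp
  obtain m where m: "m \<in> {t0 - e..t0}" "\<And>s. s \<in> {t0 - e..t0} \<Longrightarrow> resolvent b l s \<le> resolvent b l m"
  proof -
    have "{t0 - e..t0} \<subseteq> {0<..}" "{t0 - e..t0} \<noteq> {}"
      using e t0_pos by auto
    then show ?thesis
      using that continuous_attains_sup[OF compact_Icc _ cont[of "{t0 - e..t0}"]] by blast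
  qed
  have "resolvent b l m \<ge> resolvent b l (t0 - e)"
    using m(2)[of "t0 - e"] e by auto
  then have Rm: "resolvent b l m > 0"
    using pos[of "t0 - e"] e t0_pos by auto
  then have "m \<noteq> t0"
    using R0 by auto
  then have m': "t0 / 2 \<le> m" "m < t0" "0 < m"
    using m e t0_pos by auto
  have km: "?k m > 0"
    using kp m' by auto
  have "?k t0 \<le> ?k t0 - resolvent b l t0 / l"
    using R0 assms by (simp add: divide_nonpos_pos)
  also have "\<dots> = (LINT s|lborel. ?k (t0 - s) * resolvent b l s)"
    using resolvent_equation[of b l t0] assms t0_pos by (simp add: has_bochner_integral_integral_eq)
  \<comment> \<open>The integral is split at m. Before m, \<open>frac_kernel_ratio\<close> compares
    with the resolvent equation at m. Between m and t0 the resolvent is at most its value at m, and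
    \<open>frac_kernel 1 (s - m)\<close> is the indicator of s > m.\<close>
  also have "\<dots> \<le> (LINT s|lborel. ?k t0 / ?k m * (?k (m - s) * resolvent b l s) +
      resolvent b l m * (?k (t0 - s) * frac_kernel 1 (s - m)))"
  proof (rule integral_mono_AE)
    show "integrable lborel (\<lambda>s. ?k (t0 - s) * resolvent b l s)"
      using resolvent_equation[of b l t0] assms t0_pos by (auto simp: has_bochner_integral_iff)
    show "integrable lborel (\<lambda>s. ?k t0 / ?k m * (?k (m - s) * resolvent b l s) +
      resolvent b l m * (?k (t0 - s) * frac_kernel 1 (s - m)))"
      using resolvent_equation[of b l m] frac_kernel_conv_shift[of b 1 m t0] assms m'
      by (intro Bochner_Integration.integrable_add Bochner_Integration.integrable_mult_right) (auto simp: has_bochner_integral_iff)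
    have "AE s in lborel. s \<noteq> m"
      by (rule AE_lborel_singleton)
    then show "AE s in lborel. ?k (t0 - s) * resolvent b l s \<le> ?k t0 / ?k m * (?k (m - s) * resolvent b l s) +
      resolvent b l m * (?k (t0 - s) * frac_kernel 1 (s - m))"
    proof eventually_elim
      case (elim s)
      consider "s \<le> 0" | "0 < s" "s < m" | "m < s" "s < t0" | "t0 \<le> s"
        using elim by linarith
      then show ?case
      proof cases
        case 1
        then show ?thesis
          using m' by (simp add: resolvent_nonpos frac_kernel_def)
      next
        case 2
        have "?k (t0 - s) \<le> ?k t0 / ?k m * ?k (m - s)"
          using frac_kernel_ratio[of b s m t0] 2 m' assms km by (simp add: field_simps)
        then have "?k (t0 - s) * resolvent b l s \<le> ?k t0 / ?k m * ?k (m - s) * resolvent b l s"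
          using pos[of s] 2 m' by (intro mult_right_mono) auto
        then show ?thesis
          using 2 by (simp add: frac_kernel_def[of 1])
      next
        case 3
        have "?k (t0 - s) * resolvent b l s \<le> ?k (t0 - s) * resolvent b l m"
          using 3 m kp[of "t0 - s"] by (intro mult_left_mono m(2)) auto
        then show ?thesis
          using 3 by (simp add: frac_kernel_def[of b "m - s"] frac_kernel_def[of 1] mult_ac)
      next
        case 4
        then show ?thesis
          using m' by (simp add: frac_kernel_def)
      qed
    qed
  qed
  also have "\<dots> = ?k t0 / ?k m * (?k m - resolvent b l m / l) + resolvent b l m * frac_kernel (b + 1) (t0 - m)"
    using resolvent_equation[of b l m] frac_kernel_conv_shift[of b 1 m t0] assms m'
    by (simp add: has_bochner_integral_iff)
  finally have "resolvent b l m * (?k t0 / (l * ?k m)) \<le> resolvent b l m * frac_kernel (b + 1) (t0 - m)"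
    using km assms by (simp add: field_simps)
  then have "?k t0 / (l * ?k m) \<le> frac_kernel (b + 1) (t0 - m)"
    using Rm by (simp only: mult_le_cancel_left_pos)
  also have "\<dots> = (t0 - m) powr b / (b * Gamma b)"
    using assms m' by (intro frac_kernel_plus1) auto
  also have "\<dots> \<le> e powr b / (b * Gamma b)"
    using m m' assms by (intro divide_right_mono powr_mono2) auto
  also have "\<dots> < c / (b * Gamma b)"
    using eb assms by (intro divide_strict_right_mono) auto
  also have "\<dots> = ?k t0 / (l * ?k (t0 / 2))"
    using assms Gamma_real_pos[of b, THEN less_imp_neq] by (simp add: c_def)
  also have "\<dots> \<le> ?k t0 / (l * ?k m)"
    using assms m' t0_pos kp[of "t0 / 2"] km kp[of t0]
    by (intro divide_left_mono mult_left_mono frac_kernel_antimono mult_pos_pos) auto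
  finally show False
    by simp
qed

lemma resolvent_nonneg:
  assumes "0 < b" "b \<le> 1" "l > 0"
  shows "resolvent b l t \<ge> 0"
  using resolvent_pos[OF assms, of t] resolvent_nonpos[of t b l] by (cases "t > 0") auto

lemma resolvent_le_frac_kernel:
  assumes "0 < b" "b \<le> 1" "l > 0"
  shows "resolvent b l t \<le> l * frac_kernel b t"
proof (cases "t > 0")
  case True
  have "0 \<le> (LINT s|lborel. frac_kernel b (t - s) * resolvent b l s)"
    using assms by (intro integral_nonneg_AE AE_I2 mult_nonneg_nonneg frac_kernel_nonneg resolvent_nonneg) auto
  then show ?thesis
    using resolvent_equation[of b l t] True assms by (simp add: has_bochner_integral_iff pos_divide_le_eq mult.commute[of l])
qed (simp add: resolvent_nonpos frac_kernel_def)

text \<open>As k decreases, k t \<le> k (t - s) on (0, t), so k t times the integral of R is at most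
  the convolution k t - R t / l \<le> k t. The mass bound thus needs no asymptotics of R at
  infinity.\<close>

lemma
  assumes "0 < b" "b \<le> 1" "l > 0"
  shows resolvent_integrable: "set_integrable lborel {0..t} (resolvent b l)"
    and resolvent_integral_le_1: "(LINT s:{0..t}|lborel. resolvent b l s) \<le> 1"
proof -
  let ?k = "frac_kernel b"
  have *: "set_integrable lborel {0..t} (resolvent b l) \<and> (LINT s:{0..t}|lborel. resolvent b l s) \<le> 1"
  proof (cases "t > 0")
    case True
    have kt: "?k t > 0"
      using True assms by (intro frac_kernel_pos)
    have b: "has_bochner_integral lborel (\<lambda>s. (1 / ?k t) * (?k (t - s) * resolvent b l s)) ((1 / ?k t) * (?k t - resolvent b l t / l))"
      using resolvent_equation[of b l t] True assms by (intro has_bochner_integral_mult_right) auto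
    have "AE s in lborel. s \<noteq> t"
      by (rule AE_lborel_singleton)
    then have le: "AE s in lborel. indicator {0..t} s * resolvent b l s \<le> (1 / ?k t) * (?k (t - s) * resolvent b l s)"
    proof eventually_elim
      case (elim s)
      show ?case
      proof (cases "0 < s \<and> s < t")
        case True
        then have "?k t * resolvent b l s \<le> ?k (t - s) * resolvent b l s"
          using assms by (intro mult_right_mono frac_kernel_antimono resolvent_nonneg) auto
        then show ?thesis
          using True kt by (simp add: field_simps)
      next
        case False
        then have "s \<le> 0 \<or> s > t" using elim by auto
        then show ?thesis
          by (auto simp: resolvent_nonpos frac_kernel_def indicator_def)
      qed
    qed
    have int: "integrable lborel (\<lambda>s. indicator {0..t} s * resolvent b l s)"
    proof (rule Bochner_Integration.integrable_bound)
      show "integrable lborel (\<lambda>s. (1 / ?k t) * (?k (t - s) * resolvent b l s))"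
        using b by (simp add: has_bochner_integral_iff)
      show "AE s in lborel. norm (indicator {0..t} s * resolvent b l s) \<le> norm ((1 / ?k t) * (?k (t - s) * resolvent b l s))"
        using le by eventually_elim (use kt in \<open>simp add: abs_mult resolvent_nonneg[OF assms] frac_kernel_nonneg[OF assms(1)]\<close>)
    qed measurable
    have "(LINT s|lborel. indicator {0..t} s * resolvent b l s) \<le> (1 / ?k t) * (?k t - resolvent b l t / l)"
      using integral_mono_AE[OF int _ le] b kt by (simp add: has_bochner_integral_iff)
    also have "\<dots> \<le> 1"
      using kt resolvent_nonneg[OF assms, of t] assms by (simp add: field_simps)
    finally show ?thesis
      using int by (simp add: set_integrable_def set_lebesgue_integral_def)
  next
    case False
    then have "(\<lambda>s. indicator {0..t} s * resolvent b l s) = (\<lambda>_. 0)"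
      by (auto simp: indicator_def resolvent_nonpos)
    then show ?thesis
      by (simp add: set_integrable_def set_lebesgue_integral_def)
  qed
  then show "set_integrable lborel {0..t} (resolvent b l)" "(LINT s:{0..t}|lborel. resolvent b l s) \<le> 1"
    by auto
qed

section \<open>Convolutions and variation of constants\<close>

text \<open>The integral runs over {0..t} rather than the line, so that functions not vanishing at
  negative times, such as the means of the extended processes, can be convolved without cutting them
  off.\<close>

definition conv :: "(real \<Rightarrow> real) \<Rightarrow> (real \<Rightarrow> real) \<Rightarrow> real \<Rightarrow> real" where
  "conv a v t = (LINT s:{0..t}|lborel. a (t - s) * v s)"

lemma integral_reflect:
  fixes a b :: "real \<Rightarrow> real"
  shows "(LINT s|lborel. a (t - s) * b s) = (LINT s|lborel. a s * b (t - s))"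
  using lborel_integral_real_affine[of "-1" "\<lambda>s. a (t - s) * b s" t] by simp

lemma conv_commute: "conv a b t = conv b a t"
proof -
  have "conv a b t = (LINT s|lborel. (indicator {0..t} (t - s) * a (t - s)) * b s)"
    unfolding conv_def set_lebesgue_integral_def
    by (intro Bochner_Integration.integral_cong) (auto simp: indicator_def)
  also have "\<dots> = (LINT s|lborel. (indicator {0..t} s * a s) * b (t - s))"
    by (rule integral_reflect[of "\<lambda>s. indicator {0..t} s * a s"])
  also have "\<dots> = conv b a t"
    unfolding conv_def set_lebesgue_integral_def
    by (intro Bochner_Integration.integral_cong) (auto simp: mult_ac)
  finally show ?thesis .
qed

lemma conv_eq_integral:
  assumes "\<And>x. x < 0 \<Longrightarrow> a x = 0" "\<And>x. x < 0 \<Longrightarrow> v x = 0"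
  shows "conv a v t = (LINT s|lborel. a (t - s) * v s)"
  unfolding conv_def set_lebesgue_integral_def
proof (intro Bochner_Integration.integral_cong refl)
  fix s
  consider "s < 0" | "t - s < 0" | "s \<in> {0..t}" by fastforce
  then show "indicator {0..t} s *\<^sub>R (a (t - s) * v s) = a (t - s) * v s"
    by cases (auto simp: assms)
qed

lemma conv_measurable:
  assumes "\<And>x. x < 0 \<Longrightarrow> a x = 0" "\<And>x. x < 0 \<Longrightarrow> v x = 0"
    and [measurable]: "a \<in> borel_measurable borel" "v \<in> borel_measurable borel"
  shows "conv a v \<in> borel_measurable borel"
proof -
  have "conv a v = (\<lambda>t. LINT s|lborel. a (t - s) * v s)"
    using assms(1,2) by (intro ext conv_eq_integral)
  then show ?thesis
    by simp
qed

lemma conv_integrable: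
  fixes a v :: "real \<Rightarrow> real"
  assumes a: "set_integrable lborel {0..t} a"
    and [measurable]: "v \<in> borel_measurable borel" and v: "\<And>s. s \<in> {0..t} \<Longrightarrow> \<bar>v s\<bar> \<le> V"
  shows "set_integrable lborel {0..t} (\<lambda>s. a (t - s) * v s)"
proof -
  have i: "integrable lborel (\<lambda>s. indicator {0..t} s * a s)"
    using a by (simp add: set_integrable_def)
  have i': "integrable lborel (\<lambda>s. indicator {0..t} (t + - 1 * s) * a (t + - 1 * s))"
    by (rule lborel_integrable_real_affine[OF i]) simp
  have "integrable lborel (\<lambda>s. (indicator {0..t} (t + - 1 * s) * a (t + - 1 * s)) * (indicator {0..t} s * v s))"
  proof (rule Bochner_Integration.integrable_bound)
    show "integrable lborel (\<lambda>s. V * (indicator {0..t} (t + - 1 * s) * a (t + - 1 * s)))"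
      using i' by (intro Bochner_Integration.integrable_mult_right)
    show "(\<lambda>s. (indicator {0..t} (t + - 1 * s) * a (t + - 1 * s)) * (indicator {0..t} s * v s)) \<in> borel_measurable lborel"
      using borel_measurable_integrable[OF i'] by measurable
    show "AE s in lborel. norm ((indicator {0..t} (t + - 1 * s) * a (t + - 1 * s)) * (indicator {0..t} s * v s))
        \<le> norm (V * (indicator {0..t} (t + - 1 * s) * a (t + - 1 * s)))"
    proof (intro AE_I2)
      fix s
      have "\<bar>a (t - s)\<bar> * \<bar>v s\<bar> \<le> \<bar>V\<bar> * \<bar>a (t - s)\<bar>" if "s \<in> {0..t}"
        using v[OF that] by (subst mult.commute) (intro mult_right_mono, auto)
      then show "norm ((indicator {0..t} (t + - 1 * s) * a (t + - 1 * s)) * (indicator {0..t} s * v s))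
        \<le> norm (V * (indicator {0..t} (t + - 1 * s) * a (t + - 1 * s)))"
        by (auto simp: indicator_def abs_mult)
    qed
  qed
  then show ?thesis
    unfolding set_integrable_def
    by (rule Bochner_Integration.integrable_cong[THEN iffD1, rotated 2]) (auto simp: indicator_def)
qed

text \<open>Tonelli: in both alternatives the inner integral is bounded uniformly in s, so the
  double integral is at most that bound times the L^1 norm of \<open>a\<close>. The first
  alternative serves kernels against bounded paths, the second an L^1 density against a bounded
  kernel.\<close>

lemma pair_integrable_if:
  fixes a b v :: "real \<Rightarrow> real"
  assumes [measurable]: "a \<in> borel_measurable borel" "b \<in> borel_measurable borel" "v \<in> borel_measurable borel"
    and a: "integrable lborel a"
    and bv: "(integrable lborel b \<and> (\<forall>x. \<bar>v x\<bar> \<le> V)) \<or> (integrable lborel v \<and> (\<forall>x. \<bar>b x\<bar> \<le> V))"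
  shows "integrable (lborel \<Otimes>\<^sub>M lborel) (\<lambda>(s, r). a (t - s) * (b (s - r) * v r))"
proof (rule integrableI_bounded)
  have refl: "(\<integral>\<^sup>+x. ennreal \<bar>c (s - x)\<bar> \<partial>lborel) = (\<integral>\<^sup>+x. ennreal \<bar>c x\<bar> \<partial>lborel)"
    if [measurable]: "c \<in> borel_measurable borel" for c :: "real \<Rightarrow> real" and s
    using nn_integral_real_affine[of "\<lambda>x. ennreal \<bar>c x\<bar>" "-1" s] by simp
  have fin: "(\<integral>\<^sup>+x. ennreal \<bar>c x\<bar> \<partial>lborel) < \<infinity>" if "integrable lborel c" for c :: "real \<Rightarrow> real"
    using that by (simp add: integrable_iff_bounded)
  have V: "V \<ge> 0"
    using bv by (meson abs_ge_zero order_trans)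
  obtain L where L: "L < \<infinity>" "\<And>s. (\<integral>\<^sup>+r. ennreal \<bar>b (s - r) * v r\<bar> \<partial>lborel) \<le> L"
  proof (cases "integrable lborel b \<and> (\<forall>x. \<bar>v x\<bar> \<le> V)")
    case True
    have "(\<integral>\<^sup>+r. ennreal \<bar>b (s - r) * v r\<bar> \<partial>lborel) \<le> ennreal V * (\<integral>\<^sup>+x. ennreal \<bar>b x\<bar> \<partial>lborel)" for s
    proof -
      have "(\<integral>\<^sup>+r. ennreal \<bar>b (s - r) * v r\<bar> \<partial>lborel) \<le> (\<integral>\<^sup>+r. ennreal V * ennreal \<bar>b (s - r)\<bar> \<partial>lborel)"
        using True V by (intro nn_integral_mono) (auto simp: abs_mult ennreal_mult'[symmetric] mult.commute intro!: ennreal_leI mult_right_mono)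
      also have "\<dots> = ennreal V * (\<integral>\<^sup>+x. ennreal \<bar>b x\<bar> \<partial>lborel)"
        by (subst nn_integral_cmult) (auto simp: refl)
      finally show ?thesis .
    qed
    then show ?thesis
      using that[of "ennreal V * (\<integral>\<^sup>+x. ennreal \<bar>b x\<bar> \<partial>lborel)"] fin[of b] True
      by (auto simp: ennreal_mult_less_top)
  next
    case False
    then have vb: "integrable lborel v" "\<And>x. \<bar>b x\<bar> \<le> V"
      using bv by auto
    have "(\<integral>\<^sup>+r. ennreal \<bar>b (s - r) * v r\<bar> \<partial>lborel) \<le> ennreal V * (\<integral>\<^sup>+x. ennreal \<bar>v x\<bar> \<partial>lborel)" for s
    proof -
      have "(\<integral>\<^sup>+r. ennreal \<bar>b (s - r) * v r\<bar> \<partial>lborel) \<le> (\<integral>\<^sup>+r. ennreal V * ennreal \<bar>v r\<bar> \<partial>lborel)"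
        using vb V by (intro nn_integral_mono) (auto simp: abs_mult ennreal_mult'[symmetric] intro!: ennreal_leI mult_right_mono)
      also have "\<dots> = ennreal V * (\<integral>\<^sup>+x. ennreal \<bar>v x\<bar> \<partial>lborel)"
        by (subst nn_integral_cmult) auto
      finally show ?thesis .
    qed
    then show ?thesis
      using that[of "ennreal V * (\<integral>\<^sup>+x. ennreal \<bar>v x\<bar> \<partial>lborel)"] fin[of v] vb
      by (auto simp: ennreal_mult_less_top)
  qed
  have "(\<integral>\<^sup>+x. ennreal (norm ((\<lambda>(s, r). a (t - s) * (b (s - r) * v r)) x)) \<partial>(lborel \<Otimes>\<^sub>M lborel))
      = (\<integral>\<^sup>+s. \<integral>\<^sup>+r. ennreal \<bar>a (t - s) * (b (s - r) * v r)\<bar> \<partial>lborel \<partial>lborel)"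
    by (subst lborel.nn_integral_fst[symmetric]) (auto simp: split_beta')
  also have "\<dots> = (\<integral>\<^sup>+s. ennreal \<bar>a (t - s)\<bar> * (\<integral>\<^sup>+r. ennreal \<bar>b (s - r) * v r\<bar> \<partial>lborel) \<partial>lborel)"
    by (intro nn_integral_cong, subst nn_integral_cmult[symmetric]) (auto simp: abs_mult ennreal_mult')
  also have "\<dots> \<le> (\<integral>\<^sup>+s. ennreal \<bar>a (t - s)\<bar> * L \<partial>lborel)"
    by (intro nn_integral_mono mult_left_mono L) auto
  also have "\<dots> = (\<integral>\<^sup>+s. ennreal \<bar>a s\<bar> \<partial>lborel) * L"
    by (subst nn_integral_multc) (auto simp: refl)
  also have "\<dots> < \<infinity>"
    using fin[OF a] L by (simp add: ennreal_mult_less_top)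
  finally show "(\<integral>\<^sup>+x. ennreal (norm ((\<lambda>(s, r). a (t - s) * (b (s - r) * v r)) x)) \<partial>(lborel \<Otimes>\<^sub>M lborel)) < \<infinity>" .
qed measurable

text \<open>Associativity by Fubini after cutting all three functions off to {0..t}: the product
  then lives exactly on 0 \<le> r \<le> s \<le> t. The two integrability claims concern the two
  orders of integration of the same absolutely convergent double integral.\<close>

lemma conv_conv:
  fixes a b v :: "real \<Rightarrow> real"
  assumes [measurable]: "a \<in> borel_measurable borel" "b \<in> borel_measurable borel" "v \<in> borel_measurable borel"
    and a: "set_integrable lborel {0..t} a"
    and bv: "(set_integrable lborel {0..t} b \<and> (\<forall>x\<in>{0..t}. \<bar>v x\<bar> \<le> V)) \<or>
             (set_integrable lborel {0..t} v \<and> (\<forall>x\<in>{0..t}. \<bar>b x\<bar> \<le> V))"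
  shows "conv a (conv b v) t = conv (conv a b) v t"
    and "set_integrable lborel {0..t} (\<lambda>s. a (t - s) * conv b v s)"
    and "set_integrable lborel {0..t} (\<lambda>s. conv a b (t - s) * v s)"
proof -
  define a' b' v' where "a' = (\<lambda>x. indicator {0..t} x * a x)" "b' = (\<lambda>x. indicator {0..t} x * b x)"
    "v' = (\<lambda>x. indicator {0..t} x * v x)"
  note defs = this
  have [measurable]: "a' \<in> borel_measurable borel" "b' \<in> borel_measurable borel" "v' \<in> borel_measurable borel"
    unfolding defs by measurable
  have a': "integrable lborel a'"
    using a by (simp add: set_integrable_def defs)
  have bv': "(integrable lborel b' \<and> (\<forall>x. \<bar>v' x\<bar> \<le> \<bar>V\<bar>)) \<or> (integrable lborel v' \<and> (\<forall>x. \<bar>b' x\<bar> \<le> \<bar>V\<bar>))"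
  proof -
    have "\<bar>indicator {0..t} x * w x\<bar> \<le> \<bar>V\<bar>" if "\<forall>x\<in>{0..t}. \<bar>w x\<bar> \<le> V" for w :: "real \<Rightarrow> real" and x
      using that by (cases "x \<in> {0..t}") (auto intro: order_trans[OF _ abs_ge_self])
    then show ?thesis
      using bv unfolding set_integrable_def defs by auto
  qed
  have int: "integrable (lborel \<Otimes>\<^sub>M lborel) (\<lambda>(s, r). a' (t - s) * (b' (s - r) * v' r))"
    by (rule pair_integrable_if[OF _ _ _ a' bv']) measurable
  have 1: "a' (t - s) * (LINT r|lborel. b' (s - r) * v' r) = indicator {0..t} s * (a (t - s) * conv b v s)" for s
  proof (cases "s \<in> {0..t}")
    case True
    have "(LINT r|lborel. b' (s - r) * v' r) = conv b v s"
      unfolding conv_def set_lebesgue_integral_def using True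
      by (intro Bochner_Integration.integral_cong) (auto simp: defs indicator_def)
    then show ?thesis
      using True by (auto simp: defs)
  qed (auto simp: defs indicator_def)
  \<comment> \<open>Translation by r turns the inner integral into the convolution at t - r.\<close>
  have 2: "(LINT s|lborel. a' (t - s) * b' (s - r)) * v' r = indicator {0..t} r * (conv a b (t - r) * v r)" for r
  proof (cases "r \<in> {0..t}")
    case True
    have "(LINT s|lborel. a' (t - s) * b' (s - r)) = (LINT s|lborel. a' (t - (r + 1 * s)) * b' ((r + 1 * s) - r))"
      using lborel_integral_real_affine[of 1 "\<lambda>s. a' (t - s) * b' (s - r)" r] by simp
    also have "\<dots> = conv a b (t - r)"
      unfolding conv_def set_lebesgue_integral_def using True
      by (intro Bochner_Integration.integral_cong) (auto simp: defs indicator_def algebra_simps)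
    finally show ?thesis
      using True by (auto simp: defs)
  qed (auto simp: defs)
  have "conv a (conv b v) t = (LINT s|lborel. LINT r|lborel. a' (t - s) * (b' (s - r) * v' r))"
    by (simp only: conv_def[of a] set_lebesgue_integral_def real_scaleR_def 1[symmetric] integral_mult_right_zero)
  also have "\<dots> = (LINT r|lborel. LINT s|lborel. a' (t - s) * (b' (s - r) * v' r))"
    by (rule lborel_pair.Fubini_integral[symmetric]) (rule int)
  also have "\<dots> = (LINT r|lborel. (LINT s|lborel. a' (t - s) * b' (s - r)) * v' r)"
    by (simp add: mult.assoc[symmetric])
  also have "\<dots> = conv (conv a b) v t"
    by (simp only: conv_def[of "conv a b"] set_lebesgue_integral_def real_scaleR_def 2)
  finally show "conv a (conv b v) t = conv (conv a b) v t" .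
  have "integrable lborel (\<lambda>s. LINT r|lborel. a' (t - s) * (b' (s - r) * v' r))"
    using lborel_pair.integrable_fst[OF int] .
  then show "set_integrable lborel {0..t} (\<lambda>s. a (t - s) * conv b v s)"
    by (simp only: set_integrable_def real_scaleR_def 1[symmetric] integral_mult_right_zero)
  have "integrable lborel (\<lambda>r. LINT s|lborel. a' (t - s) * (b' (s - r) * v' r))"
    using lborel_pair.integrable_snd[OF int] .
  then show "set_integrable lborel {0..t} (\<lambda>s. conv a b (t - s) * v s)"
    by (simp only: set_integrable_def real_scaleR_def mult.assoc[symmetric] integral_mult_left_zero 2[unfolded mult.assoc[symmetric]])
qed

section \<open>Convolutions of the kernels and the resolvent\<close>

lemma set_integrable_frac_kernel:
  assumes "b > 0"
  shows "set_integrable lborel {0..t} (frac_kernel b)"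
proof (cases "t > 0")
  case True
  have "integrable lborel (\<lambda>s. frac_kernel 1 (t - s) * frac_kernel b s)"
    using frac_kernel_conv[of 1 b t] assms True by (auto simp: has_bochner_integral_iff)
  moreover have "AE s in lborel. s \<noteq> t"
    by (rule AE_lborel_singleton)
  then have "AE s in lborel. frac_kernel 1 (t - s) * frac_kernel b s = indicator {0..t} s * frac_kernel b s"
    by eventually_elim (auto simp: frac_kernel_def indicator_def)
  ultimately show ?thesis
    unfolding set_integrable_def
    by (subst integrable_cong_AE[where g="\<lambda>s. frac_kernel 1 (t - s) * frac_kernel b s"]) auto
next
  case False
  then have "(\<lambda>s. indicator {0..t} s * frac_kernel b s) = (\<lambda>_. 0)"
    by (auto simp: indicator_def frac_kernel_def)
  then show ?thesis
    by (simp add: set_integrable_def)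
qed

lemma conv_frac_kernel:
  assumes "a > 0" "b > 0" "t \<ge> 0"
  shows "conv (frac_kernel a) (frac_kernel b) t = frac_kernel (a + b) t"
proof -
  have "conv (frac_kernel a) (frac_kernel b) t = (LINT s|lborel. frac_kernel a (t - s) * frac_kernel b s)"
    unfolding conv_def set_lebesgue_integral_def
    by (intro Bochner_Integration.integral_cong) (auto simp: indicator_def frac_kernel_def)
  also have "\<dots> = frac_kernel (a + b) t"
  proof (cases "t = 0")
    case True
    have "frac_kernel a (0 - s) * frac_kernel b s = 0" for s
      by (auto simp: frac_kernel_def)
    then have "(LINT s|lborel. frac_kernel a (0 - s) * frac_kernel b s) = 0"
      by (simp only: Bochner_Integration.integral_zero)
    then show ?thesis
      using True by (simp add: frac_kernel_def)
  qed (use frac_kernel_conv[of a b t] assms in \<open>simp add: has_bochner_integral_iff\<close>)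
  finally show ?thesis .
qed

lemma conv_resolvent_frac_kernel:
  assumes "b > 0" "l > 0" "t \<ge> 0"
  shows "conv (resolvent b l) (frac_kernel b) t = frac_kernel b t - resolvent b l t / l"
proof -
  have "conv (frac_kernel b) (resolvent b l) t = (LINT s|lborel. frac_kernel b (t - s) * resolvent b l s)"
    unfolding conv_def set_lebesgue_integral_def
    by (intro Bochner_Integration.integral_cong) (auto simp: indicator_def frac_kernel_def resolvent_nonpos)
  also have "\<dots> = frac_kernel b t - resolvent b l t / l"
  proof (cases "t = 0")
    case True
    have "frac_kernel b (0 - s) * resolvent b l s = 0" for s
      by (cases "s > 0") (auto simp: frac_kernel_def resolvent_nonpos)
    then have "(LINT s|lborel. frac_kernel b (0 - s) * resolvent b l s) = 0"
      by (simp only: Bochner_Integration.integral_zero)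
    then show ?thesis
      using True by (simp add: frac_kernel_def resolvent_nonpos)
  qed (use resolvent_equation[of b l t] assms in \<open>simp add: has_bochner_integral_iff\<close>)
  finally show ?thesis
    by (simp add: conv_commute)
qed

lemma conv_add:
  assumes "set_integrable lborel {0..t} (\<lambda>s. a (t - s) * u s)" "set_integrable lborel {0..t} (\<lambda>s. a (t - s) * v s)"
  shows "conv a (\<lambda>s. u s + v s) t = conv a u t + conv a v t"
  using set_integral_add(2)[OF assms] by (simp add: conv_def distrib_left)

lemma conv_cmult: "conv a (\<lambda>s. c * v s) t = c * conv a v t"
  by (simp add: conv_def mult.left_commute)

lemma conv_diff:
  assumes "set_integrable lborel {0..t} (\<lambda>s. a (t - s) * u s)" "set_integrable lborel {0..t} (\<lambda>s. a (t - s) * v s)"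
  shows "conv a (\<lambda>s. u s - v s) t = conv a u t - conv a v t"
  using set_integral_diff(2)[OF assms] by (simp add: conv_def right_diff_distrib)

lemma conv_cong: "(\<And>s. s \<in> {0..t} \<Longrightarrow> u s = v s) \<Longrightarrow> conv a u t = conv a v t"
  unfolding conv_def by (intro set_lebesgue_integral_cong) auto

lemma conv_mono:
  assumes "set_integrable lborel {0..t} (\<lambda>s. a (t - s) * u s)" "set_integrable lborel {0..t} (\<lambda>s. a (t - s) * v s)"
    and "\<And>s. s \<in> {0..t} \<Longrightarrow> a s \<ge> 0" "\<And>s. s \<in> {0..t} \<Longrightarrow> u s \<le> v s"
  shows "conv a u t \<le> conv a v t"
  unfolding conv_def using assms by (intro set_integral_mono mult_left_mono) auto

lemma conv_abs_le:
  assumes "\<And>s. s \<in> {0..t} \<Longrightarrow> a s \<ge> 0"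
  shows "\<bar>conv a v t\<bar> \<le> conv a (\<lambda>s. \<bar>v s\<bar>) t"
proof -
  have "\<bar>conv a v t\<bar> \<le> (LINT s|lborel. \<bar>indicator {0..t} s * (a (t - s) * v s)\<bar>)"
    unfolding conv_def set_lebesgue_integral_def by (simp add: integral_abs_bound)
  also have "\<dots> = conv a (\<lambda>s. \<bar>v s\<bar>) t"
    unfolding conv_def set_lebesgue_integral_def using assms
    by (intro Bochner_Integration.integral_cong) (auto simp: indicator_def abs_mult)
  finally show ?thesis .
qed

text \<open>Convolve X = \<xi> + k * v with R and use R * k = k - R / l: then R * X = R * \<xi> + k
  * v - R * v / l, and k * v cancels in the difference X - R * X. Here \<open>v\<close> is
  arbitrary; in the application it contains - l X itself.\<close>

lemma variation_of_constants:
  assumes b: "0 < b" "b \<le> 1" "l > 0" and t: "t \<ge> 0"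
    and [measurable]: "\<xi> \<in> borel_measurable borel" "v \<in> borel_measurable borel"
    and bd: "\<And>s. s \<in> {0..t} \<Longrightarrow> \<bar>\<xi> s\<bar> \<le> V" "\<And>s. s \<in> {0..t} \<Longrightarrow> \<bar>v s\<bar> \<le> V"
    and X: "\<And>s. s \<in> {0..t} \<Longrightarrow> X s = \<xi> s + conv (frac_kernel b) v s"
  shows "X t - conv (resolvent b l) X t = \<xi> t - conv (resolvent b l) \<xi> t + conv (resolvent b l) v t / l"
proof -
  let ?k = "frac_kernel b" and ?R = "resolvent b l"
  note iR = resolvent_integrable[OF b, of t] and ik = set_integrable_frac_kernel[OF b(1), of t]
  have "conv ?R X t = conv ?R (\<lambda>s. \<xi> s + conv ?k v s) t"
    using X by (intro conv_cong) auto
  also have "\<dots> = conv ?R \<xi> t + conv ?R (conv ?k v) t"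
    by (intro conv_add conv_integrable[OF iR _ bd(1)] conv_conv(2)[OF _ _ _ iR disjI1, of _ _ V]) (use ik bd in auto)
  also have "conv ?R (conv ?k v) t = conv (conv ?R ?k) v t"
    by (intro conv_conv(1)[OF _ _ _ iR disjI1, of _ _ V]) (use ik bd in auto)
  also have "\<dots> = conv v (\<lambda>s. ?k s - ?R s / l) t"
    unfolding conv_commute[of _ v] using b
    by (intro conv_cong conv_resolvent_frac_kernel) auto
  also have "\<dots> = conv (\<lambda>s. ?k s - ?R s / l) v t"
    by (rule conv_commute)
  also have "\<dots> = conv ?k v t - conv ?R v t / l"
    using set_integral_diff(2)[OF conv_integrable[OF ik _ bd(2)] set_integrable_mult_right[OF conv_integrable[OF iR _ bd(2)], of "1/l"]]
    by (simp add: conv_def left_diff_distrib)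
  finally show ?thesis
    using X[of t] t by simp
qed

section \<open>The Young integral against a differentiable integrand\<close>

text \<open>The derivative may blow up at the end points, as (t - s)^(\<beta> - 1) does at s = t.
  Its sign makes the gauge integral of the fundamental theorem an absolutely convergent Lebesgue
  integral.\<close>

lemma nonneg_derivative_integral:
  fixes G g :: "real \<Rightarrow> real"
  assumes "a \<le> b" "continuous_on {a..b} G" and [measurable]: "g \<in> borel_measurable borel"
    and der: "\<And>x. x \<in> {a<..<b} \<Longrightarrow> (G has_real_derivative g x) (at x)"
    and pos: "\<And>x. x \<in> {a<..<b} \<Longrightarrow> 0 \<le> g x"
  shows "set_integrable lborel {a..b} g" "(LINT x:{a..b}|lborel. g x) = G b - G a"
proof -
  define h where "h x = indicator {a<..<b} x * g x" for x
  have [measurable]: "h \<in> borel_measurable borel"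
    unfolding h_def by measurable
  have nn: "0 \<le> h x" for x
    using pos by (auto simp: h_def indicator_def)
  have "(h has_integral (G b - G a)) {a..b}"
    using assms by (intro fundamental_theorem_of_calculus_interior)
      (auto simp: h_def has_real_derivative_iff_has_vector_derivative[symmetric])
  then have "((\<lambda>x. if x \<in> {a..b} then h x else 0) has_integral (G b - G a)) UNIV"
    by (simp only: has_integral_restrict_UNIV)
  moreover have "(\<lambda>x. if x \<in> {a..b} then h x else 0) = h"
    by (rule ext) (auto simp: h_def indicator_def)
  ultimately have hi: "(h has_integral (G b - G a)) UNIV"
    by simp
  then have nni: "(\<integral>\<^sup>+x. ennreal (h x) \<partial>lborel) = ennreal (G b - G a)"
    using nn by (intro nn_integral_has_integral_lborel) auto
  have "0 \<le> G b - G a"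
    using has_integral_nonneg[OF hi] nn by simp
  then have h: "integrable lborel h \<and> integral\<^sup>L lborel h = G b - G a"
    using nn_integral_eq_integrable[of h lborel "G b - G a"] nni nn by auto
  have "AE x in lborel. x \<noteq> a" "AE x in lborel. x \<noteq> b"
    by (rule AE_lborel_singleton)+
  then have AE: "AE x in lborel. indicator {a..b} x *\<^sub>R g x = h x"
    by eventually_elim (auto simp: h_def indicator_def)
  show "set_integrable lborel {a..b} g"
    unfolding set_integrable_def using h by (subst integrable_cong_AE[OF _ _ AE]) auto
  show "(LINT x:{a..b}|lborel. g x) = G b - G a"
    unfolding set_lebesgue_integral_def using h by (subst integral_cong_AE[OF _ _ AE]) auto
qed

lemma continuous_on_Icc_bounded:
  fixes c :: "real \<Rightarrow> real"
  assumes "continuous_on {a..b} c"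
  obtains V where "\<And>s. s \<in> {a..b} \<Longrightarrow> \<bar>c s\<bar> \<le> V"
proof -
  obtain V where "\<forall>x\<in>c ` {a..b}. norm x \<le> V"
    using compact_imp_bounded[OF compact_continuous_image[OF assms compact_Icc]]
    unfolding bounded_iff by blast
  then show thesis
    using that[of V] by simp
qed

lemma set_integral_Icc_combine:
  fixes f :: "real \<Rightarrow> real"
  assumes "set_integrable lborel {a..b} f" "a \<le> c" "c \<le> b"
  shows "(LINT x:{a..b}|lborel. f x) = (LINT x:{a..c}|lborel. f x) + (LINT x:{c..b}|lborel. f x)"
proof -
  have "set_integrable lborel {a..c} f" "set_integrable lborel {c..b} f"
    using assms by (auto intro: set_integrable_subset)
  then show ?thesis
    using assms Henstock_Kurzweil_Integration.integral_combine[of a c b f]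
    by (simp add: set_borel_integral_eq_integral)
qed

lemma set_integral_Icc_self:
  fixes f :: "real \<Rightarrow> real"
  shows "(LINT s:{a..a}|lborel. f s) = 0"
proof -
  have "AE s in lborel. s \<noteq> a"
    by (rule AE_lborel_singleton)
  then have "AE s in lborel. indicator {a..a} s *\<^sub>R f s = 0"
    by eventually_elim auto
  then show ?thesis
    unfolding set_lebesgue_integral_def by (rule integral_eq_zero_AE)
qed

lemma Union_Icc_chain:
  fixes p :: "nat \<Rightarrow> real"
  assumes "mono p" "n > 0"
  shows "(\<Union>i<n. {p i..p (Suc i)}) = {p 0..p n}"
  using assms(2)
proof (induction n)
  case (Suc n)
  show ?case
  proof (cases "n = 0")
    case False
    then have "(\<Union>i<Suc n. {p i..p (Suc i)}) = {p 0..p n} \<union> {p n..p (Suc n)}"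
      using Suc by (simp add: lessThan_Suc Un_commute)
    also have "\<dots> = {p 0..p (Suc n)}"
      using monoD[OF assms(1), of 0 n] monoD[OF assms(1), of n "Suc n"] by (intro ivl_disj_un_two_touch) auto
    finally show ?thesis .
  qed (simp add: lessThan_Suc)
qed simp

lemma tagged_division_of_chain:
  fixes p :: "nat \<Rightarrow> real"
  assumes p: "strict_mono p" and n: "n > 0"
  shows "((\<lambda>i. (p i, {p i..p (Suc i)})) ` {..<n}) tagged_division_of {p 0..p n}"
proof (rule tagged_division_ofI)
  let ?D = "(\<lambda>i. (p i, {p i..p (Suc i)})) ` {..<n}"
  have mono: "mono p"
    using p by (rule strict_mono_mono)
  have le: "p i \<le> p j" if "i \<le> j" for i j
    using mono that by (rule monoD)
  have "\<Union>{K. \<exists>x. (x, K) \<in> ?D} = (\<Union>i<n. {p i..p (Suc i)})"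
    by auto
  then show "\<Union>{K. \<exists>x. (x, K) \<in> ?D} = {p 0..p n}"
    using Union_Icc_chain[OF mono n] by simp
  fix x1 K1 x2 K2
  assume 1: "(x1, K1) \<in> ?D" and 2: "(x2, K2) \<in> ?D" and ne: "(x1, K1) \<noteq> (x2, K2)"
  obtain i j where ij: "K1 = {p i..p (Suc i)}" "K2 = {p j..p (Suc j)}" "i \<noteq> j"
    using 1 2 ne by auto
  then have "p (Suc i) \<le> p j \<or> p (Suc j) \<le> p i"
    using le[of "Suc i" j] le[of "Suc j" i] by linarith
  then show "interior K1 \<inter> interior K2 = {}"
    unfolding ij by (auto simp: interior_atLeastAtMost_real)
next
  fix x K
  assume "(x, K) \<in> (\<lambda>i. (p i, {p i..p (Suc i)})) ` {..<n}"
  then obtain i where i: "i < n" "x = p i" "K = {p i..p (Suc i)}"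
    by auto
  have le: "p i \<le> p j" if "i \<le> j" for i j
    using strict_mono_mono[OF p] that by (rule monoD)
  show "x \<in> K"
    using i le[of i "Suc i"] by auto
  show "K \<subseteq> {p 0..p n}"
    using i le[of 0 i] le[of "Suc i" n] by auto
  show "\<exists>a b. K = cbox a b"
    using i by (metis box_real(2))
qed auto

lemma abel_sum:
  fixes g c :: "nat \<Rightarrow> real"
  shows "(\<Sum>i<n. g i * (c (Suc i) - c i)) = g n * c n - g 0 * c 0 + (\<Sum>i<n. c (Suc i) * (g i - g (Suc i)))"
  by (induction n) (auto simp: algebra_simps)

lemma bounded_mult_set_integrable:
  fixes b w :: "real \<Rightarrow> real"
  assumes "set_integrable lborel S w" and [measurable]: "b \<in> borel_measurable borel" "S \<in> sets borel"
    and "\<And>s. s \<in> S \<Longrightarrow> \<bar>b s\<bar> \<le> V"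
  shows "set_integrable lborel S (\<lambda>s. b s * w s)"
proof -
  have [measurable]: "(\<lambda>s. indicator S s * w s) \<in> borel_measurable borel"
    using assms(1) borel_measurable_integrable by (fastforce simp: set_integrable_def)
  have meas: "(\<lambda>s. b s * (indicator S s * w s)) \<in> borel_measurable lborel"
    by measurable
  have "integrable lborel (\<lambda>s. b s * (indicator S s * w s))"
  proof (rule Bochner_Integration.integrable_bound[OF _ meas])
    show "integrable lborel (\<lambda>s. V * (indicator S s * w s))"
      using assms(1) by (simp add: set_integrable_def)
    show "AE s in lborel. norm (b s * (indicator S s * w s)) \<le> norm (V * (indicator S s * w s))"
    proof (intro AE_I2)
      fix s
      have "\<bar>b s\<bar> * \<bar>w s\<bar> \<le> \<bar>V\<bar> * \<bar>w s\<bar>" if "s \<in> S"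
        using assms(4)[OF that] by (intro mult_right_mono) auto
      then show "norm (b s * (indicator S s * w s)) \<le> norm (V * (indicator S s * w s))"
        by (auto simp: indicator_def abs_mult)
    qed
  qed
  then show ?thesis
    by (simp add: set_integrable_def mult.left_commute)
qed

text \<open>Since the integral is assumed to exist, left-tagged uniform partitions alone determine
  I. Abel summation moves the increments onto g, and the boundary terms vanish because g t = 0 and b
  0 = 0. As g is non-increasing with density -w, uniform continuity of b is enough; its roughness
  does not enter.\<close>

lemma young_integral_by_parts:
  fixes b g w :: "real \<Rightarrow> real"
  assumes t: "t > 0" and cont: "continuous_on {0..t} b" and [measurable]: "b \<in> borel_measurable borel"
    and young: "has_young_integral g b 0 t I"
    and w: "set_integrable lborel {0..t} w" "\<And>s. s \<in> {0..t} \<Longrightarrow> w s \<ge> 0"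
    and gw: "\<And>u v. 0 \<le> u \<Longrightarrow> u \<le> v \<Longrightarrow> v \<le> t \<Longrightarrow> (LINT s:{u..v}|lborel. w s) = g u - g v"
    and g: "g t = 0" and b: "b 0 = 0"
  shows "I = (LINT s:{0..t}|lborel. b s * w s)"
proof -
  define J where "J m = (LINT s:{0..m}|lborel. b s * w s)" for m
  obtain V where V: "\<And>s. s \<in> {0..t} \<Longrightarrow> \<bar>b s\<bar> \<le> V"
    by (rule continuous_on_Icc_bounded[OF cont]) blast
  have bw: "set_integrable lborel {0..t} (\<lambda>s. b s * w s)"
    using w V by (intro bounded_mult_set_integrable[where V=V]) auto
  have g0: "g 0 \<ge> 0"
  proof -
    have "0 \<le> (LINT s:{0..t}|lborel. w s)"
      using w(2) unfolding set_lebesgue_integral_def by (intro integral_nonneg_AE) (auto simp: indicator_def)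
    then show ?thesis
      using gw[of 0 t] g t by simp
  qed
  have est: "\<bar>I - J t\<bar> \<le> e * (1 + g 0)" if e: "e > 0" for e
  proof -
    have "\<exists>d>0. \<forall>D. D tagged_division_of {0..t} \<and> (\<forall>(x, K)\<in>D. Sup K - Inf K < d) \<longrightarrow>
        \<bar>(\<Sum>(x, K)\<in>D. g x * (b (Sup K) - b (Inf K))) - I\<bar> < e"
      using young[unfolded has_young_integral_def, rule_format, OF e] .
    then obtain d1 where "d1 > 0 \<and> (\<forall>D. D tagged_division_of {0..t} \<and> (\<forall>(x, K)\<in>D. Sup K - Inf K < d1) \<longrightarrow>
        \<bar>(\<Sum>(x, K)\<in>D. g x * (b (Sup K) - b (Inf K))) - I\<bar> < e)" ..
    note d1 = conjunct1[OF this] conjunct2[OF this, rule_format, OF conjI]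
    obtain d2 where d2: "d2 > 0" "\<And>x y. x \<in> {0..t} \<Longrightarrow> y \<in> {0..t} \<Longrightarrow> \<bar>x - y\<bar> < d2 \<Longrightarrow> \<bar>b x - b y\<bar> < e"
    proof -
      obtain d where "d > 0" "\<And>x x'. x \<in> {0..t} \<Longrightarrow> x' \<in> {0..t} \<Longrightarrow> dist x' x < d \<Longrightarrow> dist (b x') (b x) < e"
        using uniformly_continuous_onE[OF compact_uniformly_continuous[OF cont compact_Icc] e] by blast
      then show ?thesis
        using that[of d] by (simp add: dist_real_def)
    qed
    obtain n :: nat where n: "real n > t / min d1 d2"
      using reals_Archimedean2 by blast
    moreover have "t / min d1 d2 > 0"
      using d1 d2 t by simp
    ultimately have "real n > 0"
      by linarith
    then have n0: "n > 0"
      by simp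
    define p where "p i = t * real i / real n" for i
    have mesh: "p (Suc i) - p i < min d1 d2" for i
    proof -
      have "p (Suc i) - p i = t / real n"
        using n0 by (simp add: p_def field_simps)
      moreover have "t < real n * min d1 d2"
        using n d1 d2 by (simp add: pos_divide_less_eq)
      then have "t / real n < min d1 d2"
        using n0 by (subst pos_divide_less_eq) (simp_all only: mult.commute of_nat_0_less_iff)
      ultimately show ?thesis
        by simp
    qed
    have p: "strict_mono p"
      using t n0 by (intro strict_monoI) (simp add: p_def divide_strict_right_mono)
    have ple: "p i \<le> p j" if "i \<le> j" for i j
      using strict_mono_mono[OF p] that by (rule monoD)
    have p0: "p 0 = 0" and pn: "p n = t"
      using n0 by (auto simp: p_def)
    let ?D = "(\<lambda>i. (p i, {p i..p (Suc i)})) ` {..<n}"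
    have "inj_on (\<lambda>i. (p i, {p i..p (Suc i)})) {..<n}"
      using strict_mono_eq[OF p] by (auto intro!: inj_onI)
    then have "(\<Sum>(x, K)\<in>?D. g x * (b (Sup K) - b (Inf K))) = (\<Sum>i<n. g (p i) * (b (p (Suc i)) - b (p i)))"
      using ple by (subst sum.reindex) (auto intro!: sum.cong)
    also have "\<dots> = (\<Sum>i<n. b (p (Suc i)) * (g (p i) - g (p (Suc i))))"
      using abel_sum[of "\<lambda>i. g (p i)" "\<lambda>i. b (p i)" n] by (simp add: p0 pn g b)
    finally have sum: "(\<Sum>(x, K)\<in>?D. g x * (b (Sup K) - b (Inf K))) = \<dots>" .
    have "?D tagged_division_of {0..t}"
      using tagged_division_of_chain[OF p n0] by (simp add: p0 pn)
    moreover have "\<forall>(x, K)\<in>?D. Sup K - Inf K < d1"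
      using mesh ple by auto
    ultimately have 1: "\<bar>(\<Sum>i<n. b (p (Suc i)) * (g (p i) - g (p (Suc i)))) - I\<bar> < e"
      using d1(2)[of ?D] sum by simp
    \<comment> \<open>On each cell b differs from its right end value by less than e, so the error
      is at most e times the decrease of g there, and these errors telescope.\<close>
    have "\<bar>(\<Sum>i<m. b (p (Suc i)) * (g (p i) - g (p (Suc i)))) - J (p m)\<bar> \<le> e * (g 0 - g (p m))" if "m \<le> n" for m
      using that
    proof (induction m)
      case 0
      have "J 0 = 0"
        unfolding J_def by (rule set_integral_Icc_self)
      then show ?case
        by (simp add: p0)
    next
      case (Suc m)
      let ?u = "p m" and ?v = "p (Suc m)"
      have uv: "0 \<le> ?u" "?u \<le> ?v" "?v \<le> t"
        using ple[of 0 m] ple[of m "Suc m"] ple[of "Suc m" n] Suc.prems by (auto simp: p0 pn)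
      have i1: "set_integrable lborel {?u..?v} (\<lambda>s. b s * w s)" "set_integrable lborel {?u..?v} w"
        using uv by (auto intro: set_integrable_subset[OF bw] set_integrable_subset[OF w(1)])
      have "set_integrable lborel {0..?v} (\<lambda>s. b s * w s)"
        using uv by (auto intro: set_integrable_subset[OF bw])
      then have J: "J ?v = J ?u + (LINT s:{?u..?v}|lborel. b s * w s)"
        unfolding J_def using uv by (intro set_integral_Icc_combine) auto
      have "\<bar>b ?v * (g ?u - g ?v) - (LINT s:{?u..?v}|lborel. b s * w s)\<bar> = \<bar>LINT s:{?u..?v}|lborel. b ?v * w s - b s * w s\<bar>"
        using i1 uv by (subst set_integral_diff) (auto simp: gw)
      also have "\<dots> \<le> (LINT s:{?u..?v}|lborel. e * w s)"
      proof -
        have le: "\<bar>indicator {?u..?v} s * (b ?v * w s - b s * w s)\<bar> \<le> indicator {?u..?v} s * (e * w s)" for s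
        proof (cases "s \<in> {?u..?v}")
          case True
          then have "\<bar>b ?v - b s\<bar> < e"
            using uv mesh[of m] by (intro d2) auto
          then have "\<bar>b ?v - b s\<bar> * w s \<le> e * w s"
            using w(2)[of s] True uv by (intro mult_right_mono) auto
          moreover have "\<bar>b ?v * w s - b s * w s\<bar> = \<bar>b ?v - b s\<bar> * w s"
            using w(2)[of s] True uv by (simp add: abs_mult left_diff_distrib[symmetric])
          ultimately show ?thesis
            using True by simp
        qed auto
        have "\<bar>LINT s:{?u..?v}|lborel. b ?v * w s - b s * w s\<bar> \<le> (LINT s|lborel. \<bar>indicator {?u..?v} s * (b ?v * w s - b s * w s)\<bar>)"
          unfolding set_lebesgue_integral_def by (simp add: integral_abs_bound)
        also have "\<dots> \<le> (LINT s|lborel. indicator {?u..?v} s * (e * w s))"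
        proof (rule integral_mono[OF _ _ le])
          show "integrable lborel (\<lambda>s. \<bar>indicator {?u..?v} s * (b ?v * w s - b s * w s)\<bar>)"
            using set_integral_diff(1)[OF set_integrable_mult_right[OF i1(2), of "b ?v"] i1(1)]
            by (auto simp: set_integrable_def)
          show "integrable lborel (\<lambda>s. indicator {?u..?v} s * (e * w s))"
            using set_integrable_mult_right[OF i1(2), of e] by (auto simp: set_integrable_def)
        qed
        finally show ?thesis
          unfolding set_lebesgue_integral_def real_scaleR_def .
      qed
      also have "\<dots> = e * (g ?u - g ?v)"
        using uv by (simp add: gw)
      finally have "\<bar>b ?v * (g ?u - g ?v) - (LINT s:{?u..?v}|lborel. b s * w s)\<bar> \<le> e * (g ?u - g ?v)" .
      moreover have "\<bar>(\<Sum>i<m. b (p (Suc i)) * (g (p i) - g (p (Suc i)))) - J ?u\<bar> \<le> e * (g 0 - g ?u)"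
        using Suc by simp
      moreover have "e * (g 0 - g ?v) = e * (g 0 - g ?u) + e * (g ?u - g ?v)"
        by (simp add: algebra_simps)
      ultimately show ?case
        unfolding J by simp
    qed
    from this[of n] have 2: "\<bar>(\<Sum>i<n. b (p (Suc i)) * (g (p i) - g (p (Suc i)))) - J t\<bar> \<le> e * g 0"
      by (simp add: pn g)
    have "e * (1 + g 0) = e + e * g 0"
      by (simp add: algebra_simps)
    then show ?thesis
      using 1 2 by linarith
  qed
  have "\<bar>I - J t\<bar> \<le> 0"
  proof (rule field_le_epsilon)
    fix e :: real assume "e > 0"
    then show "\<bar>I - J t\<bar> \<le> 0 + e"
      using est[of "e / (1 + g 0)"] g0 by simp
  qed
  then show ?thesis
    by (simp add: J_def)
qed

text \<open>Covers t = 0: the degenerate division {(u, {u})} meets every mesh condition and has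
  Riemann sum 0.\<close>

lemma has_young_integral_same: "has_young_integral g b u u I \<Longrightarrow> I = 0"
proof -
  assume y: "has_young_integral g b u u I"
  have "\<bar>I\<bar> \<le> e" if "e > 0" for e
  proof -
    have "\<exists>d>0. \<forall>D. D tagged_division_of {u..u} \<and> (\<forall>(x, K)\<in>D. Sup K - Inf K < d) \<longrightarrow>
        \<bar>(\<Sum>(x, K)\<in>D. g x * (b (Sup K) - b (Inf K))) - I\<bar> < e"
      using y[unfolded has_young_integral_def, rule_format, OF that] .
    then obtain d where "d > 0 \<and> (\<forall>D. D tagged_division_of {u..u} \<and> (\<forall>(x, K)\<in>D. Sup K - Inf K < d) \<longrightarrow>
        \<bar>(\<Sum>(x, K)\<in>D. g x * (b (Sup K) - b (Inf K))) - I\<bar> < e)" ..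
    note d = conjunct1[OF this] conjunct2[OF this, rule_format, OF conjI]
    have "{(u, cbox u u)} tagged_division_of (cbox u u)"
      by (rule tagged_division_of_self) simp
    then have "{(u, {u})} tagged_division_of {u..u}"
      by simp
    from d(2)[OF this] d(1) show ?thesis
      by simp
  qed
  then show ?thesis
    using field_le_epsilon[of "\<bar>I\<bar>" 0] by simp
qed

section \<open>Regularity of the noise coefficient and the noise term\<close>

lemma hoelder_on_continuous_on:
  assumes "hoelder_on \<tau> S f" "\<tau> > 0"
  shows "continuous_on S f"
proof -
  obtain K where K: "\<And>s t. s \<in> S \<Longrightarrow> t \<in> S \<Longrightarrow> \<bar>f s - f t\<bar> \<le> K * \<bar>s - t\<bar> powr \<tau>"
    using assms by (auto simp: hoelder_on_def)
  show ?thesis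
    unfolding continuous_on_def
  proof
    fix x assume x: "x \<in> S"
    have "((\<lambda>s. \<bar>s - x\<bar> powr \<tau>) \<longlongrightarrow> \<bar>x - x\<bar> powr \<tau>) (at x within S)"
      using assms by (intro tendsto_powr' tendsto_intros) auto
    then have "((\<lambda>s. K * \<bar>s - x\<bar> powr \<tau>) \<longlongrightarrow> K * \<bar>x - x\<bar> powr \<tau>) (at x within S)"
      by (rule tendsto_mult_left)
    then have "((\<lambda>s. K * \<bar>s - x\<bar> powr \<tau>) \<longlongrightarrow> 0) (at x within S)"
      by simp
    then have "((\<lambda>s. f s - f x) \<longlongrightarrow> 0) (at x within S)"
    proof (rule Lim_null_comparison[rotated])
      show "\<forall>\<^sub>F s in at x within S. norm (f s - f x) \<le> K * \<bar>s - x\<bar> powr \<tau>"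
        using K x by (auto simp: eventually_at_filter)
    qed
    then show "(f \<longlongrightarrow> f x) (at x within S)"
      by (simp add: LIM_zero_iff)
  qed
qed

lemma
  assumes "admissible_noise_coeff \<gamma> p f" "\<gamma> < 1"
  shows admissible_continuous_on: "continuous_on {0..} f"
    and admissible_DERIV: "s > 0 \<Longrightarrow> (f has_real_derivative deriv f s) (at s)"
    and admissible_continuous_on_deriv: "continuous_on {0<..} (deriv f)"
    and admissible_signs: "s > 0 \<Longrightarrow> f s > 0" "s > 0 \<Longrightarrow> deriv f s < 0"
proof -
  \<comment> \<open>\<tau> > 0 because \<gamma> < 1. The Hoelder condition supplies continuity of f
    at 0, where no derivative is available.\<close>
  obtain \<tau> where "\<tau> + \<gamma> > 1" "hoelder_on \<tau> {0..} f"
    using assms by (auto simp: admissible_noise_coeff_def)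
  then show "continuous_on {0..} f"
    using assms by (intro hoelder_on_continuous_on[of \<tau>]) auto
  have "f C1_differentiable_on {0<..}"
    using assms by (simp add: admissible_noise_coeff_def)
  then obtain D where D: "\<And>x. x > 0 \<Longrightarrow> (f has_real_derivative D x) (at x)" "continuous_on {0<..} D"
    by (auto simp: C1_differentiable_on_def has_real_derivative_iff_has_vector_derivative)
  then have eq: "deriv f x = D x" if "x > 0" for x
    using that DERIV_imp_deriv by blast
  show "(f has_real_derivative deriv f s) (at s)" if "s > 0"
    using D that eq by simp
  show "continuous_on {0<..} (deriv f)"
    using D(2) by (rule continuous_on_eq) (use eq in auto)
qed (use assms in \<open>auto simp: admissible_noise_coeff_def\<close>)

lemma borel_measurable_restrict_continuous:
  fixes f :: "real \<Rightarrow> real"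
  assumes "continuous_on {0<..} f"
  shows "(\<lambda>s. if s > 0 then f s else 0) \<in> borel_measurable borel"
proof -
  have "(\<lambda>s. indicator {0<..} s *\<^sub>R f s) \<in> borel_measurable borel"
    using assms by (intro borel_measurable_continuous_on_indicator) auto
  moreover have "(\<lambda>s. indicator {0<..} s *\<^sub>R f s) = (\<lambda>s. if s > 0 then f s else 0)"
    by (auto simp: indicator_def)
  ultimately show ?thesis by simp
qed

text \<open>
  The coefficients are cut off at \<open>0\<close>, where \<open>deriv f\<close> is arbitrary.
\<close>

definition restrict_pos :: "(real \<Rightarrow> real) \<Rightarrow> real \<Rightarrow> real" where
  "restrict_pos f s = (if s > 0 then f s else 0)"

lemma
  assumes "admissible_noise_coeff \<gamma> p f" "\<gamma> < 1"
  shows admissible_measurable: "restrict_pos f \<in> borel_measurable borel"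
      "restrict_pos (\<lambda>s. - deriv f s) \<in> borel_measurable borel"
    and admissible_nonneg: "0 \<le> restrict_pos f s" "0 \<le> restrict_pos (\<lambda>s. - deriv f s) s"
proof -
  note facts = admissible_continuous_on[OF assms] admissible_continuous_on_deriv[OF assms] admissible_signs[OF assms]
  show "restrict_pos f \<in> borel_measurable borel" "restrict_pos (\<lambda>s. - deriv f s) \<in> borel_measurable borel"
    unfolding restrict_pos_def using facts
    by (intro borel_measurable_restrict_continuous continuous_on_minus; force intro: continuous_on_subset)+
  show "0 \<le> restrict_pos f s" "0 \<le> restrict_pos (\<lambda>s. - deriv f s) s"
    using facts by (auto simp: restrict_pos_def less_imp_le)
qed

text \<open>The weight of the integration by parts is the negative derivative of (t - s)^\<beta>
  f(s), with one term in f and one in -f'. After division by Gamma (\<beta> + 1) they carry the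
  kernels of order \<beta> and \<beta> + 1. Splitting the latter as order \<beta> after order 1 puts
  the whole noise under the kernel of the equation, where \<open>variation_of_constants\<close>
  applies.\<close>

lemma noise_term:
  fixes f b :: "real \<Rightarrow> real" and \<beta> t :: real
  assumes \<beta>: "0 < \<beta>" "\<beta> < 1" and adm: "admissible_noise_coeff \<gamma> p f" "\<gamma> < 1" and t: "t \<ge> 0"
    and b: "continuous_on UNIV b" "b 0 = 0"
    and young: "has_young_integral (\<lambda>s. (t - s) powr \<beta> * f s) b 0 t I"
  defines "F \<equiv> restrict_pos f" and "G \<equiv> restrict_pos (\<lambda>s. - deriv f s)"
  shows "I / Gamma (\<beta> + 1) = conv (frac_kernel \<beta>) (\<lambda>s. F s * b s + conv (frac_kernel 1) (\<lambda>r. G r * b r) s) t"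
    and "set_integrable lborel {0..t} G"
proof -
  note facts = admissible_continuous_on[OF adm] admissible_DERIV[OF adm] admissible_continuous_on_deriv[OF adm] admissible_signs[OF adm]
  have bt: "continuous_on {0..t} b"
    using b(1) by (rule continuous_on_subset) auto
  have [measurable]: "b \<in> borel_measurable borel"
    using b by (intro borel_measurable_continuous_onI)
  have [measurable]: "F \<in> borel_measurable borel" "G \<in> borel_measurable borel"
    unfolding F_def G_def using admissible_measurable[OF adm] .
  have ft: "continuous_on {0..t} f"
    using facts(1) by (rule continuous_on_subset) auto
  have G: "set_integrable lborel {0..t} G"
  proof (rule nonneg_derivative_integral(1)[OF t, of "\<lambda>s. - f s"])
    fix x assume "x \<in> {0<..<t}"
    then show "((\<lambda>s. - f s) has_real_derivative G x) (at x)" "0 \<le> G x"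
      using facts(2)[of x] facts(5)[of x] by (auto simp: G_def restrict_pos_def intro!: derivative_eq_intros)
  qed (use ft in \<open>auto intro: continuous_intros\<close>)
  then show "set_integrable lborel {0..t} G" .
  obtain Vf where Vf: "\<And>s. s \<in> {0..t} \<Longrightarrow> \<bar>f s\<bar> \<le> Vf"
    by (rule continuous_on_Icc_bounded[OF ft]) blast
  obtain Vb where Vb: "\<And>s. s \<in> {0..t} \<Longrightarrow> \<bar>b s\<bar> \<le> Vb"
    by (rule continuous_on_Icc_bounded[OF bt]) blast
  have Vf0: "Vf \<ge> 0"
    using Vf[of 0] t by (auto intro: order_trans[OF abs_ge_zero])
  have F: "\<bar>F s\<bar> \<le> Vf" if "s \<in> {0..t}" for s
    using Vf[OF that] Vf0 by (auto simp: F_def restrict_pos_def)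
  have Fb: "\<bar>F s * b s\<bar> \<le> Vf * Vb" if "s \<in> {0..t}" for s
    using F[OF that] Vb[OF that] by (simp add: abs_mult mult_mono')
  have Gb: "set_integrable lborel {0..t} (\<lambda>s. G s * b s)"
    using bounded_mult_set_integrable[OF G _ _ Vb] by (simp add: mult.commute)
  define c where "c = Gamma (\<beta> + 1)"
  have c: "c > 0" "c = \<beta> * Gamma \<beta>"
  proof -
    have "\<beta> \<notin> \<int>\<^sub>\<le>\<^sub>0"
      using \<beta> by (auto elim!: nonpos_Ints_cases)
    then show "c > 0" "c = \<beta> * Gamma \<beta>"
      using \<beta> Gamma_plus1[of \<beta>] by (auto simp: c_def)
  qed
  have k1: "frac_kernel (\<beta> + 1) x = conv (frac_kernel \<beta>) (frac_kernel 1) x" if "x \<ge> 0" for x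
    using \<beta> that by (simp add: conv_frac_kernel)
  have k1_bd: "\<bar>frac_kernel 1 x\<bar> \<le> 1" for x
    by (simp add: frac_kernel_def)
  have k1b_bd: "\<bar>frac_kernel (\<beta> + 1) (t - s)\<bar> \<le> t powr \<beta> / c" if "s \<in> {0..t}" for s
    using that \<beta> c t by (auto simp: frac_kernel_def c_def[symmetric] intro!: divide_right_mono powr_mono2)
  \<comment> \<open>As c = Gamma (\<beta> + 1) = \<beta> Gamma \<beta>, on (0, t) this is \<beta> (t
    - s)^(\<beta> - 1) f(s) - (t - s)^\<beta> f'(s).\<close>
  define w where "w s = c * (frac_kernel \<beta> (t - s) * F s + frac_kernel (\<beta> + 1) (t - s) * G s)" for s
  have [measurable]: "w \<in> borel_measurable borel"
    unfolding w_def by measurable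
  have conv_eq: "I / c = conv (frac_kernel \<beta>) (\<lambda>s. F s * b s) t + conv (frac_kernel (\<beta> + 1)) (\<lambda>s. G s * b s) t"
  proof (cases "t = 0")
    case True
    then have "I = 0"
      using young has_young_integral_same by blast
    moreover have "conv a u 0 = 0" for a u
      unfolding conv_def by (rule set_integral_Icc_self)
    ultimately show ?thesis
      using True by simp
  next
    case False
    then have t0: "t > 0" using t by simp
    have i1: "set_integrable lborel {0..t} (\<lambda>s. frac_kernel \<beta> (t - s) * F s)"
      using \<beta> F by (intro conv_integrable[OF set_integrable_frac_kernel]) auto
    have i2: "set_integrable lborel {0..t} (\<lambda>s. frac_kernel (\<beta> + 1) (t - s) * G s)"
      by (rule bounded_mult_set_integrable[OF G _ _ k1b_bd]) auto
    have "set_integrable lborel {0..t} w"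
      unfolding w_def by (intro set_integrable_mult_right set_integral_add i1 i2)
    moreover have w0: "w s \<ge> 0" if "s \<in> {0..t}" for s
      unfolding w_def using \<beta> c facts(4)[of s] facts(5)[of s]
      by (intro mult_nonneg_nonneg add_nonneg_nonneg frac_kernel_nonneg) (auto simp: F_def G_def restrict_pos_def)
    moreover have "(LINT s:{u..v}|lborel. w s) = (t - u) powr \<beta> * f u - (t - v) powr \<beta> * f v"
      if uv: "0 \<le> u" "u \<le> v" "v \<le> t" for u v
    proof -
      have fuv: "continuous_on {u..v} f"
        using ft by (rule continuous_on_subset) (use uv in auto)
      have "(LINT s:{u..v}|lborel. w s) = - ((t - v) powr \<beta> * f v) - - ((t - u) powr \<beta> * f u)"
      proof (rule nonneg_derivative_integral(2)[OF uv(2)])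
        show "continuous_on {u..v} (\<lambda>a. - ((t - a) powr \<beta> * f a))"
          using \<beta> uv by (intro continuous_intros continuous_on_powr' fuv) auto
        show "0 \<le> w x" if "x \<in> {u<..<v}" for x
          using that uv by (intro w0) auto
        show "((\<lambda>a. - ((t - a) powr \<beta> * f a)) has_real_derivative w x) (at x)" if x: "x \<in> {u<..<v}" for x
        proof -
          have x0: "x > 0" "x < t" using x uv by auto
          have "((\<lambda>a. (t - a) powr \<beta>) has_real_derivative - (\<beta> * (t - x) powr (\<beta> - 1))) (at x)"
            using x0 by (auto intro!: derivative_eq_intros)
          note d = DERIV_minus[OF DERIV_mult[OF this facts(2)[OF x0(1)]]]
          have "w x = (c / Gamma \<beta>) * (t - x) powr (\<beta> - 1) * f x - (c / Gamma (\<beta> + 1)) * (t - x) powr \<beta> * deriv f x"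
            using x0 by (simp add: w_def F_def G_def restrict_pos_def frac_kernel_def right_diff_distrib)
          also have "c / Gamma \<beta> = \<beta>"
            using \<beta> Gamma_real_pos[of \<beta>, THEN less_imp_neq] by (simp add: c(2))
          also have "c / Gamma (\<beta> + 1) = 1"
            using c(1) by (simp add: c_def)
          finally have wx: "w x = \<beta> * (t - x) powr (\<beta> - 1) * f x - 1 * (t - x) powr \<beta> * deriv f x" .
          show ?thesis
            unfolding wx by (rule DERIV_cong[OF d]) (simp add: algebra_simps)
        qed
      qed simp
      then show ?thesis by simp
    qed
    ultimately have "I = (LINT s:{0..t}|lborel. b s * w s)"
      using young_integral_by_parts[OF t0 bt _ young, of w] b by simp
    also have "\<dots> = (LINT s:{0..t}|lborel. c * (frac_kernel \<beta> (t - s) * (F s * b s)) + c * (frac_kernel (\<beta> + 1) (t - s) * (G s * b s)))"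
      by (intro set_lebesgue_integral_cong) (auto simp: w_def algebra_simps)
    also have "\<dots> = c * conv (frac_kernel \<beta>) (\<lambda>s. F s * b s) t + c * conv (frac_kernel (\<beta> + 1)) (\<lambda>s. G s * b s) t"
    proof -
      have "set_integrable lborel {0..t} (\<lambda>s. frac_kernel \<beta> (t - s) * (F s * b s))"
        using \<beta> Fb by (intro conv_integrable[OF set_integrable_frac_kernel, where V = "Vf * Vb"]) auto
      moreover have "set_integrable lborel {0..t} (\<lambda>s. frac_kernel (\<beta> + 1) (t - s) * (G s * b s))"
        by (rule bounded_mult_set_integrable[OF Gb _ _ k1b_bd]) auto
      ultimately show ?thesis
        by (subst set_integral_add) (auto simp: conv_def)
    qed
    finally show ?thesis
      using c(1) by (simp add: distrib_left[symmetric])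
  qed
  have iGb: "set_integrable lborel {0..t} (\<lambda>s. G s * b s) \<and> (\<forall>x\<in>{0..t}. \<bar>frac_kernel 1 x\<bar> \<le> 1)"
    using Gb k1_bd by blast
  have ik: "set_integrable lborel {0..t} (frac_kernel \<beta>)"
    using \<beta> by (intro set_integrable_frac_kernel)
  note cc = conv_conv[OF _ _ _ ik disjI2[OF iGb]]
  have "conv (frac_kernel (\<beta> + 1)) (\<lambda>s. G s * b s) t = conv (conv (frac_kernel \<beta>) (frac_kernel 1)) (\<lambda>s. G s * b s) t"
    unfolding conv_commute[of _ "\<lambda>s. G s * b s"] by (intro conv_cong k1) auto
  also have "\<dots> = conv (frac_kernel \<beta>) (conv (frac_kernel 1) (\<lambda>s. G s * b s)) t"
    by (rule cc(1)[symmetric]) auto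
  finally have "I / c = conv (frac_kernel \<beta>) (\<lambda>s. F s * b s) t + conv (frac_kernel \<beta>) (conv (frac_kernel 1) (\<lambda>s. G s * b s)) t"
    using conv_eq by simp
  also have "\<dots> = conv (frac_kernel \<beta>) (\<lambda>s. F s * b s + conv (frac_kernel 1) (\<lambda>r. G r * b r) s) t"
  proof (rule conv_add[symmetric])
    show "set_integrable lborel {0..t} (\<lambda>s. frac_kernel \<beta> (t - s) * (F s * b s))"
      using Fb by (intro conv_integrable[OF ik, where V = "Vf * Vb"]) auto
    show "set_integrable lborel {0..t} (\<lambda>s. frac_kernel \<beta> (t - s) * conv (frac_kernel 1) (\<lambda>s. G s * b s) s)"
      by (rule cc(2)) auto
  qed
  finally show "I / Gamma (\<beta> + 1) = conv (frac_kernel \<beta>) (\<lambda>s. F s * b s + conv (frac_kernel 1) (\<lambda>r. G r * b r) s) t"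
    by (simp add: c_def)
qed

section \<open>Deviation from the resolvent average\<close>

text \<open>Subadditivity of the power: x \<le> x^\<beta> on [0, 1], applied to b / a and (a - b) /
  a, whose sum is 1.\<close>

lemma powr_diff_le:
  fixes a b \<beta> :: real
  assumes "0 \<le> b" "b \<le> a" "0 < \<beta>" "\<beta> \<le> 1"
  shows "a powr \<beta> - b powr \<beta> \<le> (a - b) powr \<beta>"
proof (cases "a = 0")
  case False
  then have a: "a > 0" using assms by simp
  have *: "x \<le> x powr \<beta>" if "0 \<le> x" "x \<le> 1" for x :: real
    using powr_mono'[of \<beta> 1 x] that assms by (cases "x = 0") auto
  have "b / a + (a - b) / a = 1"
    using a by (simp add: add_divide_distrib[symmetric])
  then have "1 \<le> (b / a) powr \<beta> + ((a - b) / a) powr \<beta>"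
    using *[of "b / a"] *[of "(a - b) / a"] assms a by simp
  then have "1 * a powr \<beta> \<le> ((b / a) powr \<beta> + ((a - b) / a) powr \<beta>) * a powr \<beta>"
    by (intro mult_right_mono) auto
  then show ?thesis
    using a assms by (simp add: powr_divide distrib_right)
qed (use assms in auto)

lemma conv_resolvent_const_le:
  assumes "0 < b" "b \<le> 1" "l > 0" "V \<ge> 0"
  shows "conv (resolvent b l) (\<lambda>_. V) t \<le> V"
proof -
  have "conv (resolvent b l) (\<lambda>_. V) t = V * (LINT s:{0..t}|lborel. resolvent b l s)"
    by (subst conv_commute) (simp add: conv_def)
  also have "\<dots> \<le> V * 1"
    using resolvent_integral_le_1[OF assms(1-3)] assms by (intro mult_left_mono) auto
  finally show ?thesis by simp
qed

lemma conv_resolvent_abs_le: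
  assumes b: "0 < b" "b \<le> 1" "l > 0" and [measurable]: "v \<in> borel_measurable borel"
    and v: "\<And>s. s \<in> {0..t} \<Longrightarrow> \<bar>v s\<bar> \<le> V" and V: "V \<ge> 0"
  shows "\<bar>conv (resolvent b l) v t\<bar> \<le> V"
proof -
  note i = conv_integrable[OF resolvent_integrable[OF b], of _ t V]
  have "\<bar>conv (resolvent b l) v t\<bar> \<le> conv (resolvent b l) (\<lambda>s. \<bar>v s\<bar>) t"
    using b by (intro conv_abs_le resolvent_nonneg)
  also have "\<dots> \<le> conv (resolvent b l) (\<lambda>_. V) t"
    using b v V by (intro conv_mono i resolvent_nonneg) auto
  also have "\<dots> \<le> V"
    using b V by (rule conv_resolvent_const_le)
  finally show ?thesis .
qed

text \<open>This is the non-negativity of D: R has mass at most 1, and v stays below its final value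
  on {0..t}.\<close>

lemma conv_resolvent_le_mono:
  assumes b: "0 < b" "b \<le> 1" "l > 0" and [measurable]: "v \<in> borel_measurable borel"
    and v: "\<And>s. s \<in> {0..t} \<Longrightarrow> 0 \<le> v s" "\<And>s. s \<in> {0..t} \<Longrightarrow> v s \<le> v t" and t: "t \<ge> 0"
  shows "conv (resolvent b l) v t \<le> v t"
  using conv_resolvent_abs_le[OF b, of v t "v t"] assms(4) v t by auto

text \<open>The power is Gamma (b + 1) times the convolution of k with the kernel of order 1. So
  \<open>variation_of_constants\<close> with that kernel as \<open>v\<close> leaves only its average
  under R, divided by l, and R has mass at most 1.\<close>

lemma resolvent_deviation_powr:
  assumes b: "0 < b" "b \<le> 1" "l > 0" and t: "t \<ge> 0"
  shows "t powr b - conv (resolvent b l) (\<lambda>s. s powr b) t \<le> Gamma (b + 1) / l"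
proof -
  let ?R = "resolvent b l"
  have e: "s powr b = Gamma (b + 1) * frac_kernel (b + 1) s" if "s \<ge> 0" for s
    using that b Gamma_real_pos[of "b + 1", THEN less_imp_neq] by (auto simp: frac_kernel_def)
  have 1: "conv ?R (\<lambda>s. s powr b) t = Gamma (b + 1) * conv ?R (frac_kernel (b + 1)) t"
    unfolding conv_cmult[symmetric] by (intro conv_cong e) auto
  have k1: "\<bar>frac_kernel 1 s\<bar> \<le> 1" for s
    by (simp add: frac_kernel_def)
  have "frac_kernel (b + 1) t - conv ?R (frac_kernel (b + 1)) t = 0 - conv ?R (\<lambda>_. 0) t + conv ?R (frac_kernel 1) t / l"
    using b t k1 by (intro variation_of_constants[where V = 1]) (auto simp: conv_frac_kernel)
  also have "\<dots> = conv ?R (frac_kernel 1) t / l"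
    by (simp add: conv_def)
  also have "\<dots> \<le> 1 / l"
    using b conv_resolvent_abs_le[OF b, of "frac_kernel 1" t 1] k1 by (intro divide_right_mono) auto
  finally have "Gamma (b + 1) * (frac_kernel (b + 1) t - conv ?R (frac_kernel (b + 1)) t) \<le> Gamma (b + 1) * (1 / l)"
    using b by (intro mult_left_mono) auto
  then show ?thesis
    using e[OF t] 1 by (simp add: right_diff_distrib)
qed

text \<open>K s^b + P and K s^b - P are non-negative and non-decreasing, so D is non-negative on
  both. Hence |D P| is at most K times D of the power, whatever the signs of the increments of
  P.\<close>

lemma resolvent_deviation_le:
  assumes b: "0 < b" "b \<le> 1" "l > 0" and [measurable]: "P \<in> borel_measurable borel" and t: "t \<ge> 0"
    and P: "\<And>s u. 0 \<le> s \<Longrightarrow> s \<le> u \<Longrightarrow> \<bar>P u - P s\<bar> \<le> K * (u powr b - s powr b)" and P0: "P 0 = 0" and K: "K \<ge> 0"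
  shows "\<bar>P t - conv (resolvent b l) P t\<bar> \<le> K * Gamma (b + 1) / l"
proof -
  let ?R = "resolvent b l"
  have Pb: "\<bar>P s\<bar> \<le> K * s powr b" if "s \<ge> 0" for s
    using P[of 0 s] P0 that b by simp
  have pw: "\<bar>s powr b\<bar> \<le> t powr b" if "s \<in> {0..t}" for s
    using that b by (auto intro!: powr_mono2)
  have Pb': "\<bar>P s\<bar> \<le> K * t powr b" if "s \<in> {0..t}" for s
    using Pb[of s] pw[OF that] that K by (auto intro: order_trans[OF _ mult_left_mono])
  note i = conv_integrable[OF resolvent_integrable[OF b]]
  have iP: "set_integrable lborel {0..t} (\<lambda>s. ?R (t - s) * P s)"
    by (rule i[OF _ Pb']) auto
  have ip: "set_integrable lborel {0..t} (\<lambda>s. ?R (t - s) * (K * s powr b))"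
    by (rule i[where V = "K * t powr b"]) (use pw K in \<open>auto simp: abs_mult intro!: mult_left_mono\<close>)
  have dev: "K * (t powr b - conv ?R (\<lambda>s. s powr b) t) \<le> K * (Gamma (b + 1) / l)"
    using K resolvent_deviation_powr[OF b t] by (intro mult_left_mono)
  have "conv ?R (\<lambda>s. K * s powr b - P s) t \<le> K * t powr b - P t"
  proof (intro conv_resolvent_le_mono b t)
    fix s assume s: "s \<in> {0..t}"
    show "0 \<le> K * s powr b - P s"
      using Pb[of s] s by auto
    show "K * s powr b - P s \<le> K * t powr b - P t"
      using P[of s t] s by (simp add: abs_le_iff algebra_simps)
  qed auto
  then have 1: "P t - conv ?R P t \<le> K * (t powr b - conv ?R (\<lambda>s. s powr b) t)"
    using conv_diff[OF ip iP] by (simp add: conv_cmult right_diff_distrib)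
  have "conv ?R (\<lambda>s. K * s powr b + P s) t \<le> K * t powr b + P t"
  proof (intro conv_resolvent_le_mono b t)
    fix s assume s: "s \<in> {0..t}"
    show "0 \<le> K * s powr b + P s"
      using Pb[of s] s by auto
    show "K * s powr b + P s \<le> K * t powr b + P t"
      using P[of s t] s by (simp add: abs_le_iff algebra_simps)
  qed auto
  then have 2: "- (P t - conv ?R P t) \<le> K * (t powr b - conv ?R (\<lambda>s. s powr b) t)"
    using conv_add[OF ip iP] by (simp add: conv_cmult right_diff_distrib)
  show ?thesis
    using 1 2 dev by (simp add: abs_le_iff)
qed

text \<open>
  A monotone function is squeezed between its averages over adjacent unit windows. This makes the
  bound on \<open>m - P\<close> independent of the exponents \<open>\<eta>\<close> and \<open>r\<close>.
\<close>

lemma mono_window_bound: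
  fixes m P :: "real \<Rightarrow> real"
  assumes m: "mono m" "\<And>t. 0 \<le> m t" and N: "N \<ge> 0"
    and win: "\<And>t. t \<ge> 0 \<Longrightarrow> (\<integral>\<^sup>+x. indicator {t..t+1} x * ennreal \<bar>m x - P x\<bar> \<partial>lborel) \<le> ennreal N"
    and P: "\<And>s t. 0 \<le> s \<Longrightarrow> s \<le> t \<Longrightarrow> t \<le> s + 1 \<Longrightarrow> \<bar>P t - P s\<bar> \<le> S" and P0: "P 0 = 0"
    and t: "t \<ge> 0"
  shows "\<bar>m t - P t\<bar> \<le> N + S"
proof -
  have key: "a \<le> N" if u: "u \<ge> 0" and a: "\<And>x. x \<in> {u..u+1} \<Longrightarrow> a \<le> \<bar>m x - P x\<bar>" for a u
  proof -
    have "ennreal a = (\<integral>\<^sup>+x. indicator {u..u+1} x * ennreal a \<partial>lborel)"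
      by (simp add: mult.commute[of _ "ennreal a"] nn_integral_cmult_indicator)
    also have "\<dots> \<le> (\<integral>\<^sup>+x. indicator {u..u+1} x * ennreal \<bar>m x - P x\<bar> \<partial>lborel)"
      using a by (intro nn_integral_mono) (auto simp: indicator_def intro!: ennreal_leI)
    also have "\<dots> \<le> ennreal N"
      using win[OF u] .
    finally show ?thesis
      using N by (simp add: ennreal_le_iff)
  qed
  have "m t - P t - S \<le> N"
  proof (rule key[OF t])
    fix x assume x: "x \<in> {t..t+1}"
    show "m t - P t - S \<le> \<bar>m x - P x\<bar>"
      using monoD[OF m(1), of t x] P[of t x] t x by auto
  qed
  moreover have "P t - S - m t \<le> N"
  proof (cases "t \<ge> 1")
    case True
    then have "0 \<le> t - 1" by simp
    then show ?thesis
    proof (rule key)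
      fix x assume x: "x \<in> {t-1..t-1+1}"
      show "P t - S - m t \<le> \<bar>m x - P x\<bar>"
        using monoD[OF m(1), of x t] P[of x t] True x by auto
    qed
  next
    case False
    then show ?thesis
      using P[of 0 t] t P0 m(2)[of t] N by simp
  qed
  ultimately show ?thesis
    by (simp add: abs_le_iff)
qed

section \<open>Comparison functions for the classes\<close>

lemma frac_kernel_window:
  assumes "0 < \<eta>" "\<eta> \<le> 1"
  shows "(\<integral>\<^sup>+x. indicator {u..u+1} x * ennreal (frac_kernel \<eta> (x - s)) \<partial>lborel) \<le> ennreal (1 / Gamma (\<eta> + 1))"
proof -
  define v where "v = u - s"
  have hb: "has_bochner_integral lborel (\<lambda>x. frac_kernel 1 (y - x) * frac_kernel \<eta> x) (frac_kernel (\<eta> + 1) y)" for y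
  proof (cases "y > 0")
    case True
    then show ?thesis
      using frac_kernel_conv[of 1 \<eta> y] assms by (simp add: add.commute)
  next
    case False
    then have "(\<lambda>x. frac_kernel 1 (y - x) * frac_kernel \<eta> x) = (\<lambda>_. 0)"
      by (auto simp: frac_kernel_def)
    with False show ?thesis
      by (simp only:) (simp add: frac_kernel_def has_bochner_integral_zero)
  qed
  \<comment> \<open>The difference of the two kernels of order 1 is the indicator of [v, v + 1), and
    the kernel of order \<eta> + 1 is the primitive of that of order \<eta>. So the window integral
    is an increment of the primitive, at most 1 / Gamma (\<eta> + 1) by subadditivity, however
    singular the kernel is at 0.\<close>
  let ?h = "\<lambda>x. frac_kernel 1 (v + 1 - x) * frac_kernel \<eta> x - frac_kernel 1 (v - x) * frac_kernel \<eta> x"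
  have h: "has_bochner_integral lborel ?h (frac_kernel (\<eta> + 1) (v + 1) - frac_kernel (\<eta> + 1) v)"
    by (intro has_bochner_integral_diff hb)
  have h0: "0 \<le> ?h x" for x
    using assms by (auto simp: frac_kernel_def[of 1] frac_kernel_nonneg)
  have "(\<integral>\<^sup>+x. indicator {u..u+1} x * ennreal (frac_kernel \<eta> (x - s)) \<partial>lborel)
     = (\<integral>\<^sup>+x. indicator {u..u+1} (s + 1 * x) * ennreal (frac_kernel \<eta> ((s + 1 * x) - s)) \<partial>lborel)"
    by (subst nn_integral_real_affine[where c = 1 and t = s]) auto
  also have "\<dots> = (\<integral>\<^sup>+x. ennreal (?h x) \<partial>lborel)"
  proof (intro nn_integral_cong_AE)
    have "AE x in lborel. x \<noteq> v" "AE x in lborel. x \<noteq> v + 1"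
      by (rule AE_lborel_singleton)+
    then show "AE x in lborel. indicator {u..u+1} (s + 1 * x) * ennreal (frac_kernel \<eta> ((s + 1 * x) - s)) = ennreal (?h x)"
      by eventually_elim (auto simp: frac_kernel_def[of 1] v_def indicator_def)
  qed
  also have "\<dots> = ennreal (frac_kernel (\<eta> + 1) (v + 1) - frac_kernel (\<eta> + 1) v)"
    using h h0 by (subst nn_integral_eq_integral) (auto simp: has_bochner_integral_iff)
  also have "\<dots> \<le> ennreal (1 / Gamma (\<eta> + 1))"
  proof (intro ennreal_leI)
    consider "v > 0" | "v \<le> 0" "v + 1 > 0" | "v + 1 \<le> 0" by linarith
    then show "frac_kernel (\<eta> + 1) (v + 1) - frac_kernel (\<eta> + 1) v \<le> 1 / Gamma (\<eta> + 1)"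
    proof cases
      case 1
      have "(v + 1) powr \<eta> - v powr \<eta> \<le> 1"
        using powr_diff_le[of v "v + 1" \<eta>] 1 assms by simp
      then have "((v + 1) powr \<eta> - v powr \<eta>) / Gamma (\<eta> + 1) \<le> 1 / Gamma (\<eta> + 1)"
        using assms by (intro divide_right_mono) auto
      then show ?thesis
        using 1 by (simp add: frac_kernel_def diff_divide_distrib)
    next
      case 2
      have "(v + 1) powr \<eta> \<le> 1"
        using 2 assms powr_mono2[of \<eta> "v + 1" 1] by simp
      then show ?thesis
        using 2 assms by (auto simp: frac_kernel_def intro!: divide_right_mono)
    next
      case 3
      then show ?thesis
        using assms by (auto simp: frac_kernel_def)
    qed
  qed
  finally show ?thesis .
qed

text \<open>A strict bound on an infimum is realised by a concrete decomposition, exponent and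
  density, and each summand is then below \<delta>. The density is cut off to 0 at negative times,
  so that its convolution with a kernel becomes an integral over the line.\<close>

lemma norm_X_lessE:
  assumes less: "norm_X \<beta> A m < ennreal \<delta>"
  obtains \<zeta>1 \<zeta>2 \<upsilon> \<eta> g where
    "\<And>t. t \<ge> 0 \<Longrightarrow> m t = \<zeta>1 t + \<zeta>2 t + conv (frac_kernel \<eta>) g t"
    "\<And>t. t \<ge> 0 \<Longrightarrow> \<bar>\<zeta>1 t\<bar> \<le> \<delta>"
    "\<And>t. t \<ge> 0 \<Longrightarrow> \<bar>\<zeta>2 t * mittag_leffler \<beta> 1 (A * t powr \<beta>)\<bar> \<le> \<delta>"
    "continuous_on {0..} \<zeta>2"
    "\<And>t. t > 0 \<Longrightarrow> (\<zeta>2 has_real_derivative deriv \<zeta>2 t) (at t)"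
    "0 < \<upsilon>" "\<upsilon> < \<beta>"
    "\<And>t. t > 0 \<Longrightarrow> \<bar>t powr (1 - \<upsilon>) * deriv \<zeta>2 t\<bar> \<le> \<delta>"
    "0 < \<eta>" "\<eta> < \<beta> + 1"
    "g \<in> borel_measurable borel" "integrable lborel g" "(LINT s|lborel. \<bar>g s\<bar>) \<le> \<delta>"
    "\<And>s. s < 0 \<Longrightarrow> g s = 0"
proof -
  have \<delta>: "\<delta> > 0"
    using less by (metis ennreal_neg not_le not_less_zero)
  obtain \<zeta>1 \<zeta>2 \<zeta>3 where dec: "(\<zeta>1, \<zeta>2, \<zeta>3) \<in> E_decomposition \<beta> m"
    and sum: "norm_X1 \<zeta>1 + norm_X2 \<beta> A \<zeta>2 + norm_X3 \<beta> \<zeta>3 < ennreal \<delta>"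
    using less unfolding norm_X_def INF_less_iff by auto
  have n1: "norm_X1 \<zeta>1 < ennreal \<delta>" and n2: "norm_X2 \<beta> A \<zeta>2 < ennreal \<delta>" and n3: "norm_X3 \<beta> \<zeta>3 < ennreal \<delta>"
    using sum by (auto elim!: le_less_trans[rotated] simp: add_increasing add_increasing2)
  define S1 where "S1 = (SUP t\<in>{0..}. ennreal \<bar>\<zeta>2 t * mittag_leffler \<beta> 1 (A * t powr \<beta>)\<bar>)"
  define S2 where "S2 = (INF \<upsilon>\<in>{0<..<\<beta>}. SUP t\<in>{0..}. ennreal \<bar>t powr (1 - \<upsilon>) * deriv \<zeta>2 t\<bar>)"
  have "S1 + S2 < ennreal \<delta>"
    using n2 by (simp add: norm_X2_def S1_def S2_def)
  then have S1: "S1 < ennreal \<delta>" and S2: "S2 < ennreal \<delta>"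
    by (auto elim!: le_less_trans[rotated] simp: add_increasing add_increasing2)
  have sup: "\<bar>u t\<bar> \<le> \<delta>" if "(SUP t\<in>{0..}. ennreal \<bar>u t\<bar>) < ennreal \<delta>" "t \<ge> 0" for u :: "real \<Rightarrow> real" and t
  proof -
    have "ennreal \<bar>u t\<bar> \<le> (SUP t\<in>{0..}. ennreal \<bar>u t\<bar>)"
      using that by (intro SUP_upper) auto
    then have "ennreal \<bar>u t\<bar> < ennreal \<delta>"
      using that(1) by (rule le_less_trans)
    then show ?thesis
      by (simp add: ennreal_less_iff)
  qed
  obtain \<upsilon> where \<upsilon>: "0 < \<upsilon>" "\<upsilon> < \<beta>" "(SUP t\<in>{0..}. ennreal \<bar>t powr (1 - \<upsilon>) * deriv \<zeta>2 t\<bar>) < ennreal \<delta>"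
    using S2 unfolding S2_def INF_less_iff by auto
  obtain \<eta> r g where rep: "(\<eta>, r, g) \<in> E3_representation \<beta> \<zeta>3" and g: "ennreal (lp_norm 1 g) + ennreal (lp_norm r g) < ennreal \<delta>"
    using n3 unfolding norm_X3_def INF_less_iff by auto
  have "ennreal (lp_norm 1 g) < ennreal \<delta>"
    using g by (auto elim!: le_less_trans[rotated] simp: add_increasing add_increasing2)
  then have lp: "lp_norm 1 g \<le> \<delta>"
    using \<delta> by (cases "lp_norm 1 g \<ge> 0") (auto simp: ennreal_less_iff)
  define g0 where "g0 s = indicator {0..} s * g s" for s
  have m0: "g0 \<in> borel_measurable borel"
    using rep by (simp add: g0_def[abs_def] E3_representation_def lp_space_def set_borel_measurable_def)
  have "integrable lborel (\<lambda>s. \<bar>g0 s\<bar>)"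
    using rep by (simp add: g0_def E3_representation_def lp_space_def set_integrable_def abs_mult)
  then have i0: "integrable lborel g0"
    using m0 by (subst (asm) integrable_abs_iff) auto
  have "(LINT s|lborel. \<bar>g0 s\<bar>) = lp_norm 1 g"
  proof -
    have "0 \<le> (LINT s|lborel. \<bar>g0 s\<bar>)"
      by simp
    then show ?thesis
      by (simp add: lp_norm_def set_lebesgue_integral_def g0_def abs_mult)
  qed
  with lp have l0: "(LINT s|lborel. \<bar>g0 s\<bar>) \<le> \<delta>"
    by simp
  have z3: "\<zeta>3 t = conv (frac_kernel \<eta>) g0 t" if "t \<ge> 0" for t
  proof -
    have "\<zeta>3 t = (LINT s:{0..t}|lborel. 1 / Gamma \<eta> * ((t - s) powr (\<eta> - 1) * g s))"
      using rep that by (simp add: E3_representation_def riemann_liouville_def)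
    also have "\<dots> = conv (frac_kernel \<eta>) g0 t"
      unfolding conv_def by (intro set_lebesgue_integral_cong) (auto simp: frac_kernel_def g0_def)
    finally show ?thesis .
  qed
  show thesis
  proof (rule that[of \<zeta>1 \<zeta>2 \<eta> g0 \<upsilon>])
    show "m t = \<zeta>1 t + \<zeta>2 t + conv (frac_kernel \<eta>) g0 t" if "t \<ge> 0" for t
      using dec that z3[OF that] by (simp add: E_decomposition_def)
    show "\<bar>\<zeta>1 t\<bar> \<le> \<delta>" if "t \<ge> 0" for t
      using sup[of \<zeta>1 t] n1 that by (simp add: norm_X1_def)
    show "\<bar>\<zeta>2 t * mittag_leffler \<beta> 1 (A * t powr \<beta>)\<bar> \<le> \<delta>" if "t \<ge> 0" for t
      using sup[of "\<lambda>t. \<zeta>2 t * mittag_leffler \<beta> 1 (A * t powr \<beta>)" t] S1 that by (simp add: S1_def)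
    show "continuous_on {0..} \<zeta>2"
      using dec by (simp add: E_decomposition_def class_E2_def)
    show "(\<zeta>2 has_real_derivative deriv \<zeta>2 t) (at t)" if "t > 0" for t
    proof -
      have "\<zeta>2 C1_differentiable_on {0<..}"
        using dec by (simp add: E_decomposition_def class_E2_def)
      then obtain D where "\<forall>x\<in>{0<..}. (\<zeta>2 has_vector_derivative D x) (at x)"
        unfolding C1_differentiable_on_def by blast
      then have "(\<zeta>2 has_real_derivative D t) (at t)"
        using that by (simp add: has_real_derivative_iff_has_vector_derivative)
      then show ?thesis
        using DERIV_imp_deriv[of \<zeta>2 "D t" t] by simp
    qed
    show "\<bar>t powr (1 - \<upsilon>) * deriv \<zeta>2 t\<bar> \<le> \<delta>" if "t > 0" for t
      using sup[OF \<upsilon>(3), of t] that by simp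
    show "0 < \<eta>" "\<eta> < \<beta> + 1"
      using rep by (auto simp: E3_representation_def)
  qed (use \<upsilon> m0 i0 l0 in \<open>auto simp: g0_def\<close>)
qed

text \<open>K x^\<beta> + f and K x^\<beta> - f have non-negative derivatives, so their monotonicity
  bounds the increments of f by those of K x^\<beta>.\<close>

lemma powr_lipschitz:
  fixes f :: "real \<Rightarrow> real"
  assumes "0 < s" "s \<le> t"
    and der: "\<And>x. s \<le> x \<Longrightarrow> x \<le> t \<Longrightarrow> (f has_real_derivative f' x) (at x)"
    and bd: "\<And>x. s \<le> x \<Longrightarrow> x \<le> t \<Longrightarrow> \<bar>f' x\<bar> \<le> K * (\<beta> * x powr (\<beta> - 1))"
  shows "\<bar>f t - f s\<bar> \<le> K * (t powr \<beta> - s powr \<beta>)"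
proof -
  have p: "((\<lambda>x. K * x powr \<beta>) has_real_derivative K * (\<beta> * x powr (\<beta> - 1))) (at x)" if "s \<le> x" for x
    using that assms(1) by (auto intro!: derivative_eq_intros)
  have "K * s powr \<beta> - f s \<le> K * t powr \<beta> - f t"
  proof (rule DERIV_nonneg_imp_nondecreasing[OF assms(2)])
    fix x assume x: "s \<le> x" "x \<le> t"
    show "\<exists>y. ((\<lambda>x. K * x powr \<beta> - f x) has_real_derivative y) (at x) \<and> 0 \<le> y"
      using DERIV_diff[OF p der] bd[of x] x by (intro exI conjI) (auto simp: abs_le_iff)
  qed
  moreover have "K * s powr \<beta> + f s \<le> K * t powr \<beta> + f t"
  proof (rule DERIV_nonneg_imp_nondecreasing[OF assms(2)])
    fix x assume x: "s \<le> x" "x \<le> t"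
    show "\<exists>y. ((\<lambda>x. K * x powr \<beta> + f x) has_real_derivative y) (at x) \<and> 0 \<le> y"
      using DERIV_add[OF p der] bd[of x] x by (intro exI conjI) (auto simp: abs_le_iff)
  qed
  ultimately show ?thesis
    by (simp add: abs_le_iff algebra_simps)
qed

text \<open>Freezing f before t0 is what makes the second class fit: since \<upsilon> < \<beta>, its
  derivative bound x^(\<upsilon> - 1) exceeds every multiple of x^(\<beta> - 1) near 0, but not
  beyond t0. Clamping only shrinks the increments of the power.\<close>

lemma clamped_powr_lipschitz:
  fixes f :: "real \<Rightarrow> real"
  assumes "0 < t0" "0 \<le> s" "s \<le> t" "0 < \<beta>" "K \<ge> 0"
    and der: "\<And>x. t0 \<le> x \<Longrightarrow> (f has_real_derivative f' x) (at x)"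
    and bd: "\<And>x. t0 \<le> x \<Longrightarrow> \<bar>f' x\<bar> \<le> K * (\<beta> * x powr (\<beta> - 1))"
  shows "\<bar>f (max t t0) - f (max s t0)\<bar> \<le> K * (t powr \<beta> - s powr \<beta>)"
proof -
  have "\<bar>f (max t t0) - f (max s t0)\<bar> \<le> K * (max t t0 powr \<beta> - max s t0 powr \<beta>)"
    using assms by (intro powr_lipschitz[where f'=f']) auto
  also have "\<dots> \<le> K * (t powr \<beta> - s powr \<beta>)"
  proof (intro mult_left_mono)
    have "s powr \<beta> \<le> t powr \<beta>"
      using assms by (intro powr_mono2) auto
    moreover have "s powr \<beta> \<le> max s t0 powr \<beta>"
      using assms by (intro powr_mono2) auto
    ultimately show "max t t0 powr \<beta> - max s t0 powr \<beta> \<le> t powr \<beta> - s powr \<beta>"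
      using assms by (auto simp: max_def)
  qed (use assms in auto)
  finally show ?thesis .
qed

text \<open>Where the weight is at least 1 / 2, the weighted supremum in the second norm bounds the
  function itself. The time t0 depends on \<beta> and A alone, and t0 \<le> 1 lets t0^(\<upsilon> -
  \<beta>) be bounded by t0^(-\<beta>), uniformly in \<upsilon>.\<close>

lemma mittag_leffler_ge_half:
  assumes "0 < \<beta>"
  shows "\<exists>t0. 0 < t0 \<and> t0 \<le> 1 \<and> (\<forall>t. 0 \<le> t \<and> t \<le> t0 \<longrightarrow> mittag_leffler \<beta> 1 (A * t powr \<beta>) \<ge> 1 / 2)"
proof -
  have "((\<lambda>t. A * t powr \<beta>) \<longlongrightarrow> A * 0) (at_right (0::real))"
    using assms tendsto_powr'[of "\<lambda>t::real. t" 0 "at_right 0" "\<lambda>_. \<beta>" \<beta>]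
    by (intro tendsto_mult tendsto_const) (auto simp: eventually_at_filter)
  then have "((\<lambda>t. A * t powr \<beta>) \<longlongrightarrow> 0) (at_right (0::real))"
    by simp
  then have "((\<lambda>t. mittag_leffler \<beta> 1 (A * t powr \<beta>)) \<longlongrightarrow> mittag_leffler \<beta> 1 0) (at_right 0)"
    by (rule isCont_tendsto_compose[OF isCont_mittag_leffler[OF assms zero_less_one]])
  then have "eventually (\<lambda>t. mittag_leffler \<beta> 1 (A * t powr \<beta>) > 1 / 2) (at_right 0)"
    by (rule order_tendstoD) (simp add: mittag_leffler_0)
  then obtain u where u: "u > 0" "\<And>t. 0 < t \<Longrightarrow> t < u \<Longrightarrow> mittag_leffler \<beta> 1 (A * t powr \<beta>) > 1 / 2"
    by (auto simp: eventually_at_right_field)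
  have "mittag_leffler \<beta> 1 (A * t powr \<beta>) \<ge> 1 / 2" if "0 \<le> t" "t \<le> min 1 (u / 2)" for t
    using u(1) u(2)[of t] that by (cases "t = 0") (auto simp: mittag_leffler_0)
  then show ?thesis
    using u(1) by (intro exI[of _ "min 1 (u / 2)"]) auto
qed

lemma ennreal_abs_integral_le:
  fixes f :: "'a \<Rightarrow> real"
  shows "ennreal \<bar>integral\<^sup>L M f\<bar> \<le> (\<integral>\<^sup>+x. ennreal \<bar>f x\<bar> \<partial>M)"
proof (cases "integrable M f")
  case True
  then show ?thesis
    using integral_norm_bound_ennreal[OF True] by simp
qed (simp add: not_integrable_integral_eq)

text \<open>For \<eta> > 1 this is the kernel of order \<eta> frozen before time 1, minus its value
  at 1. It vanishes up to time 1, which avoids the steep start of x^(\<eta> - 1), and differs from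
  the kernel by a bounded amount. For \<eta> \<le> 1 the kernel does not grow and nothing is split
  off.\<close>

definition growing_part :: "real \<Rightarrow> real \<Rightarrow> real" where
  "growing_part \<eta> x = (if \<eta> > 1 then max x 1 powr (\<eta> - 1) / Gamma \<eta> - 1 / Gamma \<eta> else 0)"

lemma growing_part_measurable [measurable]: "growing_part \<eta> \<in> borel_measurable borel"
  unfolding growing_part_def by measurable

lemma growing_part_le_1: "x \<le> 1 \<Longrightarrow> growing_part \<eta> x = 0"
  by (simp add: growing_part_def)

context
  fixes \<beta> \<eta> c :: real
  assumes \<beta>: "0 < \<beta>" "\<beta> < 1" and \<eta>: "0 < \<eta>" "\<eta> < \<beta> + 1"
    and c: "c > 0" "\<And>x. x \<ge> 1 \<Longrightarrow> c \<le> Gamma x"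
begin

lemma growing_part_lipschitz:
  assumes "0 \<le> s" "s \<le> t"
  shows "\<bar>growing_part \<eta> t - growing_part \<eta> s\<bar> \<le> 1 / c * (t powr \<beta> - s powr \<beta>)"
proof (cases "\<eta> > 1")
  case True
  have "\<bar>max t 1 powr (\<eta> - 1) / Gamma \<eta> - max s 1 powr (\<eta> - 1) / Gamma \<eta>\<bar> \<le> 1 / c * (t powr \<beta> - s powr \<beta>)"
  proof (rule clamped_powr_lipschitz)
    fix x :: real assume x: "1 \<le> x"
    show "((\<lambda>x. x powr (\<eta> - 1) / Gamma \<eta>) has_real_derivative (\<eta> - 1) * x powr (\<eta> - 2) / Gamma \<eta>) (at x)"
      using x Gamma_real_pos[OF \<eta>(1), THEN less_imp_neq] by (auto intro!: derivative_eq_intros)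
    \<comment> \<open>Since \<eta> - 1 < \<beta> and x \<ge> 1, growth of order below \<beta> is
      dominated by that of x^\<beta>.\<close>
    have "(\<eta> - 1) * x powr (\<eta> - 2) / Gamma \<eta> \<le> \<beta> * x powr (\<beta> - 1) / c"
      using x True \<eta> c c(2)[of \<eta>] by (intro frac_le mult_mono powr_mono) auto
    then show "\<bar>(\<eta> - 1) * x powr (\<eta> - 2) / Gamma \<eta>\<bar> \<le> 1 / c * (\<beta> * x powr (\<beta> - 1))"
      using True by (simp add: abs_mult)
  qed (use \<beta> c assms in auto)
  then show ?thesis
    using True by (simp add: growing_part_def)
next
  case False
  have "s powr \<beta> \<le> t powr \<beta>"
    using assms \<beta> by (intro powr_mono2) auto
  with False show ?thesis
    using c by (simp add: growing_part_def)
qed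

lemma growing_part_increment:
  assumes "s \<le> t" "t \<le> s + 1"
  shows "\<bar>growing_part \<eta> t - growing_part \<eta> s\<bar> \<le> 1 / c"
proof (cases "s \<ge> 0")
  case True
  have "t powr \<beta> - s powr \<beta> \<le> (t - s) powr \<beta>"
    using assms True \<beta> by (intro powr_diff_le) auto
  also have "\<dots> \<le> 1"
    using assms \<beta> powr_mono2[of \<beta> "t - s" 1] by simp
  finally have "1 / c * (t powr \<beta> - s powr \<beta>) \<le> 1 / c * 1"
    using c by (intro mult_left_mono) auto
  then show ?thesis
    using growing_part_lipschitz[OF True assms(1)] by simp
next
  \<comment> \<open>Here t \<le> s + 1 < 1, so both values are 0.\<close>
  case False
  then show ?thesis
    using assms c by (simp add: growing_part_le_1)
qed

lemma frac_kernel_minus_growing_part: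
  assumes "\<eta> > 1"
  shows "\<bar>frac_kernel \<eta> x - growing_part \<eta> x\<bar> \<le> 1 / c"
proof -
  have g: "0 < 1 / Gamma \<eta>" "1 / Gamma \<eta> \<le> 1 / c"
    using assms c c(2)[of \<eta>] by (auto intro!: divide_left_mono mult_pos_pos)
  consider "x \<le> 0" | "0 < x" "x \<le> 1" | "x > 1" by linarith
  then show ?thesis
  proof cases
    case 1
    then show ?thesis using c by (simp add: frac_kernel_def growing_part_le_1)
  next
    case 2
    then have "x powr (\<eta> - 1) \<le> 1"
      using assms powr_mono2[of "\<eta> - 1" x 1] by simp
    then have "x powr (\<eta> - 1) / Gamma \<eta> \<le> 1 / Gamma \<eta>"
      using assms by (intro divide_right_mono) auto
    then show ?thesis
      using 2 g assms by (simp add: frac_kernel_def growing_part_le_1)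
  next
    case 3
    then show ?thesis
      using assms g by (simp add: frac_kernel_def growing_part_def)
  qed
qed

end

text \<open>For \<eta> \<le> 1 the kernel is integrated over the window first, by Tonelli, and
  \<open>frac_kernel_window\<close> leaves the L^1 norm of g. For \<eta> > 1 the kernel and its
  growing part differ by at most 1 / c, which gives the bound even pointwise.\<close>

lemma window_E3_bound:
  fixes g :: "real \<Rightarrow> real"
  assumes \<beta>: "0 < \<beta>" "\<beta> < 1" and \<eta>: "0 < \<eta>" "\<eta> < \<beta> + 1"
    and c: "c > 0" "\<And>x. x \<ge> 1 \<Longrightarrow> c \<le> Gamma x"
    and [measurable]: "g \<in> borel_measurable borel" and g: "integrable lborel g" and g\<delta>: "(LINT s|lborel. \<bar>g s\<bar>) \<le> \<delta>"
    and t: "t \<ge> 0"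
  shows "(\<integral>\<^sup>+x. indicator {t..t+1} x * ennreal \<bar>conv (frac_kernel \<eta>) g x - conv (growing_part \<eta>) g x\<bar> \<partial>lborel) \<le> ennreal (\<delta> / c)"
proof -
  have gn: "(\<integral>\<^sup>+s. ennreal \<bar>g s\<bar> \<partial>lborel) \<le> ennreal \<delta>"
    using g g\<delta> by (subst nn_integral_eq_integral) (auto intro!: ennreal_leI)
  have \<delta>0: "\<delta> \<ge> 0"
    using g\<delta> by (rule order_trans[rotated]) simp
  show ?thesis
  proof (cases "\<eta> > 1")
    case False
    then have gp: "growing_part \<eta> = (\<lambda>_. 0)"
      by (auto simp: growing_part_def)
    have "(\<integral>\<^sup>+x. indicator {t..t+1} x * ennreal \<bar>conv (frac_kernel \<eta>) g x - conv (growing_part \<eta>) g x\<bar> \<partial>lborel)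
       \<le> (\<integral>\<^sup>+x. indicator {t..t+1} x * (\<integral>\<^sup>+s. ennreal (frac_kernel \<eta> (x - s)) * ennreal \<bar>g s\<bar> \<partial>lborel) \<partial>lborel)"
    proof (intro nn_integral_mono mult_left_mono)
      fix x :: real
      have "ennreal \<bar>conv (frac_kernel \<eta>) g x\<bar> \<le> (\<integral>\<^sup>+s. ennreal \<bar>indicator {0..x} s *\<^sub>R (frac_kernel \<eta> (x - s) * g s)\<bar> \<partial>lborel)"
        unfolding conv_def set_lebesgue_integral_def by (rule ennreal_abs_integral_le)
      also have "\<dots> \<le> (\<integral>\<^sup>+s. ennreal (frac_kernel \<eta> (x - s)) * ennreal \<bar>g s\<bar> \<partial>lborel)"
        using \<eta> by (intro nn_integral_mono)
          (auto simp: indicator_def abs_mult frac_kernel_nonneg ennreal_mult')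
      finally show "ennreal \<bar>conv (frac_kernel \<eta>) g x - conv (growing_part \<eta>) g x\<bar> \<le> (\<integral>\<^sup>+s. ennreal (frac_kernel \<eta> (x - s)) * ennreal \<bar>g s\<bar> \<partial>lborel)"
        by (simp add: gp conv_def)
    qed simp
    also have "\<dots> = (\<integral>\<^sup>+x. \<integral>\<^sup>+s. ennreal \<bar>g s\<bar> * (indicator {t..t+1} x * ennreal (frac_kernel \<eta> (x - s))) \<partial>lborel \<partial>lborel)"
      by (intro nn_integral_cong, subst nn_integral_cmult[symmetric]) (auto simp: mult_ac)
    also have "\<dots> = (\<integral>\<^sup>+s. \<integral>\<^sup>+x. ennreal \<bar>g s\<bar> * (indicator {t..t+1} x * ennreal (frac_kernel \<eta> (x - s))) \<partial>lborel \<partial>lborel)"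
      by (rule lborel_pair.Fubini') measurable
    also have "\<dots> = (\<integral>\<^sup>+s. ennreal \<bar>g s\<bar> * (\<integral>\<^sup>+x. indicator {t..t+1} x * ennreal (frac_kernel \<eta> (x - s)) \<partial>lborel) \<partial>lborel)"
      by (intro nn_integral_cong nn_integral_cmult) measurable
    also have "\<dots> \<le> (\<integral>\<^sup>+s. ennreal \<bar>g s\<bar> * ennreal (1 / c) \<partial>lborel)"
    proof (intro nn_integral_mono mult_left_mono)
      fix s
      have "(\<integral>\<^sup>+x. indicator {t..t+1} x * ennreal (frac_kernel \<eta> (x - s)) \<partial>lborel) \<le> ennreal (1 / Gamma (\<eta> + 1))"
        using \<eta> False by (intro frac_kernel_window) auto
      also have "\<dots> \<le> ennreal (1 / c)"
        using \<eta> c c(2)[of "\<eta> + 1"] by (intro ennreal_leI divide_left_mono mult_pos_pos) auto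
      finally show "(\<integral>\<^sup>+x. indicator {t..t+1} x * ennreal (frac_kernel \<eta> (x - s)) \<partial>lborel) \<le> ennreal (1 / c)" .
    qed simp
    also have "\<dots> = (\<integral>\<^sup>+s. ennreal \<bar>g s\<bar> \<partial>lborel) * ennreal (1 / c)"
      by (rule nn_integral_multc) measurable
    also have "\<dots> \<le> ennreal \<delta> * ennreal (1 / c)"
      by (intro mult_right_mono gn) simp
    also have "\<dots> = ennreal (\<delta> / c)"
      using c \<delta>0 by (simp add: ennreal_mult'[symmetric])
    finally show ?thesis .
  next
    case True
    have bd: "\<bar>conv (frac_kernel \<eta>) g x - conv (growing_part \<eta>) g x\<bar> \<le> \<delta> / c" if "x \<ge> 0" for x
    proof -
      have kbd: "\<bar>growing_part \<eta> (x - s)\<bar> \<le> 1 / c * x powr \<beta>" if "s \<in> {0..x}" for s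
      proof -
        have "\<bar>growing_part \<eta> (x - s)\<bar> \<le> 1 / c * ((x - s) powr \<beta> - 0 powr \<beta>)"
          using growing_part_lipschitz[OF \<beta> \<eta> c, of 0 "x - s"] that by (simp add: growing_part_le_1)
        also have "\<dots> \<le> 1 / c * x powr \<beta>"
          using c \<beta> that by (intro mult_left_mono) (auto intro!: powr_mono2)
        finally show ?thesis .
      qed
      have fbd: "\<bar>frac_kernel \<eta> (x - s)\<bar> \<le> 1 / c + 1 / c * x powr \<beta>" if "s \<in> {0..x}" for s
        using kbd[OF that] frac_kernel_minus_growing_part[OF \<beta> \<eta> c True, of "x - s"] by linarith
      have ig: "set_integrable lborel {0..x} g"
        using g by (auto simp: set_integrable_def intro!: integrable_mult_indicator[where 'b = real, simplified])
      have 1: "set_integrable lborel {0..x} (\<lambda>s. growing_part \<eta> (x - s) * g s)"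
        by (rule bounded_mult_set_integrable[OF ig _ _ kbd]) auto
      have 2: "set_integrable lborel {0..x} (\<lambda>s. frac_kernel \<eta> (x - s) * g s)"
        by (rule bounded_mult_set_integrable[OF ig _ _ fbd]) auto
      have eq: "conv (frac_kernel \<eta>) g x - conv (growing_part \<eta>) g x =
          (LINT s:{0..x}|lborel. frac_kernel \<eta> (x - s) * g s - growing_part \<eta> (x - s) * g s)"
        unfolding conv_def by (rule set_integral_diff(2)[symmetric, OF 2 1])
      have "\<bar>LINT s:{0..x}|lborel. frac_kernel \<eta> (x - s) * g s - growing_part \<eta> (x - s) * g s\<bar>
          \<le> (LINT s|lborel. \<bar>indicator {0..x} s *\<^sub>R (frac_kernel \<eta> (x - s) * g s - growing_part \<eta> (x - s) * g s)\<bar>)"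
        unfolding set_lebesgue_integral_def by (rule integral_abs_bound)
      also have "\<dots> \<le> (LINT s|lborel. 1 / c * \<bar>g s\<bar>)"
      proof (rule integral_mono)
        show "integrable lborel (\<lambda>s. \<bar>indicator {0..x} s *\<^sub>R (frac_kernel \<eta> (x - s) * g s - growing_part \<eta> (x - s) * g s)\<bar>)"
          using set_integral_diff(1)[OF 2 1] unfolding set_integrable_def by (rule integrable_abs)
        fix s
        have "\<bar>frac_kernel \<eta> (x - s) - growing_part \<eta> (x - s)\<bar> * \<bar>g s\<bar> \<le> 1 / c * \<bar>g s\<bar>"
          by (intro mult_right_mono frac_kernel_minus_growing_part[OF \<beta> \<eta> c True]) auto
        moreover have "0 \<le> 1 / c * \<bar>g s\<bar>"
          using c by simp
        ultimately show "\<bar>indicator {0..x} s *\<^sub>R (frac_kernel \<eta> (x - s) * g s - growing_part \<eta> (x - s) * g s)\<bar> \<le> 1 / c * \<bar>g s\<bar>"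
          by (simp add: indicator_def abs_mult left_diff_distrib[symmetric])
      qed (use g in auto)
      also have "\<dots> = 1 / c * (LINT s|lborel. \<bar>g s\<bar>)"
        by (rule integral_mult_right_zero)
      also have "\<dots> \<le> 1 / c * \<delta>"
        using c g\<delta> by (intro mult_left_mono) auto
      finally show ?thesis
        unfolding eq by simp
    qed
    have "(\<integral>\<^sup>+x. indicator {t..t+1} x * ennreal \<bar>conv (frac_kernel \<eta>) g x - conv (growing_part \<eta>) g x\<bar> \<partial>lborel)
       \<le> (\<integral>\<^sup>+x. indicator {t..t+1} x * ennreal (\<delta> / c) \<partial>lborel)"
      using bd t by (intro nn_integral_mono) (auto simp: indicator_def intro!: ennreal_leI)
    also have "\<dots> = ennreal (\<delta> / c)"
      by (simp add: mult.commute[of _ "ennreal (\<delta> / c)"] nn_integral_cmult_indicator)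
    finally show ?thesis .
  qed
qed

text \<open>\<open>Q\<close> superposes delayed copies of the growing part with weights g of total
  mass at most \<delta>. The estimates on increments, size and deviation survive delays and
  superposition, so they pass from the growing part to \<open>Q\<close> with the factor
  \<delta>.\<close>

lemma growing_part_conv_bounds:
  fixes g :: "real \<Rightarrow> real"
  assumes \<beta>: "0 < \<beta>" "\<beta> < 1" and l: "l > 0" and \<eta>: "0 < \<eta>" "\<eta> < \<beta> + 1"
    and c: "c > 0" "\<And>x. x \<ge> 1 \<Longrightarrow> c \<le> Gamma x"
    and [measurable]: "g \<in> borel_measurable borel" and g: "integrable lborel g" and g\<delta>: "(LINT s|lborel. \<bar>g s\<bar>) \<le> \<delta>"
    and g0: "\<And>s. s < 0 \<Longrightarrow> g s = 0"
  defines "Q \<equiv> conv (growing_part \<eta>) g"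
  shows "Q \<in> borel_measurable borel"
    and "0 \<le> s \<Longrightarrow> s \<le> t \<Longrightarrow> t \<le> s + 1 \<Longrightarrow> \<bar>Q t - Q s\<bar> \<le> \<delta> / c"
    and "0 \<le> t \<Longrightarrow> \<bar>Q t\<bar> \<le> t powr \<beta> * \<delta> / c"
    and "0 \<le> t \<Longrightarrow> \<bar>Q t - conv (resolvent \<beta> l) Q t\<bar> \<le> \<delta> * Gamma (\<beta> + 1) / (c * l)"
proof -
  have Q: "Q t = (LINT s|lborel. growing_part \<eta> (t - s) * g s)" for t
    unfolding Q_def using g0 by (intro conv_eq_integral) (auto simp: growing_part_le_1)
  show "Q \<in> borel_measurable borel"
    unfolding Q by measurable
  have gp_bd: "\<bar>growing_part \<eta> x\<bar> \<le> 1 / c * t powr \<beta>" if "x \<le> t" "0 \<le> t" for x t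
  proof (cases "x \<ge> 0")
    case True
    have "\<bar>growing_part \<eta> x\<bar> \<le> 1 / c * (x powr \<beta> - 0 powr \<beta>)"
      using growing_part_lipschitz[OF \<beta> \<eta> c, of 0 x] True by (simp add: growing_part_le_1)
    also have "\<dots> \<le> 1 / c * t powr \<beta>"
      using c \<beta> that True by (intro mult_left_mono) (auto intro!: powr_mono2)
    finally show ?thesis .
  qed (use c in \<open>simp add: growing_part_le_1\<close>)
  have prod_bd: "\<bar>LINT s|lborel. k s * g s\<bar> \<le> V * \<delta>" and prod_int: "integrable lborel (\<lambda>s. k s * g s)"
    if [measurable]: "k \<in> borel_measurable borel" and k: "\<And>s. s \<ge> 0 \<Longrightarrow> \<bar>k s\<bar> \<le> V" for k :: "real \<Rightarrow> real" and V
  proof -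
    have V: "V \<ge> 0"
      using k[of 0] by simp
    have le: "\<bar>k s * g s\<bar> \<le> V * \<bar>g s\<bar>" for s
      using k[of s] g0[of s] by (cases "s \<ge> 0") (auto simp: abs_mult intro!: mult_right_mono)
    have Vg: "integrable lborel (\<lambda>s. V * \<bar>g s\<bar>)"
      using g by simp
    show i: "integrable lborel (\<lambda>s. k s * g s)"
      by (rule Bochner_Integration.integrable_bound[OF Vg]) (use le V in auto)
    have "\<bar>LINT s|lborel. k s * g s\<bar> \<le> (LINT s|lborel. \<bar>k s * g s\<bar>)"
      by (rule integral_abs_bound)
    also have "\<dots> \<le> (LINT s|lborel. V * \<bar>g s\<bar>)"
      using i Vg le by (intro integral_mono integrable_abs)
    also have "\<dots> = V * (LINT s|lborel. \<bar>g s\<bar>)"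
      by (rule integral_mult_right_zero)
    also have "\<dots> \<le> V * \<delta>"
      using V g\<delta> by (intro mult_left_mono)
    finally show "\<bar>LINT s|lborel. k s * g s\<bar> \<le> V * \<delta>" .
  qed
  show "\<bar>Q t\<bar> \<le> t powr \<beta> * \<delta> / c" if "0 \<le> t" for t
    using prod_bd[of "\<lambda>s. growing_part \<eta> (t - s)" "1 / c * t powr \<beta>"] gp_bd[of _ t] that by (simp add: Q)
  show "\<bar>Q t - Q s\<bar> \<le> \<delta> / c" if st: "0 \<le> s" "s \<le> t" "t \<le> s + 1" for s t
  proof -
    have i: "integrable lborel (\<lambda>r. growing_part \<eta> (u - r) * g r)" if "u \<ge> 0" for u
      by (rule prod_int[of _ "1 / c * u powr \<beta>"]) (use gp_bd that in auto)
    have "Q t - Q s = (LINT r|lborel. (growing_part \<eta> (t - r) - growing_part \<eta> (s - r)) * g r)"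
      using st i[of t] i[of s] by (simp add: Q left_diff_distrib)
    then show ?thesis
      using prod_bd[of "\<lambda>r. growing_part \<eta> (t - r) - growing_part \<eta> (s - r)" "1 / c"]
        growing_part_increment[OF \<beta> \<eta> c] st by simp
  qed
  show "\<bar>Q t - conv (resolvent \<beta> l) Q t\<bar> \<le> \<delta> * Gamma (\<beta> + 1) / (c * l)" if t: "0 \<le> t" for t
  proof -
    let ?R = "resolvent \<beta> l" and ?G = "growing_part \<eta>"
    have \<beta>1: "\<beta> \<le> 1" using \<beta> by simp
    have ig: "set_integrable lborel {0..t} g"
      using g by (auto simp: set_integrable_def intro!: integrable_mult_indicator[where 'b = real, simplified])
    have iR: "set_integrable lborel {0..t} ?R"
      using \<beta> l by (intro resolvent_integrable) auto
    have h: "set_integrable lborel {0..t} g \<and> (\<forall>x\<in>{0..t}. \<bar>?G x\<bar> \<le> 1 / c * t powr \<beta>)"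
      using ig gp_bd[of _ t] t by auto
    \<comment> \<open>Associativity gives D (G * g) = (D G) * g, so the deviation bound for the
      growing part can be used under the integral against g.\<close>
    note cc = conv_conv[OF _ _ _ iR disjI2[OF h]]
    have 1: "set_integrable lborel {0..t} (\<lambda>s. conv ?R ?G (t - s) * g s)"
      by (rule cc(3)) auto
    have 2: "set_integrable lborel {0..t} (\<lambda>s. ?G (t - s) * g s)"
      by (rule bounded_mult_set_integrable[OF ig, where V = "1 / c * t powr \<beta>"]) (use gp_bd t in auto)
    have "conv ?R Q t = conv (conv ?R ?G) g t"
      unfolding Q_def by (rule cc(1)) auto
    then have eq: "Q t - conv ?R Q t = (LINT s:{0..t}|lborel. ?G (t - s) * g s - conv ?R ?G (t - s) * g s)"
      unfolding Q_def conv_def[of _ g] by (simp only: set_integral_diff(2)[OF 2 1])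
    have "\<bar>LINT s:{0..t}|lborel. ?G (t - s) * g s - conv ?R ?G (t - s) * g s\<bar>
        \<le> (LINT s|lborel. \<bar>indicator {0..t} s *\<^sub>R (?G (t - s) * g s - conv ?R ?G (t - s) * g s)\<bar>)"
      unfolding set_lebesgue_integral_def by (rule integral_abs_bound)
    also have "\<dots> \<le> (LINT s|lborel. 1 / c * Gamma (\<beta> + 1) / l * \<bar>g s\<bar>)"
    proof (rule integral_mono)
      show "integrable lborel (\<lambda>s. \<bar>indicator {0..t} s *\<^sub>R (?G (t - s) * g s - conv ?R ?G (t - s) * g s)\<bar>)"
        using set_integral_diff(1)[OF 2 1] unfolding set_integrable_def by (rule integrable_abs)
      show "integrable lborel (\<lambda>s. 1 / c * Gamma (\<beta> + 1) / l * \<bar>g s\<bar>)"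
        using g by (intro Bochner_Integration.integrable_mult_right integrable_abs)
      fix s
      have K: "0 \<le> 1 / c * Gamma (\<beta> + 1) / l"
        using c \<beta> l by (auto intro!: divide_nonneg_pos mult_nonneg_nonneg less_imp_le[OF Gamma_real_pos])
      show "\<bar>indicator {0..t} s *\<^sub>R (?G (t - s) * g s - conv ?R ?G (t - s) * g s)\<bar> \<le> 1 / c * Gamma (\<beta> + 1) / l * \<bar>g s\<bar>"
      proof (cases "s \<in> {0..t}")
        case True
        have "\<bar>?G (t - s) - conv ?R ?G (t - s)\<bar> \<le> 1 / c * Gamma (\<beta> + 1) / l"
          using True c growing_part_lipschitz[OF \<beta> \<eta> c]
          by (intro resolvent_deviation_le[OF \<beta>(1) \<beta>1 l]) (auto simp: growing_part_le_1)
        then have "\<bar>?G (t - s) - conv ?R ?G (t - s)\<bar> * \<bar>g s\<bar> \<le> 1 / c * Gamma (\<beta> + 1) / l * \<bar>g s\<bar>"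
          by (intro mult_right_mono) auto
        then show ?thesis
          using True by (simp add: abs_mult left_diff_distrib[symmetric])
      next
        case False
        have "0 \<le> 1 / c * Gamma (\<beta> + 1) / l * \<bar>g s\<bar>"
          using K by (rule mult_nonneg_nonneg) simp
        with False show ?thesis
          by simp
      qed
    qed
    also have "\<dots> = 1 / c * Gamma (\<beta> + 1) / l * (LINT s|lborel. \<bar>g s\<bar>)"
      by (rule integral_mult_right_zero)
    also have "\<dots> \<le> 1 / c * Gamma (\<beta> + 1) / l * \<delta>"
      using c \<beta> l g\<delta> by (intro mult_left_mono) (auto intro!: divide_nonneg_pos mult_nonneg_nonneg less_imp_le[OF Gamma_real_pos])
    finally show ?thesis
      unfolding eq by (simp add: mult_ac)
  qed
qed

text \<open>The constant precedes m and \<delta>, so it cannot depend on the exponents or the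
  decomposition behind the norm. The split m = P + (m - P) separates a part that may be unbounded,
  but grows at most like t^\<beta>, from a bounded one. The bound on the latter comes from the
  monotonicity of m.\<close>

lemma mean_deviation_bound:
  assumes \<beta>: "0 < \<beta>" "\<beta> < 1" and l: "l > 0"
  shows "\<exists>c>0. \<forall>m \<delta>. mono m \<longrightarrow> (\<forall>t. 0 \<le> m t) \<longrightarrow> norm_X \<beta> A m < ennreal \<delta> \<longrightarrow>
      (\<forall>t\<ge>0. m t - conv (resolvent \<beta> l) m t \<le> c * \<delta>)"
proof -
  let ?R = "resolvent \<beta> l"
  have \<beta>1: "\<beta> \<le> 1" using \<beta> by simp
  obtain c0 where c0: "c0 > 0" "\<And>x. x \<ge> 1 \<Longrightarrow> c0 \<le> Gamma (x::real)"
    using Gamma_lower_bound by blast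
  obtain t0 where t0: "0 < t0" "t0 \<le> 1" and half: "\<And>t. 0 \<le> t \<Longrightarrow> t \<le> t0 \<Longrightarrow> mittag_leffler \<beta> 1 (A * t powr \<beta>) \<ge> 1 / 2"
    using mittag_leffler_ge_half[OF \<beta>(1), of A] by blast
  \<comment> \<open>For x \<ge> t0, |\<zeta>2'(x)| \<le> \<delta> x^(\<upsilon> - 1) \<le> \<delta>
    t0^(-\<beta>) x^(\<beta> - 1). The factor 1 / \<beta> comes from the derivative of
    x^\<beta>.\<close>
  define K where "K = t0 powr (- \<beta>) / \<beta>"
  have K: "K > 0"
    using \<beta> t0 by (simp add: K_def)
  \<comment> \<open>The summands bound D P2, D P3 and twice |m - P|, once for its value and once for
    its average under R. In the last one, 3 + 1 / c0 belongs to the window mean of |m - P| and K + 1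
    / c0 to the increments of P over steps of length at most 1.\<close>
  define c where "c = K * Gamma (\<beta> + 1) / l + Gamma (\<beta> + 1) / (c0 * l) + 2 * (3 + 1 / c0 + (K + 1 / c0))"
  have c: "c > 0"
    unfolding c_def using K c0 l \<beta> by (intro add_pos_pos divide_pos_pos mult_pos_pos) auto
  have "m t - conv ?R m t \<le> c * \<delta>"
    if m: "mono m" "\<And>t. 0 \<le> m t" and less: "norm_X \<beta> A m < ennreal \<delta>" and t: "t \<ge> 0" for m \<delta> t
  proof -
    obtain \<zeta>1 \<zeta>2 \<upsilon> \<eta> g where
      dec: "\<And>t. t \<ge> 0 \<Longrightarrow> m t = \<zeta>1 t + \<zeta>2 t + conv (frac_kernel \<eta>) g t"
      and z1: "\<And>t. t \<ge> 0 \<Longrightarrow> \<bar>\<zeta>1 t\<bar> \<le> \<delta>"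
      and z2: "\<And>t. t \<ge> 0 \<Longrightarrow> \<bar>\<zeta>2 t * mittag_leffler \<beta> 1 (A * t powr \<beta>)\<bar> \<le> \<delta>"
      and z2c: "continuous_on {0..} \<zeta>2"
      and z2d: "\<And>t. t > 0 \<Longrightarrow> (\<zeta>2 has_real_derivative deriv \<zeta>2 t) (at t)"
      and \<upsilon>: "0 < \<upsilon>" "\<upsilon> < \<beta>"
      and z2b: "\<And>t. t > 0 \<Longrightarrow> \<bar>t powr (1 - \<upsilon>) * deriv \<zeta>2 t\<bar> \<le> \<delta>"
      and \<eta>: "0 < \<eta>" "\<eta> < \<beta> + 1"
      and g: "g \<in> borel_measurable borel" "integrable lborel g" "(LINT s|lborel. \<bar>g s\<bar>) \<le> \<delta>"
      and g0: "\<And>s. s < 0 \<Longrightarrow> g s = 0"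
      by (rule norm_X_lessE[OF less]) blast
    have \<delta>: "\<delta> \<ge> 0"
      using z1[of 0] by simp
    \<comment> \<open>Frozen on [0, t0], so that only the part of \<zeta>2 with a uniform derivative
      bound enters P. The remainder \<zeta>2 - P2 is \<zeta>2 (min x t0), which the weighted
      supremum controls.\<close>
    define P2 where "P2 x = \<zeta>2 (max x t0) - \<zeta>2 t0" for x
    define P3 where "P3 = conv (growing_part \<eta>) g"
    define P where "P x = P2 x + P3 x" for x
    note Q = growing_part_conv_bounds[OF \<beta> l \<eta> _ _ g, of c0]
    have P3: "P3 \<in> borel_measurable borel"
        "\<And>s t. 0 \<le> s \<Longrightarrow> s \<le> t \<Longrightarrow> t \<le> s + 1 \<Longrightarrow> \<bar>P3 t - P3 s\<bar> \<le> \<delta> / c0"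
        "\<And>t. 0 \<le> t \<Longrightarrow> \<bar>P3 t\<bar> \<le> t powr \<beta> * \<delta> / c0"
        "\<And>t. 0 \<le> t \<Longrightarrow> \<bar>P3 t - conv ?R P3 t\<bar> \<le> \<delta> * Gamma (\<beta> + 1) / (c0 * l)"
      unfolding P3_def by (rule Q; use c0 g0 in simp)+
    have [measurable]: "P2 \<in> borel_measurable borel"
    proof (rule borel_measurable_continuous_onI)
      have "continuous_on UNIV (\<lambda>x. \<zeta>2 (max x t0))"
        by (rule continuous_on_compose2[OF z2c]) (use t0 in \<open>auto intro!: continuous_intros\<close>)
      then show "continuous_on UNIV P2"
        unfolding P2_def by (intro continuous_intros)
    qed
    have [measurable]: "P3 \<in> borel_measurable borel"
      by (rule P3(1))
    have [measurable]: "m \<in> borel_measurable borel"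
      using m(1) by (rule borel_measurable_mono)
    have [measurable]: "P \<in> borel_measurable borel"
      unfolding P_def by measurable
    have lip2: "\<bar>P2 u - P2 s\<bar> \<le> \<delta> * K * (u powr \<beta> - s powr \<beta>)" if "0 \<le> s" "s \<le> u" for s u
    proof -
      have "\<bar>\<zeta>2 (max u t0) - \<zeta>2 (max s t0)\<bar> \<le> \<delta> * K * (u powr \<beta> - s powr \<beta>)"
      proof (rule clamped_powr_lipschitz[OF t0(1) that \<beta>(1)])
        show "0 \<le> \<delta> * K"
          using \<delta> K by simp
        fix x assume x: "t0 \<le> x"
        then have x0: "x > 0" using t0 by simp
        show "(\<zeta>2 has_real_derivative deriv \<zeta>2 x) (at x)"
          using x0 by (rule z2d)
        have "\<bar>deriv \<zeta>2 x\<bar> = x powr (\<upsilon> - 1) * \<bar>x powr (1 - \<upsilon>) * deriv \<zeta>2 x\<bar>"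
          using x0 by (simp add: abs_mult mult.assoc[symmetric] powr_add[symmetric])
        also have "\<dots> \<le> x powr (\<upsilon> - 1) * \<delta>"
          using z2b[OF x0] by (intro mult_left_mono) auto
        also have "x powr (\<upsilon> - 1) = x powr (\<upsilon> - \<beta>) * x powr (\<beta> - 1)"
          by (simp add: powr_add[symmetric])
        also have "x powr (\<upsilon> - \<beta>) \<le> t0 powr (\<upsilon> - \<beta>)"
          using x t0 \<upsilon> by (intro powr_mono2') auto
        also have "t0 powr (\<upsilon> - \<beta>) \<le> t0 powr (- \<beta>)"
          using t0 \<upsilon> by (intro powr_mono') auto
        finally show "\<bar>deriv \<zeta>2 x\<bar> \<le> \<delta> * K * (\<beta> * x powr (\<beta> - 1))"
          using \<beta> \<delta> by (simp add: K_def mult_ac mult_left_mono mult_right_mono)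
      qed
      then show ?thesis
        by (simp add: P2_def)
    qed
    have P20: "P2 0 = 0" and P30: "P3 0 = 0"
      using t0 P3(3)[of 0] by (auto simp: P2_def)
    have inc: "\<bar>P u - P s\<bar> \<le> \<delta> * (K + 1 / c0)" if "0 \<le> s" "s \<le> u" "u \<le> s + 1" for s u
    proof -
      have "u powr \<beta> - s powr \<beta> \<le> (u - s) powr \<beta>"
        using that \<beta> by (intro powr_diff_le) auto
      also have "\<dots> \<le> 1"
        using that \<beta> powr_mono2[of \<beta> "u - s" 1] by simp
      finally have "\<delta> * K * (u powr \<beta> - s powr \<beta>) \<le> \<delta> * K * 1"
        using \<delta> K by (intro mult_left_mono) auto
      then have "\<bar>P2 u - P2 s\<bar> \<le> \<delta> * K"
        using lip2[of s u] that by simp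
      moreover have "\<bar>P3 u - P3 s\<bar> \<le> \<delta> / c0"
        using that by (rule P3(2))
      ultimately show ?thesis
        unfolding P_def by (simp add: distrib_left)
    qed
    \<comment> \<open>One \<delta> comes from \<zeta>1, and 2 \<delta> from \<zeta>2 (min x t0),
      where the weight is at least 1 / 2.\<close>
    have b12: "\<bar>m x - P x\<bar> \<le> 3 * \<delta> + \<bar>conv (frac_kernel \<eta>) g x - P3 x\<bar>" if x: "x \<ge> 0" for x
    proof -
      have "\<zeta>2 x - P2 x = \<zeta>2 (min x t0)"
        by (auto simp: P2_def max_def min_def)
      moreover have "\<bar>\<zeta>2 (min x t0)\<bar> \<le> 2 * \<delta>"
      proof -
        let ?y = "min x t0"
        have y: "0 \<le> ?y" "?y \<le> t0" using x t0 by auto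
        have "\<bar>\<zeta>2 ?y\<bar> * (1 / 2) \<le> \<bar>\<zeta>2 ?y\<bar> * mittag_leffler \<beta> 1 (A * ?y powr \<beta>)"
          using half[OF y] by (intro mult_left_mono) auto
        also have "\<dots> \<le> \<delta>"
          using z2[OF y(1)] half[OF y] by (simp add: abs_mult)
        finally show ?thesis by simp
      qed
      ultimately show ?thesis
        using dec[OF x] z1[OF x] unfolding P_def by linarith
    qed
    have diff: "\<bar>m x - P x\<bar> \<le> \<delta> * (3 + 1 / c0) + \<delta> * (K + 1 / c0)" if x: "x \<ge> 0" for x
    proof (rule mono_window_bound[OF m _ _ inc _ x])
      show "0 \<le> \<delta> * (3 + 1 / c0)"
        using \<delta> c0 by simp
      show "P 0 = 0"
        using P20 P30 by (simp add: P_def)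
      fix u :: real assume u: "u \<ge> 0"
      have "(\<integral>\<^sup>+x. indicator {u..u+1} x * ennreal \<bar>m x - P x\<bar> \<partial>lborel) \<le>
          (\<integral>\<^sup>+x. ennreal (3 * \<delta>) * indicator {u..u+1} x + indicator {u..u+1} x * ennreal \<bar>conv (frac_kernel \<eta>) g x - P3 x\<bar> \<partial>lborel)"
        using b12 u \<delta> by (intro nn_integral_mono) (auto simp: indicator_def ennreal_plus[symmetric] simp del: ennreal_plus intro!: ennreal_leI)
      also have "\<dots> \<le> (\<integral>\<^sup>+x. ennreal (3 * \<delta>) * indicator {u..u+1} x \<partial>lborel) + (\<integral>\<^sup>+x. indicator {u..u+1} x * ennreal \<bar>conv (frac_kernel \<eta>) g x - P3 x\<bar> \<partial>lborel)"
      proof (rule eq_refl[OF nn_integral_add])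
        show "(\<lambda>x. indicator {u..u+1} x * ennreal \<bar>conv (frac_kernel \<eta>) g x - P3 x\<bar>) \<in> borel_measurable lborel"
        proof -
          have [measurable]: "conv (frac_kernel \<eta>) g \<in> borel_measurable borel"
            using g(1) g0 by (intro conv_measurable) (auto simp: frac_kernel_def)
          show ?thesis by measurable
        qed
      qed measurable
      also have "\<dots> \<le> ennreal (3 * \<delta>) + ennreal (\<delta> / c0)"
        using window_E3_bound[OF \<beta> \<eta> c0 g u] unfolding P3_def
        by (intro add_mono) (auto simp: nn_integral_cmult_indicator)
      also have "\<dots> = ennreal (\<delta> * (3 + 1 / c0))"
        using \<delta> c0 by (simp add: ennreal_plus[symmetric] distrib_left mult.commute del: ennreal_plus)
      finally show "(\<integral>\<^sup>+x. indicator {u..u+1} x * ennreal \<bar>m x - P x\<bar> \<partial>lborel) \<le> ennreal (\<delta> * (3 + 1 / c0))" .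
    qed
    let ?N = "\<delta> * (3 + 1 / c0) + \<delta> * (K + 1 / c0)"
    have N: "?N \<ge> 0"
      using \<delta> c0 K by simp
    have Kd: "0 \<le> \<delta> * K"
      using \<delta> K by simp
    have dev2: "\<bar>P2 t - conv ?R P2 t\<bar> \<le> \<delta> * K * Gamma (\<beta> + 1) / l"
      by (rule resolvent_deviation_le[OF \<beta>(1) \<beta>1 l _ t lip2 P20 Kd]) auto
    have dev3: "\<bar>P3 t - conv ?R P3 t\<bar> \<le> \<delta> * Gamma (\<beta> + 1) / (c0 * l)"
      by (rule P3(4)[OF t])
    have devq: "\<bar>conv ?R (\<lambda>x. m x - P x) t\<bar> \<le> ?N"
      using diff by (intro conv_resolvent_abs_le \<beta> \<beta>1 l N) auto
    have pw: "s powr \<beta> \<le> t powr \<beta>" if "s \<in> {0..t}" for s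
      using that \<beta> by (auto intro!: powr_mono2)
    note iR = resolvent_integrable[OF \<beta>(1) \<beta>1 l, of t]
    have i2: "set_integrable lborel {0..t} (\<lambda>s. ?R (t - s) * P2 s)"
    proof (rule conv_integrable[OF iR])
      fix s assume s: "s \<in> {0..t}"
      show "\<bar>P2 s\<bar> \<le> \<delta> * K * t powr \<beta>"
        using lip2[of 0 s] s P20 mult_left_mono[OF pw[OF s] Kd] by auto
    qed auto
    have i3: "set_integrable lborel {0..t} (\<lambda>s. ?R (t - s) * P3 s)"
    proof (rule conv_integrable[OF iR])
      fix s assume s: "s \<in> {0..t}"
      have "s powr \<beta> * (\<delta> / c0) \<le> t powr \<beta> * (\<delta> / c0)"
        using \<delta> c0 pw[OF s] by (intro mult_right_mono) auto
      then show "\<bar>P3 s\<bar> \<le> t powr \<beta> * \<delta> / c0"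
        using P3(3)[of s] s by auto
    qed auto
    have iq: "set_integrable lborel {0..t} (\<lambda>s. ?R (t - s) * (m s - P s))"
      using diff by (intro conv_integrable[OF iR, where V = ?N]) auto
    have "conv ?R m t = conv ?R (\<lambda>s. (P2 s + P3 s) + (m s - P s)) t"
      by (intro conv_cong) (simp add: P_def)
    also have "\<dots> = conv ?R (\<lambda>s. P2 s + P3 s) t + conv ?R (\<lambda>s. m s - P s) t"
      using set_integral_add(1)[OF i2 i3] iq by (intro conv_add) (auto simp: distrib_left)
    also have "conv ?R (\<lambda>s. P2 s + P3 s) t = conv ?R P2 t + conv ?R P3 t"
      by (rule conv_add[OF i2 i3])
    finally have "m t - conv ?R m t = (P2 t - conv ?R P2 t) + (P3 t - conv ?R P3 t) + (m t - P t) - conv ?R (\<lambda>s. m s - P s) t"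
      by (simp add: P_def)
    also have "\<dots> \<le> \<delta> * K * Gamma (\<beta> + 1) / l + \<delta> * Gamma (\<beta> + 1) / (c0 * l) + ?N + ?N"
      using dev2 dev3 devq diff[OF t] by linarith
    also have "\<dots> = c * \<delta>"
      by (simp add: c_def algebra_simps)
    finally show ?thesis .
  qed
  with c show ?thesis
    by blast
qed

section \<open>Processes and moments\<close>

text \<open>
  Joint measurability holds because the version is the limit of its discretisations in time.
\<close>

lemma continuous_process_version:
  assumes "continuous_process M Y"
  obtains Z where "\<And>\<omega>. continuous_on UNIV (\<lambda>t. Z t \<omega>)"
    and "(\<lambda>(t, \<omega>). Z t \<omega>) \<in> borel_measurable (borel \<Otimes>\<^sub>M M)"
    and "AE \<omega> in M. \<forall>t. Z t \<omega> = Y (max 0 t) \<omega>"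
proof -
  have meas: "Y t \<in> borel_measurable M" if "t \<ge> 0" for t
    using assms that by (simp add: continuous_process_def)
  have "AE \<omega> in M. continuous_on {0..} (\<lambda>t. Y t \<omega>)"
    using assms by (simp add: continuous_process_def)
  then obtain N where N: "{\<omega> \<in> space M. \<not> continuous_on {0..} (\<lambda>t. Y t \<omega>)} \<subseteq> N" "N \<in> sets M" "emeasure M N = 0"
    by (rule AE_E)
  \<comment> \<open>Paths are set to 0 on a null set and frozen at their initial value for negative
    times. So every path is continuous on the whole line, and paths monotone on {0..} become
    monotone everywhere.\<close>
  define Z where "Z t \<omega> = indicator (space M - N) \<omega> * Y (max 0 t) \<omega>" for t \<omega>
  have [measurable]: "Z t \<in> borel_measurable M" for t
    unfolding Z_def using N meas by (intro borel_measurable_times) auto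
  have cont: "continuous_on UNIV (\<lambda>t. Z t \<omega>)" for \<omega>
  proof (cases "\<omega> \<in> space M - N")
    case True
    then have "continuous_on {0..} (\<lambda>t. Y t \<omega>)"
      using N by auto
    then have "continuous_on UNIV (\<lambda>t. Y (max 0 t) \<omega>)"
      by (rule continuous_on_compose2[where g = "\<lambda>t. Y t \<omega>"]) (auto intro!: continuous_intros)
    with True show ?thesis
      by (simp add: Z_def)
  next
    case False
    then show ?thesis
      by (simp add: Z_def indicator_simps(2))
  qed
  define Zn where "Zn n p = Z (real_of_int \<lfloor>real (Suc n) * fst p\<rfloor> / real (Suc n)) (snd p)" for n :: nat and p :: "real \<times> 'a"
  have "(\<lambda>(t, \<omega>). Z t \<omega>) \<in> borel_measurable (borel \<Otimes>\<^sub>M M)"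
  proof (rule borel_measurable_LIMSEQ_real[where u = Zn])
    fix p :: "real \<times> 'a"
    obtain t \<omega> where p: "p = (t, \<omega>)" by fastforce
    have "(\<lambda>n. real_of_int \<lfloor>real (Suc n) * t\<rfloor> / real (Suc n)) \<longlonglongrightarrow> t"
    proof (rule real_tendsto_sandwich[where f = "\<lambda>n. t - inverse (real (Suc n))" and h = "\<lambda>_. t"])
      show "(\<lambda>n. t - inverse (real (Suc n))) \<longlonglongrightarrow> t"
        using tendsto_diff[OF tendsto_const[of t] LIMSEQ_inverse_real_of_nat] by simp
      have "real_of_int \<lfloor>real (Suc n) * t\<rfloor> / real (Suc n) \<le> t" for n
        by (simp add: pos_divide_le_eq mult.commute del: of_nat_Suc)
      then show "\<forall>\<^sub>F n in sequentially. real_of_int \<lfloor>real (Suc n) * t\<rfloor> / real (Suc n) \<le> t"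
        by simp
      have "t - inverse (real (Suc n)) \<le> real_of_int \<lfloor>real (Suc n) * t\<rfloor> / real (Suc n)" for n
      proof -
        have "real (Suc n) * t - 1 \<le> real_of_int \<lfloor>real (Suc n) * t\<rfloor>"
          by linarith
        then have "(real (Suc n) * t - 1) / real (Suc n) \<le> real_of_int \<lfloor>real (Suc n) * t\<rfloor> / real (Suc n)"
          by (rule divide_right_mono) simp
        moreover have "(real (Suc n) * t - 1) / real (Suc n) = t - inverse (real (Suc n))"
          by (simp add: diff_divide_distrib inverse_eq_divide del: of_nat_Suc)
        ultimately show ?thesis
          by simp
      qed
      then show "\<forall>\<^sub>F n in sequentially. t - inverse (real (Suc n)) \<le> real_of_int \<lfloor>real (Suc n) * t\<rfloor> / real (Suc n)"
        by simp
    qed auto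
    then show "(\<lambda>n. Zn n p) \<longlonglongrightarrow> (case p of (t, \<omega>) \<Rightarrow> Z t \<omega>)"
      unfolding p Zn_def by (simp del: of_nat_Suc)
        (rule continuous_on_tendsto_compose[OF cont[of \<omega>]], auto)
  next
    fix n
    show "Zn n \<in> borel_measurable (borel \<Otimes>\<^sub>M M)"
      unfolding Zn_def
    proof (rule measurable_compose_countable'[where I = "UNIV :: int set" and g = "\<lambda>p. \<lfloor>real (Suc n) * fst p\<rfloor>"
          and f = "\<lambda>i p. Z (real_of_int i / real (Suc n)) (snd p)"])
      show "(\<lambda>p. \<lfloor>real (Suc n) * fst p\<rfloor>) \<in> (borel \<Otimes>\<^sub>M M) \<rightarrow>\<^sub>M count_space UNIV"
        by measurable
    qed auto
  qed
  moreover have "AE \<omega> in M. \<forall>t. Z t \<omega> = Y (max 0 t) \<omega>"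
  proof (rule AE_I[OF _ N(3,2)])
    show "{\<omega> \<in> space M. \<not> (\<forall>t. Z t \<omega> = Y (max 0 t) \<omega>)} \<subseteq> N"
      by (auto simp: Z_def indicator_def)
  qed
  ultimately show thesis
    using that[of Z] cont by blast
qed

context prob_space
begin

text \<open>The inequality |Y| \<le> (v + Y^2 / v) / 2 takes the place of Cauchy-Schwarz; its right
  side has mean exactly v.\<close>

lemma abs_first_moment_le:
  assumes [measurable]: "Y \<in> borel_measurable M" and Y: "(\<integral>\<omega>. Y \<omega> * Y \<omega> \<partial>M) = v\<^sup>2" and v: "v > 0"
  shows "(\<integral>\<^sup>+\<omega>. ennreal \<bar>Y \<omega>\<bar> \<partial>M) \<le> ennreal v"
proof -
  \<comment> \<open>A non-integrable square would have Bochner integral 0 by convention, which v > 0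
    excludes.\<close>
  have i: "integrable M (\<lambda>\<omega>. Y \<omega> * Y \<omega>)"
    using not_integrable_integral_eq[of M "\<lambda>\<omega>. Y \<omega> * Y \<omega>"] Y v by auto
  have am: "\<bar>Y \<omega>\<bar> \<le> (v + Y \<omega> * Y \<omega> / v) / 2" for \<omega>
  proof -
    have "0 \<le> (\<bar>Y \<omega>\<bar> - v)\<^sup>2"
      by simp
    then have "2 * \<bar>Y \<omega>\<bar> * v \<le> v * v + Y \<omega> * Y \<omega>"
      by (simp add: power2_eq_square algebra_simps)
    then show ?thesis
      using v by (simp add: field_simps)
  qed
  have "(\<integral>\<^sup>+\<omega>. ennreal \<bar>Y \<omega>\<bar> \<partial>M) \<le> (\<integral>\<^sup>+\<omega>. ennreal ((v + Y \<omega> * Y \<omega> / v) / 2) \<partial>M)"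
    by (intro nn_integral_mono ennreal_leI am)
  also have "\<dots> = ennreal (\<integral>\<omega>. (v + Y \<omega> * Y \<omega> / v) / 2 \<partial>M)"
    using i v by (intro nn_integral_eq_integral) auto
  also have "(\<integral>\<omega>. (v + Y \<omega> * Y \<omega> / v) / 2 \<partial>M) = v"
    using i Y v by (simp add: prob_space power2_eq_square)
  finally show ?thesis .
qed

lemma fractional_brownian_motion_moment:
  assumes B: "fractional_brownian_motion M \<gamma> B" and s: "s > 0"
  shows "(\<integral>\<^sup>+\<omega>. ennreal \<bar>B s \<omega>\<bar> \<partial>M) \<le> ennreal (s powr \<gamma>)"
proof (rule abs_first_moment_le)
  show "B s \<in> borel_measurable M"
    using B s by (simp add: fractional_brownian_motion_def continuous_process_def)
  have "(\<integral>\<omega>. B s \<omega> * B s \<omega> \<partial>M) = s powr (2 * \<gamma>)"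
  proof -
    have "(\<integral>\<omega>. B s \<omega> * B s \<omega> \<partial>M) = 1 / 2 * (s powr (2 * \<gamma>) + s powr (2 * \<gamma>) - \<bar>s - s\<bar> powr (2 * \<gamma>))"
      using B less_imp_le[OF s] unfolding fractional_brownian_motion_def by blast
    then show ?thesis by simp
  qed
  also have "\<dots> = (s powr \<gamma>)\<^sup>2"
    using s by (simp add: power2_eq_square powr_add[symmetric])
  finally show "(\<integral>\<omega>. B s \<omega> * B s \<omega> \<partial>M) = (s powr \<gamma>)\<^sup>2" .
qed (use s in simp)

text \<open>
  The covariance at time \<open>0\<close> alone would not exclude a non-integrable square, so the value at \<open>0\<close>
  is obtained from the continuity of the paths and Fatou's lemma.
\<close>

lemma fractional_brownian_motion_at_0:
  assumes B: "fractional_brownian_motion M \<gamma> B" and \<gamma>: "\<gamma> > 0"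
  shows "AE \<omega> in M. B 0 \<omega> = 0"
proof -
  have cp: "continuous_process M B"
    using B by (simp add: fractional_brownian_motion_def)
  have [measurable]: "B t \<in> borel_measurable M" if "t \<ge> 0" for t
    using cp that by (simp add: continuous_process_def)
  define s where "s n = inverse (real (Suc n))" for n
  have s: "s n > 0" for n
    by (simp add: s_def)
  have s0: "s \<longlonglongrightarrow> 0"
    unfolding s_def by (rule LIMSEQ_inverse_real_of_nat)
  have "AE \<omega> in M. continuous_on {0..} (\<lambda>t. B t \<omega>)"
    using cp by (simp add: continuous_process_def)
  then have lim: "AE \<omega> in M. liminf (\<lambda>n. ennreal \<bar>B (s n) \<omega>\<bar>) = ennreal \<bar>B 0 \<omega>\<bar>"
  proof eventually_elim
    case (elim \<omega>)
    have "(\<lambda>n. B (s n) \<omega>) \<longlonglongrightarrow> B 0 \<omega>"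
      by (rule continuous_on_tendsto_compose[OF elim s0]) (auto intro!: always_eventually less_imp_le s)
    then have "(\<lambda>n. ennreal \<bar>B (s n) \<omega>\<bar>) \<longlonglongrightarrow> ennreal \<bar>B 0 \<omega>\<bar>"
      by (intro tendsto_ennrealI tendsto_rabs)
    then show ?case
      by (intro lim_imp_Liminf) auto
  qed
  have p: "(\<lambda>n. ennreal (s n powr \<gamma>)) \<longlonglongrightarrow> ennreal 0"
    using tendsto_powr'[OF s0 tendsto_const[of \<gamma>]] \<gamma> s
    by (intro tendsto_ennrealI) (auto intro!: always_eventually less_imp_le)
  have "(\<integral>\<^sup>+\<omega>. ennreal \<bar>B 0 \<omega>\<bar> \<partial>M) = (\<integral>\<^sup>+\<omega>. liminf (\<lambda>n. ennreal \<bar>B (s n) \<omega>\<bar>) \<partial>M)"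
    using lim by (intro nn_integral_cong_AE) (auto elim: eventually_mono)
  also have "\<dots> \<le> liminf (\<lambda>n. \<integral>\<^sup>+\<omega>. ennreal \<bar>B (s n) \<omega>\<bar> \<partial>M)"
  proof (rule nn_integral_liminf)
    fix n
    have "s n \<ge> 0"
      using s[of n] by simp
    then show "(\<lambda>\<omega>. ennreal \<bar>B (s n) \<omega>\<bar>) \<in> borel_measurable M"
      by measurable
  qed
  also have "\<dots> \<le> liminf (\<lambda>n. ennreal (s n powr \<gamma>))"
    by (intro Liminf_mono always_eventually allI fractional_brownian_motion_moment[OF B] s)
  also have "\<dots> = 0"
    using lim_imp_Liminf[OF _ p] by simp
  finally have "(\<integral>\<^sup>+\<omega>. ennreal \<bar>B 0 \<omega>\<bar> \<partial>M) = 0"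
    by simp
  then show ?thesis
    by (subst (asm) nn_integral_0_iff_AE) auto
qed

end

text \<open>Young's inequality, scaled so that the bound is linear in \<open>\<delta>\<close>.\<close>

lemma kernel_Lp_bound:
  assumes \<beta>: "0 < \<beta>" "\<beta> < 1" and p: "p > 1 / \<beta>"
  shows "\<exists>c>0. \<forall>F \<delta> t. \<delta> > 0 \<longrightarrow> F \<in> borel_measurable borel \<longrightarrow> (\<forall>s. 0 \<le> F s) \<longrightarrow>
    (\<integral>\<^sup>+s. ennreal (F s) \<partial>lborel) \<le> ennreal \<delta> \<longrightarrow> (\<integral>\<^sup>+s. ennreal (F s powr p) \<partial>lborel) \<le> ennreal (\<delta> powr p) \<longrightarrow>
    (\<integral>\<^sup>+s. ennreal (frac_kernel \<beta> (t - s) * F s) \<partial>lborel) \<le> ennreal (c * \<delta>)"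
proof -
  have "1 < 1 / \<beta>" using \<beta> by simp
  then have p1: "p > 1" using p by simp
  define q where "q = p / (p - 1)"
  have q: "q > 0" "1 / p + 1 / q = 1" "q > 1"
    using p1 by (auto simp: q_def field_simps)
  \<comment> \<open>The q-th power of k is a multiple of the kernel of order \<open>a\<close>, and
    for conjugate exponents a > 0 is exactly the condition p > 1 / \<beta>.\<close>
  define a where "a = q * (\<beta> - 1) + 1"
  have "p * \<beta> > 1"
    using p \<beta> by (simp add: field_simps)
  then have a: "a > 0"
    using p1 by (simp add: a_def q_def field_simps)
  define d where "d = Gamma a / Gamma \<beta> powr q"
  have d: "d \<ge> 0"
    using a by (auto simp: d_def intro!: divide_nonneg_nonneg less_imp_le[OF Gamma_real_pos])
  have kq: "frac_kernel \<beta> u powr q = d * frac_kernel a u" for u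
    using \<beta> a q Gamma_real_pos[OF a, THEN less_imp_neq] by (simp add: frac_kernel_def d_def a_def powr_divide powr_powr mult.commute)
  have fin: "set_integrable lborel {0..1} (frac_kernel a)"
    by (rule set_integrable_frac_kernel[OF a])
  define I where "I = (LINT s:{0..1}|lborel. frac_kernel a s)"
  have I: "I \<ge> 0"
    unfolding I_def set_lebesgue_integral_def using a by (intro integral_nonneg_AE) (auto simp: frac_kernel_nonneg)
  \<comment> \<open>d I comes from the singular part of the kernel, 1 from the L^p norm of F and 1 /
    Gamma \<beta> from its L^1 norm.\<close>
  define c where "c = d * I + 1 + 1 / Gamma \<beta>"
  have c: "c > 0"
    using d I \<beta> by (auto simp: c_def intro!: add_nonneg_pos add_nonneg_pos)
  have "(\<integral>\<^sup>+s. ennreal (frac_kernel \<beta> (t - s) * F s) \<partial>lborel) \<le> ennreal (c * \<delta>)"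
    if \<delta>: "\<delta> > 0" and [measurable]: "F \<in> borel_measurable borel" and F: "\<And>s. 0 \<le> F s"
      and F1: "(\<integral>\<^sup>+s. ennreal (F s) \<partial>lborel) \<le> ennreal \<delta>" and Fp: "(\<integral>\<^sup>+s. ennreal (F s powr p) \<partial>lborel) \<le> ennreal (\<delta> powr p)" for F \<delta> t
  proof -
    have pt: "frac_kernel \<beta> (t - s) * F s \<le> \<delta> * d * (indicator {0..1} (t - s) * frac_kernel a (t - s))
        + \<delta> / \<delta> powr p * F s powr p + 1 / Gamma \<beta> * F s" for s
    proof (cases "t - s \<le> 1")
      \<comment> \<open>Here the kernel may be singular and is paired with F / \<delta>. In the
        other case it is at most 1 / Gamma \<beta>, and the L^1 norm of F suffices.\<close>
      case True
      have "frac_kernel \<beta> (t - s) * (F s / \<delta>) = (F s / \<delta>) * frac_kernel \<beta> (t - s)"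
        by simp
      also have "\<dots> \<le> (F s / \<delta>) powr p / p + frac_kernel \<beta> (t - s) powr q / q"
        using p1 q \<beta> F[of s] \<delta> by (intro Youngs_inequality) (auto simp: frac_kernel_nonneg)
      also have "\<dots> \<le> (F s / \<delta>) powr p / 1 + frac_kernel \<beta> (t - s) powr q / 1"
        using p1 q by (intro add_mono divide_left_mono) auto
      also have "\<dots> = F s powr p / \<delta> powr p + d * frac_kernel a (t - s)"
        using F[of s] \<delta> by (simp add: powr_divide kq)
      finally have "\<delta> * (frac_kernel \<beta> (t - s) * (F s / \<delta>)) \<le> \<delta> * (F s powr p / \<delta> powr p + d * frac_kernel a (t - s))"
        using \<delta> by (intro mult_left_mono) auto
      moreover have "indicator {0..1} (t - s) * frac_kernel a (t - s) = frac_kernel a (t - s)"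
        using True by (auto simp: indicator_def frac_kernel_def)
      moreover have "0 \<le> 1 / Gamma \<beta> * F s"
        using \<beta> F[of s] by (intro mult_nonneg_nonneg) auto
      moreover have "\<delta> * (frac_kernel \<beta> (t - s) * (F s / \<delta>)) = frac_kernel \<beta> (t - s) * F s"
        using \<delta> by simp
      moreover have "\<delta> * (F s powr p / \<delta> powr p + d * frac_kernel a (t - s)) =
          \<delta> * d * frac_kernel a (t - s) + \<delta> / \<delta> powr p * F s powr p"
        by (simp add: algebra_simps)
      ultimately show ?thesis
        by (simp only:)
    next
      case False
      have "(t - s) powr (\<beta> - 1) \<le> 1 powr (\<beta> - 1)"
        using False \<beta> by (intro powr_mono2') auto
      then have "frac_kernel \<beta> (t - s) \<le> 1 / Gamma \<beta>"
        using False \<beta> by (auto simp: frac_kernel_def intro!: divide_right_mono less_imp_le[OF Gamma_real_pos])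
      then have "frac_kernel \<beta> (t - s) * F s \<le> 1 / Gamma \<beta> * F s"
        using F[of s] by (rule mult_right_mono)
      moreover have "0 \<le> \<delta> * d * (indicator {0..1} (t - s) * frac_kernel a (t - s))" "0 \<le> \<delta> / \<delta> powr p * F s powr p"
        using \<delta> d a by (auto simp: frac_kernel_nonneg)
      ultimately show ?thesis
        by linarith
    qed
    have I_eq: "(\<integral>\<^sup>+s. ennreal (indicator {0..1} (t - s) * frac_kernel a (t - s)) \<partial>lborel) = ennreal I"
    proof -
      have "(\<integral>\<^sup>+s. ennreal (indicator {0..1} (t - s) * frac_kernel a (t - s)) \<partial>lborel) = (\<integral>\<^sup>+s. ennreal (indicator {0..1} s * frac_kernel a s) \<partial>lborel)"
        using nn_integral_real_affine[of "\<lambda>s. ennreal (indicator {0..1} s * frac_kernel a s)" "-1" t] by simp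
      also have "\<dots> = ennreal I"
        using fin a unfolding I_def set_integrable_def set_lebesgue_integral_def
        by (subst nn_integral_eq_integral) (auto simp: frac_kernel_nonneg)
      finally show ?thesis .
    qed
    have "(\<integral>\<^sup>+s. ennreal (frac_kernel \<beta> (t - s) * F s) \<partial>lborel) \<le>
        (\<integral>\<^sup>+s. ennreal (\<delta> * d) * ennreal (indicator {0..1} (t - s) * frac_kernel a (t - s))
          + ennreal (\<delta> / \<delta> powr p) * ennreal (F s powr p) + ennreal (1 / Gamma \<beta>) * ennreal (F s) \<partial>lborel)"
    proof (intro nn_integral_mono)
      fix s
      have "ennreal (frac_kernel \<beta> (t - s) * F s) \<le> ennreal (\<delta> * d * (indicator {0..1} (t - s) * frac_kernel a (t - s))
        + \<delta> / \<delta> powr p * F s powr p + 1 / Gamma \<beta> * F s)"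
        by (rule ennreal_leI[OF pt])
      also have "\<dots> = ennreal (\<delta> * d) * ennreal (indicator {0..1} (t - s) * frac_kernel a (t - s))
          + ennreal (\<delta> / \<delta> powr p) * ennreal (F s powr p) + ennreal (1 / Gamma \<beta>) * ennreal (F s)"
        using \<delta> d a \<beta> F[of s] by (subst ennreal_plus | subst ennreal_mult | simp add: frac_kernel_nonneg)+
      finally show "ennreal (frac_kernel \<beta> (t - s) * F s) \<le> \<dots>" .
    qed
    also have "\<dots> = ennreal (\<delta> * d) * ennreal I + ennreal (\<delta> / \<delta> powr p) * (\<integral>\<^sup>+s. ennreal (F s powr p) \<partial>lborel)
        + ennreal (1 / Gamma \<beta>) * (\<integral>\<^sup>+s. ennreal (F s) \<partial>lborel)"
      unfolding I_eq[symmetric] by (simp add: nn_integral_add nn_integral_cmult)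
    also have "\<dots> \<le> ennreal (\<delta> * d) * ennreal I + ennreal (\<delta> / \<delta> powr p) * ennreal (\<delta> powr p) + ennreal (1 / Gamma \<beta>) * ennreal \<delta>"
      by (intro add_mono mult_left_mono F1 Fp order_refl) auto
    also have "\<dots> = ennreal (\<delta> * d * I + \<delta> / \<delta> powr p * \<delta> powr p + 1 / Gamma \<beta> * \<delta>)"
      using \<delta> d I \<beta> by (simp add: ennreal_mult'[symmetric] ennreal_plus[symmetric] del: ennreal_plus)
    also have "\<delta> * d * I + \<delta> / \<delta> powr p * \<delta> powr p + 1 / Gamma \<beta> * \<delta> = c * \<delta>"
      using \<delta> by (simp add: c_def algebra_simps)
    finally show ?thesis .
  qed
  with c show ?thesis
    by blast
qed

section \<open>The mean of the solution\<close>

text \<open>Riemann sums evaluate the integrator only at end points of cells, all in {u..v}. This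
  allows passing from B to its version with everywhere continuous paths.\<close>

lemma has_young_integral_cong:
  assumes "has_young_integral g b u v I" "\<And>s. s \<in> {u..v} \<Longrightarrow> b s = b' s"
  shows "has_young_integral g b' u v I"
proof -
  have "(\<Sum>(x, K)\<in>D. g x * (b (Sup K) - b (Inf K))) = (\<Sum>(x, K)\<in>D. g x * (b' (Sup K) - b' (Inf K)))"
    if D: "D tagged_division_of {u..v}" for D
  proof (intro sum.cong refl, clarify)
    fix x K assume xK: "(x, K) \<in> D"
    obtain c d where K: "K = cbox c d"
      using tagged_division_ofD(4)[OF D xK] by blast
    have "x \<in> K" "K \<subseteq> {u..v}"
      using tagged_division_ofD(2,3)[OF D xK] .
    then have "c \<le> d" "c \<in> {u..v}" "d \<in> {u..v}"
      unfolding K by auto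
    then show "g x * (b (Sup K) - b (Inf K)) = g x * (b' (Sup K) - b' (Inf K))"
      using assms(2) by (simp add: K)
  qed
  note eq = this
  show ?thesis
    unfolding has_young_integral_def
  proof (intro allI impI)
    fix e :: real assume e: "e > 0"
    have "\<exists>d>0. \<forall>D. D tagged_division_of {u..v} \<and> (\<forall>(x, K)\<in>D. Sup K - Inf K < d) \<longrightarrow>
        \<bar>(\<Sum>(x, K)\<in>D. g x * (b (Sup K) - b (Inf K))) - I\<bar> < e"
      using assms(1)[unfolded has_young_integral_def, rule_format, OF e] .
    then obtain d where "d > 0 \<and> (\<forall>D. D tagged_division_of {u..v} \<and> (\<forall>(x, K)\<in>D. Sup K - Inf K < d) \<longrightarrow>
        \<bar>(\<Sum>(x, K)\<in>D. g x * (b (Sup K) - b (Inf K))) - I\<bar> < e)" ..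
    note d = conjunct1[OF this] conjunct2[OF this, rule_format]
    show "\<exists>d>0. \<forall>D. D tagged_division_of {u..v} \<and> (\<forall>(x, K)\<in>D. Sup K - Inf K < d) \<longrightarrow>
        \<bar>(\<Sum>(x, K)\<in>D. g x * (b' (Sup K) - b' (Inf K))) - I\<bar> < e"
    proof (rule exI[of _ d], intro conjI allI impI)
      fix D assume D: "D tagged_division_of {u..v} \<and> (\<forall>(x, K)\<in>D. Sup K - Inf K < d)"
      show "\<bar>(\<Sum>(x, K)\<in>D. g x * (b' (Sup K) - b' (Inf K))) - I\<bar> < e"
        unfolding eq[OF conjunct1[OF D], symmetric] by (rule d(2)[OF D])
    qed (rule d(1))
  qed
qed

section \<open>Linear growth of the nonlinearity and the pathwise inequality\<close>

lemma concave_convex_linear_bound: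
  fixes h :: "real \<Rightarrow> real"
  assumes "mono h" "concave_on {0..} h" "convex_on {..0} h" "\<delta> > 0"
    and bd: "\<And>x. \<bar>x\<bar> < \<delta> \<Longrightarrow> \<bar>h x\<bar> \<le> C * \<bar>x\<bar>"
  shows "\<bar>h x\<bar> \<le> C * \<bar>x\<bar>"
proof -
  have h0: "h 0 = 0"
    using bd[of 0] assms(4) by simp
  \<comment> \<open>\<open>u\<close> scales x into the interval where the local bound holds.
    Concavity for x \<ge> 0 and convexity for x \<le> 0, together with h 0 = 0 and monotonicity,
    give u |h x| \<le> |h (u x)|, so the local linear bound becomes global.\<close>
  define u where "u = min 1 (\<delta> / 2 / (1 + \<bar>x\<bar>))"
  have u: "0 < u" "u \<le> 1"
    using assms(4) by (auto simp: u_def intro!: divide_pos_pos)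
  have "u * \<bar>x\<bar> \<le> \<delta> / 2 / (1 + \<bar>x\<bar>) * \<bar>x\<bar>"
    by (intro mult_right_mono) (auto simp: u_def)
  also have "\<dots> \<le> \<delta> / 2"
    using assms(4) by (simp add: field_simps)
  finally have "\<bar>u * x\<bar> < \<delta>"
    using u assms(4) by (simp add: abs_mult)
  then have hu: "\<bar>h (u * x)\<bar> \<le> C * (u * \<bar>x\<bar>)"
    using bd[of "u * x"] u by (simp add: abs_mult)
  have "u * \<bar>h x\<bar> \<le> \<bar>h (u * x)\<bar>"
  proof (cases "x \<ge> 0")
    case True
    have "convex_on {0..} (\<lambda>x. - h x)"
      using assms(2) by (simp add: concave_on_def)
    then have "u * h x \<le> h (u * x)"
      using convex_onD[of "{0..}" "\<lambda>x. - h x" u 0 x] True u h0 by simp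
    moreover have "0 \<le> h x" "0 \<le> h (u * x)"
      using monoD[OF assms(1), of 0] True u h0 by auto
    ultimately show ?thesis
      by simp
  next
    case False
    have "h (u * x) \<le> u * h x"
      using convex_onD[OF assms(3), of u 0 x] False u h0 by simp
    moreover have "h x \<le> 0" "h (u * x) \<le> 0"
      using monoD[OF assms(1), of _ 0] False u h0 by (auto simp: mult_nonneg_nonpos)
    ultimately show ?thesis
      by simp
  qed
  then have "u * \<bar>h x\<bar> \<le> u * (C * \<bar>x\<bar>)"
    using hu by (simp add: mult_ac)
  then show ?thesis
    using u by simp
qed

text \<open>With v = - l x + h(x) + noise in \<open>variation_of_constants\<close>, the linear part
  contributes - R * x, which cancels the R * x on the left. What remains is x = D y1 - D y2 + R * W
  / l without a linear term, and absolute values may be taken because R and both D terms are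
  non-negative.\<close>

lemma pathwise_bound:
  fixes f b x y1 y2 :: "real \<Rightarrow> real"
  assumes \<beta>: "0 < \<beta>" "\<beta> < 1" and l: "l > 0" and adm: "admissible_noise_coeff \<gamma> p f" "\<gamma> < 1"
    and h: "\<And>u. \<bar>h u\<bar> \<le> C * \<bar>u\<bar>" and [measurable]: "h \<in> borel_measurable borel"
    and cont: "continuous_on UNIV b" "continuous_on UNIV x" "continuous_on UNIV y1" "continuous_on UNIV y2"
    and b0: "b 0 = 0"
    and y: "mono y1" "\<And>t. 0 \<le> y1 t" "mono y2" "\<And>t. 0 \<le> y2 t"
    and eq: "\<And>t. t \<ge> 0 \<Longrightarrow> \<exists>I. has_young_integral (\<lambda>s. (t - s) powr \<beta> * f s) b 0 t I \<and>
        x t = y1 t - y2 t + 1 / Gamma \<beta> * (LINT s:{0..t}|lborel. (t - s) powr (\<beta> - 1) * (- l * x s + h (x s)))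
          + 1 / Gamma (\<beta> + 1) * I"
    and t: "t \<ge> 0"
  defines "F \<equiv> restrict_pos f" and "G \<equiv> restrict_pos (\<lambda>s. - deriv f s)" and "R \<equiv> resolvent \<beta> l"
  shows "\<bar>x t\<bar> \<le> (y1 t - conv R y1 t) + (y2 t - conv R y2 t)
      + conv R (\<lambda>s. C * \<bar>x s\<bar> + F s * \<bar>b s\<bar> + conv (frac_kernel 1) (\<lambda>r. G r * \<bar>b r\<bar>) s) t / l"
proof -
  let ?k = "frac_kernel \<beta>"
  have \<beta>1: "\<beta> \<le> 1" using \<beta> by simp
  have [measurable]: "b \<in> borel_measurable borel" "x \<in> borel_measurable borel" "y1 \<in> borel_measurable borel" "y2 \<in> borel_measurable borel"
    using cont by (auto intro: borel_measurable_continuous_onI)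
  have [measurable]: "F \<in> borel_measurable borel" "G \<in> borel_measurable borel"
    unfolding F_def G_def using admissible_measurable[OF adm] .
  have sub: "continuous_on {0..t} c" if "continuous_on UNIV c" for c :: "real \<Rightarrow> real"
    using that by (rule continuous_on_subset) simp
  have "continuous_on {0..t} f"
    using admissible_continuous_on[OF adm] by (rule continuous_on_subset) auto
  then obtain Vf where Vf: "\<And>s. s \<in> {0..t} \<Longrightarrow> \<bar>f s\<bar> \<le> Vf"
    by (rule continuous_on_Icc_bounded) blast
  obtain Vb where Vb: "\<And>s. s \<in> {0..t} \<Longrightarrow> \<bar>b s\<bar> \<le> Vb"
    by (rule continuous_on_Icc_bounded[OF sub[OF cont(1)]]) blast
  obtain Vx where Vx: "\<And>s. s \<in> {0..t} \<Longrightarrow> \<bar>x s\<bar> \<le> Vx"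
    by (rule continuous_on_Icc_bounded[OF sub[OF cont(2)]]) blast
  obtain V1 where V1: "\<And>s. s \<in> {0..t} \<Longrightarrow> \<bar>y1 s\<bar> \<le> V1"
    by (rule continuous_on_Icc_bounded[OF sub[OF cont(3)]]) blast
  obtain V2 where V2: "\<And>s. s \<in> {0..t} \<Longrightarrow> \<bar>y2 s\<bar> \<le> V2"
    by (rule continuous_on_Icc_bounded[OF sub[OF cont(4)]]) blast
  note V = Vb Vx V1 V2 Vf
  have C0: "C \<ge> 0"
    using h[of 1] by simp
  have Vb0: "Vb \<ge> 0" and Vf0: "Vf \<ge> 0"
    using V(1)[of 0] V(5)[of 0] t by auto
  have F0: "F s \<ge> 0" and G0: "G s \<ge> 0" for s
    unfolding F_def G_def using admissible_nonneg[OF adm] .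
  have Fb: "F s * \<bar>b s\<bar> \<le> Vf * Vb" if "s \<in> {0..t}" for s
    using V(1)[OF that] V(5)[OF that] Vf0 Vb0 by (intro mult_mono) (auto simp: F_def restrict_pos_def)
  obtain I where "has_young_integral (\<lambda>s. (t - s) powr \<beta> * f s) b 0 t I"
    using eq[OF t] by blast
  then have iG: "set_integrable lborel {0..t} G"
    unfolding G_def by (rule noise_term(2)[OF \<beta> adm t cont(1) b0])
  define J where "J s = conv (frac_kernel 1) (\<lambda>r. G r * b r) s" for s
  define J' where "J' s = conv (frac_kernel 1) (\<lambda>r. G r * \<bar>b r\<bar>) s" for s
  have G_neg: "G r = 0" if "r < 0" for r
    using that by (simp add: G_def restrict_pos_def)
  have k_neg: "frac_kernel 1 r = 0" if "r < 0" for r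
    using that by (simp add: frac_kernel_def)
  have [measurable]: "J \<in> borel_measurable borel"
    unfolding J_def[abs_def] by (rule conv_measurable) (auto simp: G_neg k_neg)
  have [measurable]: "J' \<in> borel_measurable borel"
    unfolding J'_def[abs_def] by (rule conv_measurable) (auto simp: G_neg k_neg)
  have JJ: "\<bar>J s\<bar> \<le> J' s" for s
  proof -
    have "\<bar>J s\<bar> \<le> conv (frac_kernel 1) (\<lambda>r. \<bar>G r * b r\<bar>) s"
      unfolding J_def by (intro conv_abs_le frac_kernel_nonneg) simp
    then show ?thesis
      using G0 by (simp add: J'_def abs_mult)
  qed
  define VJ where "VJ = Vb * (LINT r:{0..t}|lborel. G r)"
  have J': "\<bar>J' s\<bar> \<le> VJ" if s: "s \<in> {0..t}" for s
  proof -
    have "\<bar>J' s\<bar> \<le> (LINT r|lborel. \<bar>indicator {0..s} r *\<^sub>R (frac_kernel 1 (s - r) * (G r * \<bar>b r\<bar>))\<bar>)"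
      unfolding J'_def conv_def set_lebesgue_integral_def by (rule integral_abs_bound)
    also have "\<dots> \<le> (LINT r|lborel. indicator {0..t} r *\<^sub>R (Vb * G r))"
    proof (rule integral_mono')
      show "integrable lborel (\<lambda>r. indicator {0..t} r *\<^sub>R (Vb * G r))"
        using set_integrable_mult_right[OF iG, of Vb] by (auto simp: set_integrable_def)
      fix r
      show "0 \<le> indicator {0..t} r *\<^sub>R (Vb * G r)"
        using G0 Vb0 by simp
      show "\<bar>indicator {0..s} r *\<^sub>R (frac_kernel 1 (s - r) * (G r * \<bar>b r\<bar>))\<bar> \<le> indicator {0..t} r *\<^sub>R (Vb * G r)"
      proof (cases "r \<in> {0..s}")
        case True
        then have "G r * \<bar>b r\<bar> \<le> G r * Vb"
          using s G0 V(1)[of r] by (intro mult_left_mono) auto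
        moreover have "0 \<le> G r * Vb"
          using G0 Vb0 by simp
        ultimately show ?thesis
          using True s G0[of r] by (auto simp: frac_kernel_def abs_mult mult.commute)
      qed (use G0 Vb0 in simp)
    qed
    also have "\<dots> = VJ"
      by (simp add: VJ_def set_lebesgue_integral_def mult.left_commute[of _ Vb])
    finally show ?thesis .
  qed
  define v where "v s = (- l * x s + h (x s)) + (F s * b s + J s)" for s
  have hx: "\<bar>h (x s)\<bar> \<le> C * Vx" if "s \<in> {0..t}" for s
    using h[of "x s"] V(2)[OF that] C0 by (meson mult_left_mono order_trans)
  have w1: "\<bar>- l * x s + h (x s)\<bar> \<le> l * Vx + C * Vx" if "s \<in> {0..t}" for s
  proof -
    have "\<bar>- l * x s\<bar> \<le> l * Vx"
      using l V(2)[OF that] by (simp add: abs_mult)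
    then show ?thesis
      using hx[OF that] by linarith
  qed
  have Fb': "\<bar>F s * b s\<bar> \<le> Vf * Vb" if "s \<in> {0..t}" for s
    using Fb[OF that] F0[of s] by (simp add: abs_mult)
  have w2: "\<bar>F s * b s + J s\<bar> \<le> Vf * Vb + VJ" if "s \<in> {0..t}" for s
    using Fb'[OF that] JJ[of s] J'[OF that] by linarith
  have [measurable]: "v \<in> borel_measurable borel"
    unfolding v_def by measurable
  define VV where "VV = \<bar>V1\<bar> + \<bar>V2\<bar> + (l * Vx + C * Vx) + (Vf * Vb + VJ)"
  have vV: "\<bar>v s\<bar> \<le> VV" "\<bar>y1 s - y2 s\<bar> \<le> VV" if "s \<in> {0..t}" for s
  proof -
    have "0 \<le> l * Vx + C * Vx" "0 \<le> Vf * Vb + VJ"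
      using w1[OF that] w2[OF that] by linarith+
    then show "\<bar>v s\<bar> \<le> VV" "\<bar>y1 s - y2 s\<bar> \<le> VV"
      using w1[OF that] w2[OF that] V(3,4)[OF that] unfolding v_def VV_def by linarith+
  qed
  have xeq: "x s = (y1 s - y2 s) + conv ?k v s" if s: "s \<in> {0..t}" for s
  proof -
    have s0: "s \<ge> 0" using s by simp
    obtain I where young: "has_young_integral (\<lambda>r. (s - r) powr \<beta> * f r) b 0 s I"
      and xs: "x s = y1 s - y2 s + 1 / Gamma \<beta> * (LINT r:{0..s}|lborel. (s - r) powr (\<beta> - 1) * (- l * x r + h (x r)))
          + 1 / Gamma (\<beta> + 1) * I"
      using eq[OF s0] by blast
    have "1 / Gamma \<beta> * (LINT r:{0..s}|lborel. (s - r) powr (\<beta> - 1) * (- l * x r + h (x r))) =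
        (LINT r:{0..s}|lborel. 1 / Gamma \<beta> * ((s - r) powr (\<beta> - 1) * (- l * x r + h (x r))))"
      by (rule set_integral_mult_right[symmetric])
    also have "\<dots> = conv ?k (\<lambda>r. - l * x r + h (x r)) s"
      unfolding conv_def by (intro set_lebesgue_integral_cong) (auto simp: frac_kernel_def)
    finally have 1: "1 / Gamma \<beta> * (LINT r:{0..s}|lborel. (s - r) powr (\<beta> - 1) * (- l * x r + h (x r))) =
        conv ?k (\<lambda>r. - l * x r + h (x r)) s" .
    have 2: "1 / Gamma (\<beta> + 1) * I = conv ?k (\<lambda>r. F r * b r + J r) s"
      using noise_term(1)[OF \<beta> adm s0 cont(1) b0 young] by (simp add: F_def G_def J_def)
    have ik: "set_integrable lborel {0..s} ?k"
      by (rule set_integrable_frac_kernel[OF \<beta>(1)])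
    have "conv ?k v s = conv ?k (\<lambda>r. - l * x r + h (x r)) s + conv ?k (\<lambda>r. F r * b r + J r) s"
      unfolding v_def
    proof (rule conv_add)
      show "set_integrable lborel {0..s} (\<lambda>r. ?k (s - r) * (- l * x r + h (x r)))"
        by (rule conv_integrable[OF ik _ w1]) (use s in auto)
      show "set_integrable lborel {0..s} (\<lambda>r. ?k (s - r) * (F r * b r + J r))"
        by (rule conv_integrable[OF ik _ w2]) (use s in auto)
    qed
    then show ?thesis
      using xs 1 2 by simp
  qed
  note iR = resolvent_integrable[OF \<beta>(1) \<beta>1 l, of t, folded R_def]
  have voc: "x t - conv R x t = (y1 t - y2 t) - conv R (\<lambda>s. y1 s - y2 s) t + conv R v t / l"
    unfolding R_def by (rule variation_of_constants[OF \<beta>(1) \<beta>1 l t _ _ vV(2) vV(1) xeq]) auto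
  have c1: "conv R (\<lambda>s. y1 s - y2 s) t = conv R y1 t - conv R y2 t"
    by (rule conv_diff[OF conv_integrable[OF iR _ V(3)] conv_integrable[OF iR _ V(4)]]) auto
  define W where "W s = h (x s) + (F s * b s + J s)" for s
  have W: "\<bar>W s\<bar> \<le> C * Vx + (Vf * Vb + VJ)" if "s \<in> {0..t}" for s
    using w2[OF that] hx[OF that] unfolding W_def by linarith
  have [measurable]: "W \<in> borel_measurable borel"
    unfolding W_def by measurable
  have "conv R v t = conv R (\<lambda>s. - l * x s + W s) t"
    by (intro conv_cong) (simp add: v_def W_def)
  also have "\<dots> = conv R (\<lambda>s. - l * x s) t + conv R W t"
  proof (rule conv_add)
    show "set_integrable lborel {0..t} (\<lambda>s. R (t - s) * (- l * x s))"
      by (rule conv_integrable[OF iR, of _ "l * Vx"]) (use V l in \<open>auto simp: abs_mult\<close>)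
    show "set_integrable lborel {0..t} (\<lambda>s. R (t - s) * W s)"
      by (rule conv_integrable[OF iR _ W]) auto
  qed
  also have "conv R (\<lambda>s. - l * x s) t = - l * conv R x t"
    by (rule conv_cmult)
  finally have "conv R v t / l = - conv R x t + conv R W t / l"
    using l by (simp add: diff_divide_distrib)
  with voc c1 have x_eq: "x t = (y1 t - conv R y1 t) - (y2 t - conv R y2 t) + conv R W t / l"
    by simp
  have D: "0 \<le> y1 t - conv R y1 t" "0 \<le> y2 t - conv R y2 t"
    using conv_resolvent_le_mono[OF \<beta>(1) \<beta>1 l, of y1 t] conv_resolvent_le_mono[OF \<beta>(1) \<beta>1 l, of y2 t]
      monoD[OF y(1)] monoD[OF y(3)] y t by (auto simp: R_def)
  let ?W' = "\<lambda>s. C * \<bar>x s\<bar> + F s * \<bar>b s\<bar> + J' s"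
  have R0: "R s \<ge> 0" for s
    unfolding R_def by (rule resolvent_nonneg[OF \<beta>(1) \<beta>1 l])
  have "\<bar>conv R W t\<bar> \<le> conv R (\<lambda>s. \<bar>W s\<bar>) t"
    using R0 by (intro conv_abs_le)
  also have "\<dots> \<le> conv R ?W' t"
  proof (rule conv_mono)
    show "set_integrable lborel {0..t} (\<lambda>s. R (t - s) * \<bar>W s\<bar>)"
      by (rule conv_integrable[OF iR]) (use W in auto)
    show "set_integrable lborel {0..t} (\<lambda>s. R (t - s) * ?W' s)"
    proof (rule conv_integrable[OF iR])
      fix s assume s: "s \<in> {0..t}"
      have "C * \<bar>x s\<bar> \<le> C * Vx"
        using V(2)[OF s] C0 by (intro mult_left_mono)
      moreover have "0 \<le> C * \<bar>x s\<bar>" "0 \<le> F s * \<bar>b s\<bar>" "0 \<le> J' s"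
        using C0 F0 JJ[of s] by auto
      ultimately show "\<bar>?W' s\<bar> \<le> C * Vx + Vf * Vb + VJ"
        using Fb[OF s] J'[OF s] by linarith
    qed measurable
    fix s assume s: "s \<in> {0..t}"
    have "\<bar>F s * b s\<bar> = F s * \<bar>b s\<bar>"
      using F0[of s] by (simp add: abs_mult)
    then show "\<bar>W s\<bar> \<le> ?W' s"
      using h[of "x s"] JJ[of s] unfolding W_def by linarith
  qed (use R0 in auto)
  finally have "\<bar>conv R W t / l\<bar> \<le> conv R ?W' t / l"
    using l by (simp add: divide_right_mono)
  then have "\<bar>x t\<bar> \<le> (y1 t - conv R y1 t) + (y2 t - conv R y2 t) + conv R ?W' t / l"
    using x_eq D by linarith
  then show ?thesis
    by (simp add: J'_def)
qed

text \<open>Stated with non-negative integrals, for which Tonelli needs no integrability, so that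
  expectations can be taken term by term. The integral of G |b| over {0..s} is enlarged to the
  half-line and becomes independent of s.\<close>

lemma pathwise_bound_nn:
  fixes f b x y1 y2 :: "real \<Rightarrow> real"
  assumes \<beta>: "0 < \<beta>" "\<beta> < 1" and l: "l > 0" and adm: "admissible_noise_coeff \<gamma> p f" "\<gamma> < 1"
    and h: "\<And>u. \<bar>h u\<bar> \<le> C * \<bar>u\<bar>" "h \<in> borel_measurable borel"
    and cont: "continuous_on UNIV b" "continuous_on UNIV x" "continuous_on UNIV y1" "continuous_on UNIV y2"
    and b0: "b 0 = 0"
    and y: "mono y1" "\<And>t. 0 \<le> y1 t" "mono y2" "\<And>t. 0 \<le> y2 t"
    and eq: "\<And>t. t \<ge> 0 \<Longrightarrow> \<exists>I. has_young_integral (\<lambda>s. (t - s) powr \<beta> * f s) b 0 t I \<and>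
        x t = y1 t - y2 t + 1 / Gamma \<beta> * (LINT s:{0..t}|lborel. (t - s) powr (\<beta> - 1) * (- l * x s + h (x s)))
          + 1 / Gamma (\<beta> + 1) * I"
    and t: "t \<ge> 0"
  defines "F \<equiv> restrict_pos f" and "G \<equiv> restrict_pos (\<lambda>s. - deriv f s)" and "R \<equiv> resolvent \<beta> l"
  shows "ennreal \<bar>x t\<bar> \<le> ennreal (y1 t - conv R y1 t) + ennreal (y2 t - conv R y2 t)
      + (\<integral>\<^sup>+s. ennreal (indicator {0..t} s * R (t - s) / l) *
          (ennreal C * ennreal \<bar>x s\<bar> + ennreal (F s * \<bar>b s\<bar>) + (\<integral>\<^sup>+r. ennreal (G r * \<bar>b r\<bar>) \<partial>lborel)) \<partial>lborel)"
proof -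
  let ?J = "\<lambda>s. conv (frac_kernel 1) (\<lambda>r. G r * \<bar>b r\<bar>) s"
  let ?w = "\<lambda>s. C * \<bar>x s\<bar> + F s * \<bar>b s\<bar> + ?J s"
  let ?\<Gamma> = "\<integral>\<^sup>+r. ennreal (G r * \<bar>b r\<bar>) \<partial>lborel"
  have \<beta>1: "\<beta> \<le> 1" using \<beta> by simp
  have F0: "F s \<ge> 0" and G0: "G s \<ge> 0" for s
    unfolding F_def G_def using admissible_nonneg[OF adm] .
  have R0: "R s \<ge> 0" for s
    unfolding R_def by (rule resolvent_nonneg[OF \<beta>(1) \<beta>1 l])
  have C0: "C \<ge> 0"
    using h(1)[of 1] by simp
  have J: "ennreal \<bar>?J s\<bar> \<le> ?\<Gamma>" for s
  proof -
    have "ennreal \<bar>?J s\<bar> \<le> (\<integral>\<^sup>+r. ennreal \<bar>indicator {0..s} r *\<^sub>R (frac_kernel 1 (s - r) * (G r * \<bar>b r\<bar>))\<bar> \<partial>lborel)"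
      unfolding conv_def set_lebesgue_integral_def by (rule ennreal_abs_integral_le)
    also have "\<dots> \<le> ?\<Gamma>"
      using G0 by (intro nn_integral_mono ennreal_leI) (auto simp: indicator_def frac_kernel_def)
    finally show ?thesis .
  qed
  have D: "0 \<le> y1 t - conv R y1 t" "0 \<le> y2 t - conv R y2 t"
    using conv_resolvent_le_mono[OF \<beta>(1) \<beta>1 l, of y1 t] conv_resolvent_le_mono[OF \<beta>(1) \<beta>1 l, of y2 t]
      monoD[OF y(1)] monoD[OF y(3)] y t cont by (auto simp: R_def intro: borel_measurable_continuous_onI)
  have le: "\<bar>x t\<bar> \<le> (y1 t - conv R y1 t) + (y2 t - conv R y2 t) + conv R ?w t / l"
    unfolding F_def G_def R_def
    by (rule pathwise_bound[OF \<beta> l adm h cont b0 y eq t])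
  have "ennreal \<bar>x t\<bar> \<le> ennreal ((y1 t - conv R y1 t) + (y2 t - conv R y2 t) + \<bar>conv R ?w t / l\<bar>)"
    by (rule ennreal_leI) (use le in linarith)
  also have "\<dots> = ennreal (y1 t - conv R y1 t) + ennreal (y2 t - conv R y2 t) + ennreal \<bar>conv R ?w t / l\<bar>"
    using D by (simp add: ennreal_plus)
  also have "ennreal \<bar>conv R ?w t / l\<bar> \<le> (\<integral>\<^sup>+s. ennreal (indicator {0..t} s * R (t - s) / l) *
          (ennreal C * ennreal \<bar>x s\<bar> + ennreal (F s * \<bar>b s\<bar>) + ?\<Gamma>) \<partial>lborel)"
  proof -
    have "conv R ?w t / l = (LINT s|lborel. (indicator {0..t} s *\<^sub>R (R (t - s) * ?w s)) / l)"
      unfolding conv_def[of R] set_lebesgue_integral_def by (rule integral_divide_zero[symmetric])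
    then have "ennreal \<bar>conv R ?w t / l\<bar> \<le> (\<integral>\<^sup>+s. ennreal \<bar>(indicator {0..t} s *\<^sub>R (R (t - s) * ?w s)) / l\<bar> \<partial>lborel)"
      by (simp only: ennreal_abs_integral_le)
    also have "\<dots> \<le> (\<integral>\<^sup>+s. ennreal (indicator {0..t} s * R (t - s) / l) *
          (ennreal C * ennreal \<bar>x s\<bar> + ennreal (F s * \<bar>b s\<bar>) + ?\<Gamma>) \<partial>lborel)"
    proof (rule nn_integral_mono)
      fix s
      have "\<bar>(indicator {0..t} s *\<^sub>R (R (t - s) * ?w s)) / l\<bar> = indicator {0..t} s * R (t - s) / l * \<bar>?w s\<bar>"
        using R0 l by (simp add: abs_mult)
      then have "ennreal \<bar>(indicator {0..t} s *\<^sub>R (R (t - s) * ?w s)) / l\<bar> = ennreal (indicator {0..t} s * R (t - s) / l) * ennreal \<bar>?w s\<bar>"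
      proof (rule ssubst)
        show "ennreal (indicator {0..t} s * R (t - s) / l * \<bar>?w s\<bar>) = ennreal (indicator {0..t} s * R (t - s) / l) * ennreal \<bar>?w s\<bar>"
          using R0 l by (intro ennreal_mult) auto
      qed
      also have "\<dots> \<le> ennreal (indicator {0..t} s * R (t - s) / l) * (ennreal C * ennreal \<bar>x s\<bar> + ennreal (F s * \<bar>b s\<bar>) + ?\<Gamma>)"
      proof (rule mult_left_mono)
        have "ennreal \<bar>?w s\<bar> \<le> ennreal (C * \<bar>x s\<bar> + F s * \<bar>b s\<bar> + \<bar>?J s\<bar>)"
        proof (rule ennreal_leI)
          have "0 \<le> C * \<bar>x s\<bar>" "0 \<le> F s * \<bar>b s\<bar>"
            using C0 F0 by auto
          then show "\<bar>?w s\<bar> \<le> C * \<bar>x s\<bar> + F s * \<bar>b s\<bar> + \<bar>?J s\<bar>"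
            by linarith
        qed
        also have "\<dots> = ennreal C * ennreal \<bar>x s\<bar> + ennreal (F s * \<bar>b s\<bar>) + ennreal \<bar>?J s\<bar>"
          using C0 F0 by (simp add: ennreal_plus ennreal_mult')
        also have "\<dots> \<le> ennreal C * ennreal \<bar>x s\<bar> + ennreal (F s * \<bar>b s\<bar>) + ?\<Gamma>"
          by (intro add_left_mono J)
        finally show "ennreal \<bar>?w s\<bar> \<le> \<dots>" .
      qed simp
      finally show "ennreal \<bar>(indicator {0..t} s *\<^sub>R (R (t - s) * ?w s)) / l\<bar> \<le> \<dots>" .
    qed
    finally show ?thesis .
  qed
  finally show ?thesis
    by (simp add: add_left_mono)
qed

section \<open>Expectations of the pathwise terms\<close>

lemma measurable_process_compose:
  assumes "(\<lambda>(t, \<omega>). Z t \<omega>) \<in> borel_measurable (borel \<Otimes>\<^sub>M M)" "f \<in> borel_measurable N" "g \<in> N \<rightarrow>\<^sub>M M"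
  shows "(\<lambda>x. Z (f x) (g x)) \<in> borel_measurable N"
  using measurable_compose[OF measurable_Pair[OF assms(2,3)] assms(1)] by simp

context prob_space
begin

text \<open>Expectation commutes with averaging under R by Tonelli, hence with D. The pathwise
  bounds 0 \<le> R * Z \<le> Z, from monotone non-negative paths, keep the subtraction meaningful in
  the extended non-negative reals.\<close>

lemma expectation_deviation:
  assumes \<beta>: "0 < \<beta>" "\<beta> \<le> 1" and l: "l > 0"
    and Z: "(\<lambda>(t, \<omega>). Z t \<omega>) \<in> borel_measurable (borel \<Otimes>\<^sub>M M)"
    and mono: "AE \<omega> in M. mono (\<lambda>t. Z t \<omega>) \<and> (\<forall>t. 0 \<le> Z t \<omega>)"
    and int: "\<And>t. integrable M (Z t)" and t: "t \<ge> 0"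
  defines "m \<equiv> \<lambda>t. \<integral>\<omega>. Z t \<omega> \<partial>M"
  shows "mono m" "0 \<le> m s"
    and "(\<integral>\<^sup>+\<omega>. ennreal (Z t \<omega> - conv (resolvent \<beta> l) (\<lambda>s. Z s \<omega>) t) \<partial>M) = ennreal (m t - conv (resolvent \<beta> l) m t)"
proof -
  let ?R = "resolvent \<beta> l"
  note [measurable (raw)] = measurable_process_compose[OF Z]
  note iR = resolvent_integrable[OF \<beta> l, of t]
  have R0: "?R s \<ge> 0" for s
    by (rule resolvent_nonneg[OF \<beta> l])
  show m: "mono m"
  proof (rule monoI)
    fix u v :: real assume "u \<le> v"
    then show "m u \<le> m v"
      unfolding m_def using mono by (intro integral_mono_AE int) (auto elim: eventually_mono dest: monoD)
  qed
  have [measurable]: "m \<in> borel_measurable borel"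
    using m by (rule borel_measurable_mono)
  show m0: "0 \<le> m s" for s
    unfolding m_def using mono by (intro integral_nonneg_AE) (auto elim: eventually_mono)
  define c where "c \<omega> = conv ?R (\<lambda>s. Z s \<omega>) t" for \<omega>
  have [measurable]: "c \<in> borel_measurable M"
    unfolding c_def conv_def set_lebesgue_integral_def by measurable
  have path: "(\<lambda>s. Z s \<omega>) \<in> borel_measurable borel" if "\<omega> \<in> space M" for \<omega>
    using that by measurable
  have AE1: "AE \<omega> in M. 0 \<le> c \<omega> \<and> c \<omega> \<le> Z t \<omega> \<and> ennreal (c \<omega>) = (\<integral>\<^sup>+s. ennreal (indicator {0..t} s * ?R (t - s)) * ennreal (Z s \<omega>) \<partial>lborel)"
    using mono AE_space
  proof eventually_elim
    case (elim \<omega>)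
    then have Z0: "0 \<le> Z s \<omega>" and Zm: "s \<le> u \<Longrightarrow> Z s \<omega> \<le> Z u \<omega>" for s u
      by (auto dest: monoD)
    note pm = path[OF elim(2)]
    have i: "set_integrable lborel {0..t} (\<lambda>s. ?R (t - s) * Z s \<omega>)"
      using Z0 Zm by (intro conv_integrable[OF iR pm, where V = "Z t \<omega>"]) auto
    have "0 \<le> c \<omega>"
      unfolding c_def conv_def set_lebesgue_integral_def using R0 Z0 by (intro integral_nonneg_AE) auto
    moreover have "c \<omega> \<le> Z t \<omega>"
      unfolding c_def using Z0 Zm t by (intro conv_resolvent_le_mono[OF \<beta> l pm]) auto
    moreover have "ennreal (c \<omega>) = (\<integral>\<^sup>+s. ennreal (indicator {0..t} s *\<^sub>R (?R (t - s) * Z s \<omega>)) \<partial>lborel)"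
      unfolding c_def conv_def set_lebesgue_integral_def
      using i R0 Z0 by (subst nn_integral_eq_integral) (auto simp: set_integrable_def)
    moreover have "\<dots> = (\<integral>\<^sup>+s. ennreal (indicator {0..t} s * ?R (t - s)) * ennreal (Z s \<omega>) \<partial>lborel)"
      using R0 Z0 by (intro nn_integral_cong) (simp add: ennreal_mult'[symmetric] mult.assoc)
    ultimately show ?case by simp
  qed
  have im: "set_integrable lborel {0..t} (\<lambda>s. ?R (t - s) * m s)"
    using m0 monoD[OF m] by (intro conv_integrable[OF iR, where V = "m t"]) auto
  have c0: "conv ?R m t \<ge> 0"
    unfolding conv_def set_lebesgue_integral_def using R0 m0 by (intro integral_nonneg_AE) auto
  have nnm: "(\<integral>\<^sup>+\<omega>. ennreal (Z s \<omega>) \<partial>M) = ennreal (m s)" for s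
    unfolding m_def using mono by (intro nn_integral_eq_integral int) (auto elim: eventually_mono)
  have "(\<integral>\<^sup>+\<omega>. ennreal (c \<omega>) \<partial>M) = (\<integral>\<^sup>+\<omega>. \<integral>\<^sup>+s. ennreal (indicator {0..t} s * ?R (t - s)) * ennreal (Z s \<omega>) \<partial>lborel \<partial>M)"
    using AE1 by (intro nn_integral_cong_AE) (auto elim: eventually_mono)
  also have "\<dots> = (\<integral>\<^sup>+s. \<integral>\<^sup>+\<omega>. ennreal (indicator {0..t} s * ?R (t - s)) * ennreal (Z s \<omega>) \<partial>M \<partial>lborel)"
  proof -
    interpret pair_sigma_finite lborel M ..
    show ?thesis
      by (rule Fubini') measurable
  qed
  also have "\<dots> = (\<integral>\<^sup>+s. ennreal (indicator {0..t} s * ?R (t - s)) * ennreal (m s) \<partial>lborel)"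
    by (intro nn_integral_cong, subst nn_integral_cmult) (auto simp: nnm)
  also have "\<dots> = (\<integral>\<^sup>+s. ennreal (indicator {0..t} s *\<^sub>R (?R (t - s) * m s)) \<partial>lborel)"
    using R0 m0 by (intro nn_integral_cong) (simp add: ennreal_mult'[symmetric] mult.assoc)
  also have "\<dots> = ennreal (conv ?R m t)"
    unfolding conv_def set_lebesgue_integral_def
    using im R0 m0 by (subst nn_integral_eq_integral) (auto simp: set_integrable_def)
  finally have Ec: "(\<integral>\<^sup>+\<omega>. ennreal (c \<omega>) \<partial>M) = ennreal (conv ?R m t)" .
  \<comment> \<open>No difference of integrals is formed too early: Z = D Z + R * Z is integrated,
    and the finite mean of R * Z is subtracted afterwards.\<close>
  have "ennreal (m t) = (\<integral>\<^sup>+\<omega>. ennreal (Z t \<omega> - c \<omega>) + ennreal (c \<omega>) \<partial>M)"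
    unfolding nnm[symmetric]
  proof (rule nn_integral_cong_AE)
    have "AE \<omega> in M. 0 \<le> c \<omega> \<and> c \<omega> \<le> Z t \<omega>"
      using AE1 by eventually_elim simp
    then show "AE \<omega> in M. ennreal (Z t \<omega>) = ennreal (Z t \<omega> - c \<omega>) + ennreal (c \<omega>)"
      by eventually_elim (simp add: ennreal_plus[symmetric] del: ennreal_plus)
  qed
  also have "\<dots> = (\<integral>\<^sup>+\<omega>. ennreal (Z t \<omega> - c \<omega>) \<partial>M) + ennreal (conv ?R m t)"
    by (subst nn_integral_add) (auto simp: Ec)
  finally have "(\<integral>\<^sup>+\<omega>. ennreal (Z t \<omega> - c \<omega>) \<partial>M) = ennreal (m t) - ennreal (conv ?R m t)"
    by simp
  then show "(\<integral>\<^sup>+\<omega>. ennreal (Z t \<omega> - conv ?R (\<lambda>s. Z s \<omega>) t) \<partial>M) = ennreal (m t - conv ?R m t)"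
    using c0 by (simp add: c_def ennreal_minus)
qed

text \<open>
  A linear Volterra inequality with kernel mass below \<open>1\<close> absorbs its integral term once the
  expectations are known to be finite. This is arranged by restricting to paths bounded by \<open>n\<close>.
\<close>

lemma volterra_expectation_bound:
  fixes X :: "real \<Rightarrow> 'a \<Rightarrow> real" and k :: "real \<Rightarrow> real \<Rightarrow> real"
  assumes X: "(\<lambda>(t, \<omega>). X t \<omega>) \<in> borel_measurable (borel \<Otimes>\<^sub>M M)" and cont: "\<And>\<omega>. continuous_on UNIV (\<lambda>t. X t \<omega>)"
    and k [measurable]: "\<And>t. k t \<in> borel_measurable borel" and k0: "\<And>t s. s \<notin> {0..t} \<Longrightarrow> k t s = 0"
    and mass: "\<And>t. (\<integral>\<^sup>+s. ennreal (k t s) \<partial>lborel) \<le> ennreal q" and q: "0 \<le> q" "q < 1"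
    and \<Phi> [measurable]: "\<And>t. \<Phi> t \<in> borel_measurable M" and \<Phi>K: "\<And>t. t \<ge> 0 \<Longrightarrow> (\<integral>\<^sup>+\<omega>. \<Phi> t \<omega> \<partial>M) \<le> ennreal K" and K: "K \<ge> 0"
    and le: "\<And>t. t \<ge> 0 \<Longrightarrow> AE \<omega> in M. ennreal \<bar>X t \<omega>\<bar> \<le> \<Phi> t \<omega> + (\<integral>\<^sup>+s. ennreal (k t s) * ennreal \<bar>X s \<omega>\<bar> \<partial>lborel)"
    and T: "T \<ge> 0"
  shows "(\<integral>\<^sup>+\<omega>. ennreal \<bar>X T \<omega>\<bar> \<partial>M) \<le> ennreal (K / (1 - q))"
proof -
  note [measurable (raw)] = measurable_process_compose[OF X]
  \<comment> \<open>Times are clamped to {0..T}, so that rational times suffice to bound a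
    continuous path there and countably many conditions make \<open>A n\<close> measurable.\<close>
  define cl where "cl t = max 0 (min T t)" for t
  have cl: "cl t = t" if "t \<in> {0..T}" for t
    using that by (simp add: cl_def)
  define A where "A n = {\<omega> \<in> space M. \<forall>r::rat. \<bar>X (cl (of_rat r)) \<omega>\<bar> \<le> real n}" for n :: nat
  have [measurable]: "A n \<in> sets M" for n
    unfolding A_def by measurable
  have A: "\<bar>X t \<omega>\<bar> \<le> real n" if \<omega>: "\<omega> \<in> A n" and t: "t \<in> {0..T}" for n t \<omega>
  proof -
    have c: "continuous_on UNIV (\<lambda>t. \<bar>X (cl t) \<omega>\<bar>)"
      by (intro continuous_on_rabs continuous_on_compose2[OF cont[of \<omega>], of _ cl])
        (auto simp: cl_def intro!: continuous_intros)
    have "closed {t. \<bar>X (cl t) \<omega>\<bar> \<le> real n}"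
      using continuous_on_closed_Collect_le[OF c continuous_on_const closed_UNIV] by simp
    moreover have "\<rat> \<subseteq> {t. \<bar>X (cl t) \<omega>\<bar> \<le> real n}"
      using \<omega> by (auto simp: A_def Rats_def)
    ultimately have "closure \<rat> \<subseteq> {t. \<bar>X (cl t) \<omega>\<bar> \<le> real n}"
      by (rule closure_minimal[rotated])
    then have "t \<in> {t. \<bar>X (cl t) \<omega>\<bar> \<le> real n}"
      unfolding Rats_closure_real by blast
    then show ?thesis
      using cl[OF t] by simp
  qed
  have un: "(\<integral>\<^sup>+\<omega>. indicator (A n) \<omega> * ennreal \<bar>X T \<omega>\<bar> \<partial>M) \<le> ennreal (K / (1 - q))" for n
  proof -
    define u where "u t = (\<integral>\<^sup>+\<omega>. indicator (A n) \<omega> * ennreal \<bar>X t \<omega>\<bar> \<partial>M)" for t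
    define U where "U = (SUP t\<in>{0..T}. u t)"
    have "u t \<le> ennreal (real n)" if t: "t \<in> {0..T}" for t
    proof -
      have "u t \<le> (\<integral>\<^sup>+\<omega>. ennreal (real n) \<partial>M)"
        unfolding u_def using A[OF _ t] by (intro nn_integral_mono) (auto simp: indicator_def intro!: ennreal_leI)
      also have "\<dots> = ennreal (real n)"
        by (simp add: emeasure_space_1)
      finally show ?thesis .
    qed
    \<comment> \<open>On \<open>A n\<close> the paths are bounded by n on {0..T}, so U is finite and
      q U can be moved to the left side. The resulting bound K / (1 - q) no longer involves
      n.\<close>
    then have "U \<le> ennreal (real n)"
      unfolding U_def by (intro SUP_least)
    then obtain U' where U': "U = ennreal U'" "U' \<ge> 0"
      by (cases U) (auto simp: top_unique)
    have "u t \<le> ennreal (K + q * U')" if t: "t \<in> {0..T}" for t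
    proof -
      have t0: "t \<ge> 0" using t by simp
      have "u t \<le> (\<integral>\<^sup>+\<omega>. \<Phi> t \<omega> + (\<integral>\<^sup>+s. ennreal (k t s) * (indicator (A n) \<omega> * ennreal \<bar>X s \<omega>\<bar>) \<partial>lborel) \<partial>M)"
        unfolding u_def
      proof (rule nn_integral_mono_AE)
        show "AE \<omega> in M. indicator (A n) \<omega> * ennreal \<bar>X t \<omega>\<bar> \<le> \<Phi> t \<omega> + (\<integral>\<^sup>+s. ennreal (k t s) * (indicator (A n) \<omega> * ennreal \<bar>X s \<omega>\<bar>) \<partial>lborel)"
          using le[OF t0] by eventually_elim (auto simp: indicator_def)
      qed
      also have "\<dots> = (\<integral>\<^sup>+\<omega>. \<Phi> t \<omega> \<partial>M) + (\<integral>\<^sup>+\<omega>. \<integral>\<^sup>+s. ennreal (k t s) * (indicator (A n) \<omega> * ennreal \<bar>X s \<omega>\<bar>) \<partial>lborel \<partial>M)"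
        by (rule nn_integral_add) measurable
      also have "(\<integral>\<^sup>+\<omega>. \<integral>\<^sup>+s. ennreal (k t s) * (indicator (A n) \<omega> * ennreal \<bar>X s \<omega>\<bar>) \<partial>lborel \<partial>M) =
          (\<integral>\<^sup>+s. \<integral>\<^sup>+\<omega>. ennreal (k t s) * (indicator (A n) \<omega> * ennreal \<bar>X s \<omega>\<bar>) \<partial>M \<partial>lborel)"
      proof -
        interpret pair_sigma_finite lborel M ..
        show ?thesis
          by (rule Fubini') measurable
      qed
      also have "\<dots> = (\<integral>\<^sup>+s. ennreal (k t s) * u s \<partial>lborel)"
        unfolding u_def by (intro nn_integral_cong nn_integral_cmult) measurable
      also have "\<dots> \<le> (\<integral>\<^sup>+s. ennreal (k t s) * U \<partial>lborel)"
      proof (rule nn_integral_mono)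
        fix s
        show "ennreal (k t s) * u s \<le> ennreal (k t s) * U"
        proof (cases "s \<in> {0..t}")
          case True
          then have "u s \<le> U"
            unfolding U_def using t by (intro SUP_upper) auto
          then show ?thesis
            by (rule mult_left_mono) simp
        qed (simp add: k0)
      qed
      also have "\<dots> = (\<integral>\<^sup>+s. ennreal (k t s) \<partial>lborel) * U"
        by (rule nn_integral_multc) measurable
      also have "\<dots> \<le> ennreal q * U"
        by (rule mult_right_mono[OF mass]) simp
      also have "(\<integral>\<^sup>+\<omega>. \<Phi> t \<omega> \<partial>M) + ennreal q * U \<le> ennreal K + ennreal q * U"
        by (rule add_right_mono[OF \<Phi>K[OF t0]])
      also have "\<dots> = ennreal (K + q * U')"
        using K q U' by (simp add: ennreal_plus ennreal_mult')
      finally show ?thesis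
        by (simp add: add_left_mono)
    qed
    then have "U \<le> ennreal (K + q * U')"
      unfolding U_def by (intro SUP_least)
    then have "U' \<le> K + q * U'"
      using U' K q by (simp add: ennreal_le_iff del: ennreal_plus)
    then have "U' \<le> K / (1 - q)"
      using q by (simp add: pos_le_divide_eq algebra_simps)
    then have "U \<le> ennreal (K / (1 - q))"
      using U' by (simp add: ennreal_leI)
    moreover have "u T \<le> U"
      unfolding U_def using T by (intro SUP_upper) auto
    ultimately show ?thesis
      by (simp add: u_def)
  qed
  \<comment> \<open>Every continuous path is bounded on {0..T}, so the sets \<open>A n\<close>
    exhaust the space.\<close>
  have lim: "(SUP n. indicator (A n) \<omega> * ennreal \<bar>X T \<omega>\<bar>) = ennreal \<bar>X T \<omega>\<bar>" if "\<omega> \<in> space M" for \<omega>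
  proof -
    have "continuous_on {0..T} (\<lambda>t. X t \<omega>)"
      using cont by (rule continuous_on_subset) simp
    then obtain V where V: "\<And>t. t \<in> {0..T} \<Longrightarrow> \<bar>X t \<omega>\<bar> \<le> V"
      by (rule continuous_on_Icc_bounded) blast
    obtain N where N: "V \<le> real N"
      using real_arch_simple by blast
    have "\<bar>X (cl t) \<omega>\<bar> \<le> real N" for t
    proof -
      have "cl t \<in> {0..T}"
        using T by (auto simp: cl_def)
      then have "\<bar>X (cl t) \<omega>\<bar> \<le> V"
        using V by simp
      then show ?thesis
        using N by simp
    qed
    then have "\<omega> \<in> A N"
      using that by (simp add: A_def)
    then have "ennreal \<bar>X T \<omega>\<bar> = indicator (A N) \<omega> * ennreal \<bar>X T \<omega>\<bar>"
      by simp
    also have "\<dots> \<le> (SUP n. indicator (A n) \<omega> * ennreal \<bar>X T \<omega>\<bar>)"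
      by (rule SUP_upper) simp
    finally show ?thesis
      by (intro antisym SUP_least) (auto simp: indicator_def)
  qed
  have "(\<integral>\<^sup>+\<omega>. ennreal \<bar>X T \<omega>\<bar> \<partial>M) = (\<integral>\<^sup>+\<omega>. (SUP n. indicator (A n) \<omega> * ennreal \<bar>X T \<omega>\<bar>) \<partial>M)"
    by (intro nn_integral_cong) (simp only: lim)
  also have "\<dots> = (SUP n. \<integral>\<^sup>+\<omega>. indicator (A n) \<omega> * ennreal \<bar>X T \<omega>\<bar> \<partial>M)"
  proof (rule nn_integral_monotone_convergence_SUP)
    show "incseq (\<lambda>n \<omega>. indicator (A n) \<omega> * ennreal \<bar>X T \<omega>\<bar>)"
    proof (intro incseq_SucI le_funI mult_right_mono)
      fix n \<omega>
      show "indicator (A n) \<omega> \<le> (indicator (A (Suc n)) \<omega> :: ennreal)"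
        by (auto simp: A_def indicator_def intro: order_trans)
    qed simp
  qed measurable
  also have "\<dots> \<le> ennreal (K / (1 - q))"
    by (intro SUP_least un)
  finally show ?thesis .
qed

end

section \<open>The mean bound and the choice of \<delta>\<close>

lemma norm_X_cong:
  assumes "\<And>t. t \<ge> 0 \<Longrightarrow> m t = m' t"
  shows "norm_X \<beta> A m = norm_X \<beta> A m'"
  using assms by (simp add: norm_X_def E_decomposition_def)

lemma lp_norm_nn_integral_le:
  assumes \<phi>: "\<phi> \<in> lp_space q" and q: "q > 0" and less: "ennreal (lp_norm q \<phi>) < ennreal \<delta>"
    and F: "\<And>s. \<bar>F s\<bar> = indicator {0..} s * \<bar>\<phi> s\<bar>"
  shows "(\<integral>\<^sup>+s. ennreal (\<bar>F s\<bar> powr q) \<partial>lborel) \<le> ennreal (\<delta> powr q)"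
proof -
  let ?L = "LINT s:{0..}|lborel. \<bar>\<phi> s\<bar> powr q"
  have L0: "?L \<ge> 0"
    unfolding set_lebesgue_integral_def by (intro integral_nonneg_AE) auto
  have "lp_norm q \<phi> < \<delta>"
    using less L0 by (simp add: lp_norm_def ennreal_less_iff)
  then have "(?L powr (1 / q)) powr q \<le> \<delta> powr q"
    using q by (intro powr_mono2) (auto simp: lp_norm_def)
  then have L: "?L \<le> \<delta> powr q"
    using q L0 by (simp add: powr_powr)
  have "(\<integral>\<^sup>+s. ennreal (\<bar>F s\<bar> powr q) \<partial>lborel) = (\<integral>\<^sup>+s. ennreal (indicator {0..} s *\<^sub>R (\<bar>\<phi> s\<bar> powr q)) \<partial>lborel)"
    by (intro nn_integral_cong) (auto simp: F indicator_def)
  also have "\<dots> = ennreal ?L"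
    using \<phi> unfolding lp_space_def set_integrable_def set_lebesgue_integral_def
    by (intro nn_integral_eq_integral) auto
  finally show ?thesis
    using L by (simp add: ennreal_leI)
qed

context prob_space
begin

text \<open>Freezing time at 0 makes Z monotone on the whole line, as the deterministic deviation
  bound requires, and non-negativity identifies its mean on {0..} with \<open>mean_abs\<close>. The
  norm sees only t \<ge> 0, so the extension does not change it.\<close>

lemma monotone_E_process_deviation:
  assumes \<beta>: "0 < \<beta>" "\<beta> < 1" and l: "l > 0"
    and \<xi>: "monotone_E_process M \<beta> \<xi>" and less: "norm_X \<beta> A (mean_abs M \<xi>) < ennreal \<delta>"
    and c: "\<And>m \<delta> t. mono m \<Longrightarrow> (\<And>t. 0 \<le> m t) \<Longrightarrow> norm_X \<beta> A m < ennreal \<delta> \<Longrightarrow> t \<ge> 0 \<Longrightarrow>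
      m t - conv (resolvent \<beta> l) m t \<le> c * \<delta>"
  obtains Z where "\<And>\<omega>. continuous_on UNIV (\<lambda>t. Z t \<omega>)"
    and "(\<lambda>(t, \<omega>). Z t \<omega>) \<in> borel_measurable (borel \<Otimes>\<^sub>M M)"
    and "AE \<omega> in M. mono (\<lambda>t. Z t \<omega>) \<and> (\<forall>t. 0 \<le> Z t \<omega>) \<and> (\<forall>t\<ge>0. Z t \<omega> = \<xi> t \<omega>)"
    and "\<And>t. t \<ge> 0 \<Longrightarrow> (\<integral>\<^sup>+\<omega>. ennreal (Z t \<omega> - conv (resolvent \<beta> l) (\<lambda>s. Z s \<omega>) t) \<partial>M) \<le> ennreal (c * \<delta>)"
proof -
  have cp: "continuous_process M \<xi>" and int: "\<And>t. t \<ge> 0 \<Longrightarrow> integrable M (\<xi> t)"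
    and AE_\<xi>: "AE \<omega> in M. (\<forall>t\<ge>0. 0 \<le> \<xi> t \<omega>) \<and> mono_on {0..} (\<lambda>t. \<xi> t \<omega>)"
    using \<xi> by (auto simp: monotone_E_process_def in_E_in_mean_def)
  obtain Z where Z: "\<And>\<omega>. continuous_on UNIV (\<lambda>t. Z t \<omega>)"
      "(\<lambda>(t, \<omega>). Z t \<omega>) \<in> borel_measurable (borel \<Otimes>\<^sub>M M)"
      "AE \<omega> in M. \<forall>t. Z t \<omega> = \<xi> (max 0 t) \<omega>"
    using continuous_process_version[OF cp] by blast
  note [measurable (raw)] = measurable_process_compose[OF Z(2)]
  have good: "AE \<omega> in M. mono (\<lambda>t. Z t \<omega>) \<and> (\<forall>t. 0 \<le> Z t \<omega>) \<and> (\<forall>t\<ge>0. Z t \<omega> = \<xi> t \<omega>)"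
    using Z(3) AE_\<xi>
  proof eventually_elim
    case (elim \<omega>)
    then show ?case
      by (auto intro!: monoI dest: mono_onD[where r = "max 0 _" and s = "max 0 _"] simp: mono_on_def)
  qed
  have intZ: "integrable M (Z t)" for t
  proof (rule integrable_cong_AE_imp[OF int[of "max 0 t"]])
    show "AE \<omega> in M. \<xi> (max 0 t) \<omega> = Z t \<omega>"
      using Z(3) by eventually_elim simp
  qed auto
  have good': "AE \<omega> in M. mono (\<lambda>t. Z t \<omega>) \<and> (\<forall>t. 0 \<le> Z t \<omega>)"
    using good by eventually_elim simp
  define m where "m t = (\<integral>\<omega>. Z t \<omega> \<partial>M)" for t
  have "m t = mean_abs M \<xi> t" if "t \<ge> 0" for t
    unfolding m_def mean_abs_def
  proof (rule integral_cong_AE)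
    show "AE \<omega> in M. Z t \<omega> = \<bar>\<xi> t \<omega>\<bar>"
      using good
    proof eventually_elim
      case (elim \<omega>)
      then have "0 \<le> Z t \<omega>" "Z t \<omega> = \<xi> t \<omega>"
        using that by blast+
      then show ?case by simp
    qed
  qed (use int[OF that] in auto)
  then have "norm_X \<beta> A m < ennreal \<delta>"
    using less norm_X_cong[of m "mean_abs M \<xi>"] by simp
  note dev = expectation_deviation[OF \<beta>(1) less_imp_le[OF \<beta>(2)] l Z(2) good' intZ, folded m_def]
  show thesis
  proof (rule that[OF Z(1,2) good])
    fix t :: real assume t: "t \<ge> 0"
    have "m t - conv (resolvent \<beta> l) m t \<le> c * \<delta>"
      using dev(1,2)[OF t] \<open>norm_X \<beta> A m < ennreal \<delta>\<close> t by (intro c)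
    then show "(\<integral>\<^sup>+\<omega>. ennreal (Z t \<omega> - conv (resolvent \<beta> l) (\<lambda>s. Z s \<omega>) t) \<partial>M) \<le> ennreal (c * \<delta>)"
      using dev(3)[OF t] by (simp add: ennreal_leI)
  qed
qed

text \<open>Origin of the constant: c1 for each of \<xi>1 and \<xi>2, c2 for the term in f, and 1 /
  l, a bound on the mass of R / l, for the term in f', whose inner integral has mean at most
  \<delta>. The factor 1 / (1 - C / l) comes from absorbing C |X|.\<close>

lemma solution_mean_bound:
  fixes B X \<xi>1 \<xi>2 :: "real \<Rightarrow> 'a \<Rightarrow> real"
  assumes \<beta>: "0 < \<beta>" "\<beta> < 1" and l: "l > 0" and \<gamma>: "0 < \<gamma>" "\<gamma> < 1" and p: "p > 1 / \<beta>"
    and C: "0 < C" "C < l" and h: "\<And>u. \<bar>h u\<bar> \<le> C * \<bar>u\<bar>" "h \<in> borel_measurable borel"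
    and B: "fractional_brownian_motion M \<gamma> B" and adm: "admissible_noise_coeff \<gamma> p f"
    and \<xi>1: "monotone_E_process M \<beta> \<xi>1" "norm_X \<beta> A (mean_abs M \<xi>1) < ennreal \<delta>"
    and \<xi>2: "monotone_E_process M \<beta> \<xi>2" "norm_X \<beta> A (mean_abs M \<xi>2) < ennreal \<delta>"
    and X: "volterra_solution M \<beta> (- l) h f B (\<lambda>t \<omega>. \<xi>1 t \<omega> - \<xi>2 t \<omega>) X"
    and f1: "ennreal (lp_norm 1 (\<lambda>s. f s * s powr \<gamma>)) < ennreal \<delta>"
    and fp: "ennreal (lp_norm p (\<lambda>s. f s * s powr \<gamma>)) < ennreal \<delta>"
    and f': "ennreal (lp_norm 1 (\<lambda>s. deriv f s * s powr \<gamma>)) < ennreal \<delta>"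
    and \<delta>: "\<delta> > 0" and t: "t \<ge> 0"
    and c1: "c1 > 0" "\<And>m \<delta> t. mono m \<Longrightarrow> (\<And>t. 0 \<le> m t) \<Longrightarrow> norm_X \<beta> A m < ennreal \<delta> \<Longrightarrow> t \<ge> 0 \<Longrightarrow>
      m t - conv (resolvent \<beta> l) m t \<le> c1 * \<delta>"
    and c2: "c2 > 0" "\<And>F \<delta> t. \<delta> > 0 \<Longrightarrow> F \<in> borel_measurable borel \<Longrightarrow> (\<And>s. 0 \<le> F s) \<Longrightarrow>
      (\<integral>\<^sup>+s. ennreal (F s) \<partial>lborel) \<le> ennreal \<delta> \<Longrightarrow> (\<integral>\<^sup>+s. ennreal (F s powr p) \<partial>lborel) \<le> ennreal (\<delta> powr p) \<Longrightarrow>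
      (\<integral>\<^sup>+s. ennreal (frac_kernel \<beta> (t - s) * F s) \<partial>lborel) \<le> ennreal (c2 * \<delta>)"
  shows "(\<integral>\<^sup>+\<omega>. ennreal \<bar>X t \<omega>\<bar> \<partial>M) \<le> ennreal ((2 * c1 + c2 + 1 / l) * \<delta> / (1 - C / l))"
proof -
  let ?R = "resolvent \<beta> l"
  have \<beta>1: "\<beta> \<le> 1" using \<beta> by simp
  have R0: "?R s \<ge> 0" for s
    by (rule resolvent_nonneg[OF \<beta>(1) \<beta>1 l])
  define F where "F = restrict_pos f"
  define G where "G = restrict_pos (\<lambda>s. - deriv f s)"
  have [measurable]: "F \<in> borel_measurable borel" "G \<in> borel_measurable borel"
    unfolding F_def G_def using admissible_measurable[OF adm \<gamma>(2)] .
  have F0: "F s \<ge> 0" and G0: "G s \<ge> 0" for s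
    unfolding F_def G_def using admissible_nonneg[OF adm \<gamma>(2)] .
  obtain Z1 where Z1: "\<And>\<omega>. continuous_on UNIV (\<lambda>t. Z1 t \<omega>)"
      "(\<lambda>(t, \<omega>). Z1 t \<omega>) \<in> borel_measurable (borel \<Otimes>\<^sub>M M)"
      "AE \<omega> in M. mono (\<lambda>t. Z1 t \<omega>) \<and> (\<forall>t. 0 \<le> Z1 t \<omega>) \<and> (\<forall>t\<ge>0. Z1 t \<omega> = \<xi>1 t \<omega>)"
      "\<And>t. t \<ge> 0 \<Longrightarrow> (\<integral>\<^sup>+\<omega>. ennreal (Z1 t \<omega> - conv ?R (\<lambda>s. Z1 s \<omega>) t) \<partial>M) \<le> ennreal (c1 * \<delta>)"
    using monotone_E_process_deviation[OF \<beta> l \<xi>1 c1(2)] by blast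
  obtain Z2 where Z2: "\<And>\<omega>. continuous_on UNIV (\<lambda>t. Z2 t \<omega>)"
      "(\<lambda>(t, \<omega>). Z2 t \<omega>) \<in> borel_measurable (borel \<Otimes>\<^sub>M M)"
      "AE \<omega> in M. mono (\<lambda>t. Z2 t \<omega>) \<and> (\<forall>t. 0 \<le> Z2 t \<omega>) \<and> (\<forall>t\<ge>0. Z2 t \<omega> = \<xi>2 t \<omega>)"
      "\<And>t. t \<ge> 0 \<Longrightarrow> (\<integral>\<^sup>+\<omega>. ennreal (Z2 t \<omega> - conv ?R (\<lambda>s. Z2 s \<omega>) t) \<partial>M) \<le> ennreal (c1 * \<delta>)"
    using monotone_E_process_deviation[OF \<beta> l \<xi>2 c1(2)] by blast
  have cpB: "continuous_process M B"
    using B by (simp add: fractional_brownian_motion_def)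
  obtain ZB where ZB: "\<And>\<omega>. continuous_on UNIV (\<lambda>t. ZB t \<omega>)"
      "(\<lambda>(t, \<omega>). ZB t \<omega>) \<in> borel_measurable (borel \<Otimes>\<^sub>M M)"
      "AE \<omega> in M. \<forall>t. ZB t \<omega> = B (max 0 t) \<omega>"
    using continuous_process_version[OF cpB] by blast
  have cpX: "continuous_process M X"
    and sol: "AE \<omega> in M. \<forall>t\<ge>0. \<exists>I. has_young_integral (\<lambda>s. (t - s) powr \<beta> * f s) (\<lambda>s. B s \<omega>) 0 t I \<and>
        X t \<omega> = \<xi>1 t \<omega> - \<xi>2 t \<omega>
          + 1 / Gamma \<beta> * (LINT s:{0..t}|lborel. (t - s) powr (\<beta> - 1) * (- l * X s \<omega> + h (X s \<omega>)))
          + 1 / Gamma (\<beta> + 1) * I"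
    using X by (simp_all add: volterra_solution_def)
  obtain ZX where ZX: "\<And>\<omega>. continuous_on UNIV (\<lambda>t. ZX t \<omega>)"
      "(\<lambda>(t, \<omega>). ZX t \<omega>) \<in> borel_measurable (borel \<Otimes>\<^sub>M M)"
      "AE \<omega> in M. \<forall>t. ZX t \<omega> = X (max 0 t) \<omega>"
    using continuous_process_version[OF cpX] by blast
  note [measurable (raw)] = measurable_process_compose[OF Z1(2)] measurable_process_compose[OF Z2(2)]
    measurable_process_compose[OF ZB(2)] measurable_process_compose[OF ZX(2)]
  define k where "k t s = indicator {0..t} s * ?R (t - s) / l" for t s
  have [measurable]: "k t \<in> borel_measurable borel" for t
    unfolding k_def by measurable
  have k0: "k t s \<ge> 0" for t s
    using R0 l by (simp add: k_def)
  define \<Gamma> where "\<Gamma> \<omega> = (\<integral>\<^sup>+r. ennreal (G r * \<bar>ZB r \<omega>\<bar>) \<partial>lborel)" for \<omega>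
  define N where "N t \<omega> = (\<integral>\<^sup>+s. ennreal (k t s) * (ennreal (F s * \<bar>ZB s \<omega>\<bar>) + \<Gamma> \<omega>) \<partial>lborel)" for t \<omega>
  \<comment> \<open>The part of the pathwise bound without X, that is, the inhomogeneity of the
    Volterra inequality.\<close>
  define \<Phi> where "\<Phi> t \<omega> = ennreal (Z1 t \<omega> - conv ?R (\<lambda>s. Z1 s \<omega>) t) + ennreal (Z2 t \<omega> - conv ?R (\<lambda>s. Z2 s \<omega>) t) + N t \<omega>" for t \<omega>
  have [measurable]: "\<Gamma> \<in> borel_measurable M"
    unfolding \<Gamma>_def by measurable
  have [measurable]: "(\<lambda>\<omega>. conv ?R (\<lambda>s. Z1 s \<omega>) t) \<in> borel_measurable M" "(\<lambda>\<omega>. conv ?R (\<lambda>s. Z2 s \<omega>) t) \<in> borel_measurable M" for t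
    unfolding conv_def set_lebesgue_integral_def by measurable
  have [measurable]: "N t \<in> borel_measurable M" for t
    unfolding N_def by measurable
  have [measurable]: "\<Phi> t \<in> borel_measurable M" for t
    unfolding \<Phi>_def by measurable
  have path: "AE \<omega> in M. ennreal \<bar>ZX t \<omega>\<bar> \<le> \<Phi> t \<omega> + (\<integral>\<^sup>+s. ennreal (C * k t s) * ennreal \<bar>ZX s \<omega>\<bar> \<partial>lborel)" if t: "t \<ge> 0" for t
    using Z1(3) Z2(3) ZB(3) ZX(3) sol fractional_brownian_motion_at_0[OF B \<gamma>(1)] AE_space
  proof eventually_elim
    case (elim \<omega>)
    have [measurable]: "(\<lambda>s. ZX s \<omega>) \<in> borel_measurable borel" "(\<lambda>s. ZB s \<omega>) \<in> borel_measurable borel"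
      using elim(7) by measurable
    have eq: "\<exists>I. has_young_integral (\<lambda>s. (t - s) powr \<beta> * f s) (\<lambda>s. ZB s \<omega>) 0 t I \<and>
        ZX t \<omega> = Z1 t \<omega> - Z2 t \<omega>
          + 1 / Gamma \<beta> * (LINT s:{0..t}|lborel. (t - s) powr (\<beta> - 1) * (- l * ZX s \<omega> + h (ZX s \<omega>)))
          + 1 / Gamma (\<beta> + 1) * I" if t: "t \<ge> 0" for t
    proof -
      obtain I where I: "has_young_integral (\<lambda>s. (t - s) powr \<beta> * f s) (\<lambda>s. B s \<omega>) 0 t I"
        "X t \<omega> = \<xi>1 t \<omega> - \<xi>2 t \<omega>
          + 1 / Gamma \<beta> * (LINT s:{0..t}|lborel. (t - s) powr (\<beta> - 1) * (- l * X s \<omega> + h (X s \<omega>)))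
          + 1 / Gamma (\<beta> + 1) * I"
        using elim(5) t by blast
      have 1: "has_young_integral (\<lambda>s. (t - s) powr \<beta> * f s) (\<lambda>s. ZB s \<omega>) 0 t I"
        by (rule has_young_integral_cong[OF I(1)]) (use elim(3) in simp)
      have 2: "(LINT s:{0..t}|lborel. (t - s) powr (\<beta> - 1) * (- l * X s \<omega> + h (X s \<omega>))) =
          (LINT s:{0..t}|lborel. (t - s) powr (\<beta> - 1) * (- l * ZX s \<omega> + h (ZX s \<omega>)))"
        by (intro set_lebesgue_integral_cong) (use elim(4) in auto)
      have "ZX t \<omega> = X t \<omega>" "Z1 t \<omega> = \<xi>1 t \<omega>" "Z2 t \<omega> = \<xi>2 t \<omega>"
        using elim t by auto
      then show ?thesis
        using 1 I(2) unfolding 2 by auto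
    qed
    have "ZB 0 \<omega> = 0"
      using elim(3,6) by simp
    then have "ennreal \<bar>ZX t \<omega>\<bar> \<le> ennreal (Z1 t \<omega> - conv ?R (\<lambda>s. Z1 s \<omega>) t) + ennreal (Z2 t \<omega> - conv ?R (\<lambda>s. Z2 s \<omega>) t)
      + (\<integral>\<^sup>+s. ennreal (indicator {0..t} s * ?R (t - s) / l) *
          (ennreal C * ennreal \<bar>ZX s \<omega>\<bar> + ennreal (F s * \<bar>ZB s \<omega>\<bar>) + (\<integral>\<^sup>+r. ennreal (G r * \<bar>ZB r \<omega>\<bar>) \<partial>lborel)) \<partial>lborel)"
      unfolding F_def G_def using elim(1,2)
      by (intro pathwise_bound_nn[OF \<beta> l adm \<gamma>(2) h ZB(1) ZX(1) Z1(1) Z2(1) _ _ _ _ _ eq t]) auto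
    also have "(\<integral>\<^sup>+s. ennreal (indicator {0..t} s * ?R (t - s) / l) *
          (ennreal C * ennreal \<bar>ZX s \<omega>\<bar> + ennreal (F s * \<bar>ZB s \<omega>\<bar>) + (\<integral>\<^sup>+r. ennreal (G r * \<bar>ZB r \<omega>\<bar>) \<partial>lborel)) \<partial>lborel)
       = (\<integral>\<^sup>+s. ennreal (C * k t s) * ennreal \<bar>ZX s \<omega>\<bar> + ennreal (k t s) * (ennreal (F s * \<bar>ZB s \<omega>\<bar>) + \<Gamma> \<omega>) \<partial>lborel)"
      using C k0 unfolding k_def[symmetric] \<Gamma>_def[symmetric]
      by (intro nn_integral_cong) (simp add: ennreal_mult' distrib_left mult_ac add_ac)
    also have "\<dots> = (\<integral>\<^sup>+s. ennreal (C * k t s) * ennreal \<bar>ZX s \<omega>\<bar> \<partial>lborel) + N t \<omega>"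
      unfolding N_def by (rule nn_integral_add) measurable
    finally show ?case
      by (simp add: \<Phi>_def add_ac)
  qed
  have mass: "(\<integral>\<^sup>+s. ennreal (k t s) \<partial>lborel) \<le> ennreal (1 / l)" for t
  proof -
    have "(\<integral>\<^sup>+s. ennreal (k t s) \<partial>lborel) = (\<integral>\<^sup>+s. ennreal (indicator {0..t} s *\<^sub>R (?R (t - s) * 1) / l) \<partial>lborel)"
      by (intro nn_integral_cong) (simp add: k_def)
    also have "\<dots> = ennreal (conv ?R (\<lambda>_. 1) t / l)"
    proof -
      have "set_integrable lborel {0..t} (\<lambda>s. ?R (t - s) * 1)"
        by (rule conv_integrable[OF resolvent_integrable[OF \<beta>(1) \<beta>1 l], of _ _ 1]) auto
      then show ?thesis
        unfolding conv_def set_lebesgue_integral_def integral_divide_zero[symmetric] set_integrable_def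
        using R0 l by (intro nn_integral_eq_integral) auto
    qed
    also have "\<dots> \<le> ennreal (1 / l)"
      using conv_resolvent_const_le[OF \<beta>(1) \<beta>1 l, of 1 t] l by (intro ennreal_leI divide_right_mono) auto
    finally show ?thesis .
  qed
  \<comment> \<open>For s > 0 this is the moment bound E |B s| \<le> s^\<gamma>; for s \<le> 0 both
    sides vanish because H does.\<close>
  have EB: "(\<integral>\<^sup>+\<omega>. ennreal (H s * \<bar>ZB s \<omega>\<bar>) \<partial>M) \<le> ennreal (H s * s powr \<gamma>)"
    if H: "\<And>s. H s \<ge> 0" "\<And>s. s \<le> 0 \<Longrightarrow> H s = 0" for H :: "real \<Rightarrow> real" and s
  proof (cases "s > 0")
    case True
    have "(\<integral>\<^sup>+\<omega>. ennreal \<bar>ZB s \<omega>\<bar> \<partial>M) = (\<integral>\<^sup>+\<omega>. ennreal \<bar>B s \<omega>\<bar> \<partial>M)"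
      using ZB(3) True by (intro nn_integral_cong_AE) (auto elim!: eventually_mono)
    also have "\<dots> \<le> ennreal (s powr \<gamma>)"
      by (rule fractional_brownian_motion_moment[OF B True])
    finally have "ennreal (H s) * (\<integral>\<^sup>+\<omega>. ennreal \<bar>ZB s \<omega>\<bar> \<partial>M) \<le> ennreal (H s) * ennreal (s powr \<gamma>)"
      by (rule mult_left_mono) simp
    then show ?thesis
      using H by (simp add: ennreal_mult' nn_integral_cmult)
  qed (use H in simp)
  have E\<Gamma>: "(\<integral>\<^sup>+\<omega>. \<Gamma> \<omega> \<partial>M) \<le> ennreal \<delta>"
  proof -
    have "(\<integral>\<^sup>+\<omega>. \<Gamma> \<omega> \<partial>M) = (\<integral>\<^sup>+r. \<integral>\<^sup>+\<omega>. ennreal (G r * \<bar>ZB r \<omega>\<bar>) \<partial>M \<partial>lborel)"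
    proof -
      interpret pair_sigma_finite lborel M ..
      show ?thesis
        unfolding \<Gamma>_def by (rule Fubini') measurable
    qed
    also have "\<dots> \<le> (\<integral>\<^sup>+r. ennreal (\<bar>G r * r powr \<gamma>\<bar> powr 1) \<partial>lborel)"
      using G0 by (intro nn_integral_mono order_trans[OF EB[of G]]) (auto simp: G_def restrict_pos_def)
    also have "\<dots> \<le> ennreal (\<delta> powr 1)"
    proof (rule lp_norm_nn_integral_le[where \<phi> = "\<lambda>s. \<bar>deriv f s\<bar> * s powr \<gamma>"])
      show "(\<lambda>s. \<bar>deriv f s\<bar> * s powr \<gamma>) \<in> lp_space 1"
        using adm by (simp add: admissible_noise_coeff_def)
      show "ennreal (lp_norm 1 (\<lambda>s. \<bar>deriv f s\<bar> * s powr \<gamma>)) < ennreal \<delta>"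
        using f' by (simp add: lp_norm_def abs_mult)
      show "\<bar>G s * s powr \<gamma>\<bar> = indicator {0..} s * \<bar>\<bar>deriv f s\<bar> * s powr \<gamma>\<bar>" for s
        by (cases "s = 0") (auto simp: G_def restrict_pos_def abs_mult indicator_def)
    qed simp
    finally show ?thesis
      using \<delta> by simp
  qed
  have EN: "(\<integral>\<^sup>+\<omega>. N t \<omega> \<partial>M) \<le> ennreal (c2 * \<delta> + \<delta> / l)" if t: "t \<ge> 0" for t
  proof -
    have "(\<integral>\<^sup>+\<omega>. N t \<omega> \<partial>M) = (\<integral>\<^sup>+s. \<integral>\<^sup>+\<omega>. ennreal (k t s) * (ennreal (F s * \<bar>ZB s \<omega>\<bar>) + \<Gamma> \<omega>) \<partial>M \<partial>lborel)"
    proof -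
      interpret pair_sigma_finite lborel M ..
      show ?thesis
        unfolding N_def by (rule Fubini') measurable
    qed
    also have "\<dots> = (\<integral>\<^sup>+s. ennreal (k t s) * ((\<integral>\<^sup>+\<omega>. ennreal (F s * \<bar>ZB s \<omega>\<bar>) \<partial>M) + (\<integral>\<^sup>+\<omega>. \<Gamma> \<omega> \<partial>M)) \<partial>lborel)"
      by (intro nn_integral_cong) (simp add: nn_integral_cmult nn_integral_add)
    also have "\<dots> \<le> (\<integral>\<^sup>+s. ennreal (frac_kernel \<beta> (t - s) * (F s * s powr \<gamma>)) + ennreal (k t s) * ennreal \<delta> \<partial>lborel)"
    proof (rule nn_integral_mono)
      fix s
      \<comment> \<open>In the term with f the kernel R / l is enlarged to k, for which
        \<open>kernel_Lp_bound\<close> is available. In the term with f' it is kept, since there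
        only its mass counts.\<close>
      have "?R (t - s) / l \<le> frac_kernel \<beta> (t - s)"
        using resolvent_le_frac_kernel[OF \<beta>(1) \<beta>1 l, of "t - s"] l by (simp add: pos_divide_le_eq mult.commute)
      then have kk: "k t s \<le> frac_kernel \<beta> (t - s)"
        using \<beta> by (auto simp: k_def indicator_def frac_kernel_nonneg)
      have "ennreal (k t s) * (\<integral>\<^sup>+\<omega>. ennreal (F s * \<bar>ZB s \<omega>\<bar>) \<partial>M) \<le> ennreal (k t s) * ennreal (F s * s powr \<gamma>)"
        using F0 by (intro mult_left_mono EB) (auto simp: F_def restrict_pos_def)
      also have "\<dots> = ennreal (k t s * (F s * s powr \<gamma>))"
        using k0 F0 by (simp add: ennreal_mult')
      also have "\<dots> \<le> ennreal (frac_kernel \<beta> (t - s) * (F s * s powr \<gamma>))"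
        using kk F0 by (intro ennreal_leI mult_right_mono) auto
      finally have "ennreal (k t s) * (\<integral>\<^sup>+\<omega>. ennreal (F s * \<bar>ZB s \<omega>\<bar>) \<partial>M) \<le> ennreal (frac_kernel \<beta> (t - s) * (F s * s powr \<gamma>))" .
      moreover have "ennreal (k t s) * (\<integral>\<^sup>+\<omega>. \<Gamma> \<omega> \<partial>M) \<le> ennreal (k t s) * ennreal \<delta>"
        by (rule mult_left_mono[OF E\<Gamma>]) simp
      ultimately show "ennreal (k t s) * ((\<integral>\<^sup>+\<omega>. ennreal (F s * \<bar>ZB s \<omega>\<bar>) \<partial>M) + (\<integral>\<^sup>+\<omega>. \<Gamma> \<omega> \<partial>M))
          \<le> ennreal (frac_kernel \<beta> (t - s) * (F s * s powr \<gamma>)) + ennreal (k t s) * ennreal \<delta>"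
        unfolding distrib_left by (rule add_mono)
    qed
    also have "\<dots> = (\<integral>\<^sup>+s. ennreal (frac_kernel \<beta> (t - s) * (F s * s powr \<gamma>)) \<partial>lborel) + (\<integral>\<^sup>+s. ennreal (k t s) \<partial>lborel) * ennreal \<delta>"
      by (simp add: nn_integral_add nn_integral_multc)
    also have "\<dots> \<le> ennreal (c2 * \<delta>) + ennreal (1 / l) * ennreal \<delta>"
    proof (rule add_mono)
      have Fs: "\<bar>F s * s powr \<gamma>\<bar> = indicator {0..} s * \<bar>f s * s powr \<gamma>\<bar>" for s
        by (cases "s = 0") (auto simp: F_def restrict_pos_def abs_mult indicator_def)
      have lp: "(\<lambda>s. f s * s powr \<gamma>) \<in> lp_space 1" "(\<lambda>s. f s * s powr \<gamma>) \<in> lp_space p"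
        using adm by (auto simp: admissible_noise_coeff_def)
      have p0: "p > 0"
        using p \<beta> by (meson less_trans zero_less_divide_1_iff)
      show "(\<integral>\<^sup>+s. ennreal (frac_kernel \<beta> (t - s) * (F s * s powr \<gamma>)) \<partial>lborel) \<le> ennreal (c2 * \<delta>)"
      proof (rule c2(2)[OF \<delta>])
        show "(\<integral>\<^sup>+s. ennreal (F s * s powr \<gamma>) \<partial>lborel) \<le> ennreal \<delta>"
          using lp_norm_nn_integral_le[OF lp(1) zero_less_one f1 Fs] F0 \<delta> by simp
        show "(\<integral>\<^sup>+s. ennreal ((F s * s powr \<gamma>) powr p) \<partial>lborel) \<le> ennreal (\<delta> powr p)"
          using lp_norm_nn_integral_le[OF lp(2) p0 fp Fs] F0 by simp
      qed (use F0 in auto)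
      show "(\<integral>\<^sup>+s. ennreal (k t s) \<partial>lborel) * ennreal \<delta> \<le> ennreal (1 / l) * ennreal \<delta>"
        by (rule mult_right_mono[OF mass]) simp
    qed
    also have "\<dots> = ennreal (c2 * \<delta> + \<delta> / l)"
      using c2(1) \<delta> l by (simp add: ennreal_mult'[symmetric] ennreal_plus[symmetric] del: ennreal_plus)
    finally show ?thesis .
  qed
  have E\<Phi>: "(\<integral>\<^sup>+\<omega>. \<Phi> t \<omega> \<partial>M) \<le> ennreal ((2 * c1 + c2 + 1 / l) * \<delta>)" if t: "t \<ge> 0" for t
  proof -
    have "(\<integral>\<^sup>+\<omega>. \<Phi> t \<omega> \<partial>M) = (\<integral>\<^sup>+\<omega>. ennreal (Z1 t \<omega> - conv ?R (\<lambda>s. Z1 s \<omega>) t) \<partial>M)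
        + (\<integral>\<^sup>+\<omega>. ennreal (Z2 t \<omega> - conv ?R (\<lambda>s. Z2 s \<omega>) t) \<partial>M) + (\<integral>\<^sup>+\<omega>. N t \<omega> \<partial>M)"
      unfolding \<Phi>_def by (simp add: nn_integral_add)
    also have "\<dots> \<le> ennreal (c1 * \<delta>) + ennreal (c1 * \<delta>) + ennreal (c2 * \<delta> + \<delta> / l)"
      by (intro add_mono Z1(4)[OF t] Z2(4)[OF t] EN[OF t])
    also have "\<dots> = ennreal ((2 * c1 + c2 + 1 / l) * \<delta>)"
      using c1(1) c2(1) \<delta> l by (simp add: ennreal_plus[symmetric] algebra_simps del: ennreal_plus)
    finally show ?thesis .
  qed
  have "(\<integral>\<^sup>+\<omega>. ennreal \<bar>ZX t \<omega>\<bar> \<partial>M) \<le> ennreal ((2 * c1 + c2 + 1 / l) * \<delta> / (1 - C / l))"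
  proof (rule volterra_expectation_bound[OF ZX(2) ZX(1) _ _ _ _ _ _ E\<Phi> _ path t])
    show "(\<integral>\<^sup>+s. ennreal (C * k t s) \<partial>lborel) \<le> ennreal (C / l)" for t
    proof -
      have "(\<integral>\<^sup>+s. ennreal (C * k t s) \<partial>lborel) = ennreal C * (\<integral>\<^sup>+s. ennreal (k t s) \<partial>lborel)"
        using C by (simp add: ennreal_mult' nn_integral_cmult)
      also have "\<dots> \<le> ennreal C * ennreal (1 / l)"
        by (rule mult_left_mono[OF mass]) simp
      also have "\<dots> = ennreal (C / l)"
        using C l by (simp add: ennreal_mult'[symmetric])
      finally show ?thesis .
    qed
    show "C / l < 1" "0 \<le> C / l" "0 \<le> (2 * c1 + c2 + 1 / l) * \<delta>"
      using C l c1(1) c2(1) \<delta> by (auto simp: field_simps)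
    show "C * k t s = 0" if "s \<notin> {0..t}" for t s
      using that by (simp add: k_def)
  qed measurable
  also have "(\<integral>\<^sup>+\<omega>. ennreal \<bar>ZX t \<omega>\<bar> \<partial>M) = (\<integral>\<^sup>+\<omega>. ennreal \<bar>X t \<omega>\<bar> \<partial>M)"
    using ZX(3) t by (intro nn_integral_cong_AE) (auto elim!: eventually_mono)
  finally show ?thesis .
qed

end

theorem theorem4p9:
  fixes M :: "'a measure" and B :: "real \<Rightarrow> 'a \<Rightarrow> real"
    and \<beta> A \<gamma> p \<delta>\<^sub>0 C :: real and h :: "real \<Rightarrow> real"
  assumes "prob_space M" and "complete_measure M"
    and "0 < \<beta>" and "\<beta> < 1" and "A < 0" and "0 < \<gamma>" and "\<gamma> < 1" and "\<beta> + \<gamma> > 1" and "p > 1 / \<beta>"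
    and "mono h" and "locally_lipschitz h" and "concave_on {0..} h" and "convex_on {..0} h"
    and "\<delta>\<^sub>0 > 0" and "C > 0" and "A + C < 0"
    and "\<And>x. \<bar>x\<bar> < \<delta>\<^sub>0 \<Longrightarrow> \<bar>h x\<bar> \<le> C * \<bar>x\<bar>"
    and "fractional_brownian_motion M \<gamma> B"
  shows "\<forall>\<epsilon>>0. \<exists>\<delta>>0. \<forall>f \<xi>1 \<xi>2 X.
    admissible_noise_coeff \<gamma> p f \<longrightarrow>
    monotone_E_process M \<beta> \<xi>1 \<longrightarrow> monotone_E_process M \<beta> \<xi>2 \<longrightarrow>
    volterra_solution M \<beta> A h f B (\<lambda>t \<omega>. \<xi>1 t \<omega> - \<xi>2 t \<omega>) X \<longrightarrow>
    norm_X \<beta> A (mean_abs M \<xi>1) + norm_X \<beta> A (mean_abs M \<xi>2)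
      + ennreal (lp_norm 1 (\<lambda>s. f s * s powr \<gamma>)) + ennreal (lp_norm p (\<lambda>s. f s * s powr \<gamma>))
      + ennreal (lp_norm 1 (\<lambda>s. deriv f s * s powr \<gamma>)) < ennreal \<delta> \<longrightarrow>
    (SUP t\<in>{0..}. \<integral>\<^sup>+\<omega>. ennreal \<bar>X t \<omega>\<bar> \<partial>M) < ennreal \<epsilon>"
proof (intro allI impI)
  fix \<epsilon> :: real assume \<epsilon>: "\<epsilon> > 0"
  interpret prob_space M by fact
  define l where "l = - A"
  have l: "l > 0" "C < l" "A = - l"
    using assms by (auto simp: l_def)
  have h: "\<bar>h u\<bar> \<le> C * \<bar>u\<bar>" for u
    by (rule concave_convex_linear_bound[OF assms(10,12,13,14,17)])
  have hm: "h \<in> borel_measurable borel"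
    using assms(10) by (rule borel_measurable_mono)
  obtain c1 where c1: "c1 > 0" "\<And>m \<delta> t. mono m \<Longrightarrow> (\<And>t. 0 \<le> m t) \<Longrightarrow> norm_X \<beta> A m < ennreal \<delta> \<Longrightarrow> t \<ge> 0 \<Longrightarrow>
      m t - conv (resolvent \<beta> l) m t \<le> c1 * \<delta>"
    using mean_deviation_bound[OF assms(3,4) l(1), of A] by blast
  obtain c2 where c2: "c2 > 0" "\<And>F \<delta> t. \<delta> > 0 \<Longrightarrow> F \<in> borel_measurable borel \<Longrightarrow> (\<And>s. 0 \<le> F s) \<Longrightarrow>
      (\<integral>\<^sup>+s. ennreal (F s) \<partial>lborel) \<le> ennreal \<delta> \<Longrightarrow> (\<integral>\<^sup>+s. ennreal (F s powr p) \<partial>lborel) \<le> ennreal (\<delta> powr p) \<Longrightarrow>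
      (\<integral>\<^sup>+s. ennreal (frac_kernel \<beta> (t - s) * F s) \<partial>lborel) \<le> ennreal (c2 * \<delta>)"
    using kernel_Lp_bound[OF assms(3,4,9)] by blast
  define c where "c = (2 * c1 + c2 + 1 / l) / (1 - C / l)"
  have c: "c > 0"
    using c1(1) c2(1) l by (auto simp: c_def intro!: divide_pos_pos add_pos_pos)
  show "\<exists>\<delta>>0. \<forall>f \<xi>1 \<xi>2 X.
    admissible_noise_coeff \<gamma> p f \<longrightarrow>
    monotone_E_process M \<beta> \<xi>1 \<longrightarrow> monotone_E_process M \<beta> \<xi>2 \<longrightarrow>
    volterra_solution M \<beta> A h f B (\<lambda>t \<omega>. \<xi>1 t \<omega> - \<xi>2 t \<omega>) X \<longrightarrow>
    norm_X \<beta> A (mean_abs M \<xi>1) + norm_X \<beta> A (mean_abs M \<xi>2)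
      + ennreal (lp_norm 1 (\<lambda>s. f s * s powr \<gamma>)) + ennreal (lp_norm p (\<lambda>s. f s * s powr \<gamma>))
      + ennreal (lp_norm 1 (\<lambda>s. deriv f s * s powr \<gamma>)) < ennreal \<delta> \<longrightarrow>
    (SUP t\<in>{0..}. \<integral>\<^sup>+\<omega>. ennreal \<bar>X t \<omega>\<bar> \<partial>M) < ennreal \<epsilon>"
  proof (rule exI[of _ "\<epsilon> / (2 * c)"], intro conjI allI impI)
    \<comment> \<open>This \<delta> gives every mean the bound \<epsilon> / 2, so that the supremum
      over t stays strictly below \<epsilon>.\<close>
    let ?\<delta> = "\<epsilon> / (2 * c)"
    show \<delta>: "?\<delta> > 0"
      using \<epsilon> c by simp
    fix f :: "real \<Rightarrow> real" and \<xi>1 \<xi>2 X :: "real \<Rightarrow> 'a \<Rightarrow> real"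
    assume adm: "admissible_noise_coeff \<gamma> p f" and \<xi>: "monotone_E_process M \<beta> \<xi>1" "monotone_E_process M \<beta> \<xi>2"
      and X: "volterra_solution M \<beta> A h f B (\<lambda>t \<omega>. \<xi>1 t \<omega> - \<xi>2 t \<omega>) X"
      and sum: "norm_X \<beta> A (mean_abs M \<xi>1) + norm_X \<beta> A (mean_abs M \<xi>2)
      + ennreal (lp_norm 1 (\<lambda>s. f s * s powr \<gamma>)) + ennreal (lp_norm p (\<lambda>s. f s * s powr \<gamma>))
      + ennreal (lp_norm 1 (\<lambda>s. deriv f s * s powr \<gamma>)) < ennreal ?\<delta>"
    have n: "norm_X \<beta> A (mean_abs M \<xi>1) < ennreal ?\<delta>" "norm_X \<beta> A (mean_abs M \<xi>2) < ennreal ?\<delta>"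
      "ennreal (lp_norm 1 (\<lambda>s. f s * s powr \<gamma>)) < ennreal ?\<delta>" "ennreal (lp_norm p (\<lambda>s. f s * s powr \<gamma>)) < ennreal ?\<delta>"
      "ennreal (lp_norm 1 (\<lambda>s. deriv f s * s powr \<gamma>)) < ennreal ?\<delta>"
      by (rule le_less_trans[OF _ sum], simp add: add_increasing add_increasing2)+
    have bd: "(\<integral>\<^sup>+\<omega>. ennreal \<bar>X t \<omega>\<bar> \<partial>M) \<le> ennreal (\<epsilon> / 2)" if "t \<ge> 0" for t
    proof -
      have "(\<integral>\<^sup>+\<omega>. ennreal \<bar>X t \<omega>\<bar> \<partial>M) \<le> ennreal ((2 * c1 + c2 + 1 / l) * ?\<delta> / (1 - C / l))"
        by (rule solution_mean_bound[OF assms(3,4) l(1) assms(6,7,9,15) l(2) h hm assms(18) adm \<xi>(1) n(1) \<xi>(2) n(2)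
              X[unfolded l(3)] n(3-5) \<delta> that c1 c2])
      also have "(2 * c1 + c2 + 1 / l) * ?\<delta> / (1 - C / l) = c * ?\<delta>"
        by (simp add: c_def)
      also have "\<dots> = \<epsilon> / 2"
        using c by simp
      finally show ?thesis .
    qed
    have "(SUP t\<in>{0..}. \<integral>\<^sup>+\<omega>. ennreal \<bar>X t \<omega>\<bar> \<partial>M) \<le> ennreal (\<epsilon> / 2)"
      using bd by (intro SUP_least) auto
    also have "\<dots> < ennreal \<epsilon>"
      using \<epsilon> by (simp add: ennreal_less_iff)
    finally show "(SUP t\<in>{0..}. \<integral>\<^sup>+\<omega>. ennreal \<bar>X t \<omega>\<bar> \<partial>M) < ennreal \<epsilon>" .
  qed
qed

end
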